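(* Let $X=X(\Sigma)$ be a pure $\mathbb{Q}$-factorial complete toric variety over an algebraically closed field of characteristic $0$, let $T=\operatorname{Tors}(\operatorname{Cl}(X))$, $r=\operatorname{rk}\operatorname{Cl}(X)$, and choose an isomorphism $\operatorname{Cl}(X)\cong\mathbb{Z}^r\oplus T$ such that $\operatorname{Pic}(X)$ is mapped into $\mathbb{Z}^r$. Let $V$ be a fan matrix of $X$ and let $Q$ be the weight matrix corresponding to this choice. Then, for $\mathbf x\in\mathbb{Z}^r$, $$\mathbf x\in\operatorname{Pic}(X)\ \Longleftrightarrow\ \mathbf x\in\bigcap_{I\in\mathcal{I}^\Sigma}\mathcal{L}_c(Q_I)\ \text{ and }\ \mathbf u_{IJ}\in\mathcal{L}_r(V)\ \text{ for all } I,J\in\mathcal{I}^\Sigma,$$ where $\mathbf u_{IJ}=\mathbf a_I-\mathbf a_J$ and, for each $I\in\mathcal I^\Sigma$, $\mathbf a_I$ is the unique element of $E_I$ with $Q\cdot\mathbf a_I=\mathbf x$.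
   Context: Purity. A free part of a finitely generated abelian group $G$ is a free subgroup $L$ with $G=L\oplus\operatorname{Tors}(G)$. A complete toric variety $X$ (for which $\operatorname{Cl}(X)$ is finitely generated and $\operatorname{Pic}(X)$ is free and canonically embedded in $\operatorname{Cl}(X)$) is pure if $\operatorname{Pic}(X)$ is contained in some free part of $\operatorname{Cl}(X)$. Let $n=\dim X$, and let $\mathbf v_1,\dots,\mathbf v_{n+r}$ be the primitive generators of the rays of $\Sigma$ in $N\cong\mathbb Z^n$. The fan matrix $V$ is the $n\times(n+r)$ matrix with columns $\mathbf v_1,\dots,\mathbf v_{n+r}$. The group of torus invariant Weil divisors is $\mathcal W_{\mathbb T}(X)=\bigoplus_j\mathbb Z D_j\cong\mathbb Z^{n+r}$, and $d_X:\mathcal W_{\mathbb T}(X)\twoheadrightarrow\operatorname{Cl}(X)$ sends a divisor to its class. Given $\operatorname{Cl}(X)\cong\mathbb Z^r\oplus T$, the weight matrix $Q$ is the $r\times(n+r)$ integer matrix representing the composition of $d_X$ with the projection $\operatorname{Cl}(X)\to\mathbb Z^r$. Notation. For $I\subseteq\{1,\dots,n+r\}$: $A_I$ is the submatrix of $A$ given by the columns indexed by $I$, and $A^I$ the submatrix given by the columns indexed by the complement of $I$. $\mathcal L_r(A)$ and $\mathcal L_c(A)$ are the lattices spanned by the rows, respectively the columns, of $A$. $\mathcal I^\Sigma=\{I\subseteq\{1,\dots,n+r\}: \langle V^I\rangle\in\Sigma(n)\}$, where $\langle V^I\rangle$ is the cone generated by the columns of $V^I$; each such $I$ has $r$ elements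 and $\det(Q_I)\neq0$. $E_I=\{(x_1,\dots,x_{n+r})\in\mathbb Z^{n+r}: x_i=0\ \forall i\notin I\}$. For $\mathbf x\in\bigcap_{I\in\mathcal I^\Sigma}\mathcal L_c(Q_I)$ and $I\in\mathcal I^\Sigma$ there is a unique $\mathbf a_I\in E_I$ with $Q\cdot\mathbf a_I=\mathbf x$ (tuples are regarded as column vectors when multiplied by $Q$). An element $\mathbf x\in\mathbb Z^r$ is identified with $(\mathbf x,0)\in\mathbb Z^r\oplus T\cong\operatorname{Cl}(X)$. *)

theory Defs
  imports
    "HOL-Analysis.Analysis"
    "HOL-Algebra.Algebra"
    "HOL-Algebra.Algebraic_Closure_Type"
    "HOL-Library.Poly_Mapping"
    "HOL-Computational_Algebra.Fraction_Field"
begin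

section \<open>Integral separated schemes inside their function field\<close>

text \<open>
  An integral separated scheme with function field \<open>K\<close> is recorded by its atlas: the set of the
  coordinate rings, as subrings of \<open>K\<close>, of the members of an affine open cover.  Since the scheme
  is separated, a point \<open>x\<close> is determined by its local ring \<open>\<O>\<^sub>x \<subseteq> K\<close>, and points
  of different charts are identified by the gluing exactly when their local rings coincide.  So
  points are represented by their local rings.  A prime divisor is represented by its generic point.
\<close>

definition subring_of_type :: "'K::field set \<Rightarrow> 'K ring" where
  "subring_of_type A = ring_of_type_algebra\<lparr>carrier := A\<rparr>"

definition Spec :: "'K::field set \<Rightarrow> 'K set set" where
  "Spec A = {p. primeideal p (subring_of_type A)}"

definition localization :: "'K::field set \<Rightarrow> 'K set \<Rightarrow> 'K set" where
  "localization A p = {a / b | a b. a \<in> A \<and> b \<in> A - p}"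

definition nonunits :: "'K::field set \<Rightarrow> 'K set" where
  "nonunits A = A - Units (subring_of_type A)"

definition points :: "'K::field set set \<Rightarrow> 'K set set" where
  "points \<XX> = (\<Union>A\<in>\<XX>. localization A ` Spec A)"

text \<open>The topology glued from the Zariski topologies of the charts, whose open sets are the
  complements of the sets of primes containing a given subset.\<close>

definition zariski_open :: "'K::field set set \<Rightarrow> 'K set set \<Rightarrow> bool" where
  "zariski_open \<XX> U \<longleftrightarrow> U \<subseteq> points \<XX> \<and>
     (\<forall>A\<in>\<XX>. \<exists>S\<subseteq>A. \<forall>p\<in>Spec A. localization A p \<in> U \<longleftrightarrow> \<not> S \<subseteq> p)"

text \<open>Points of codimension one: a local domain has Krull dimension one iff it has exactly two
  prime ideals, namely zero and the maximal ideal.\<close>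

definition prime_divisors :: "'K::field set set \<Rightarrow> 'K set set" where
  "prime_divisors \<XX> = {P \<in> points \<XX>. card (Spec P) = 2}"

text \<open>The normalized valuation of a discrete valuation ring \<open>P\<close> with fraction field \<open>K\<close>; only used
  for nonzero \<open>f\<close> and for the local rings \<open>P\<close> of prime divisors of normal schemes.\<close>

definition ord_at :: "'K::field set \<Rightarrow> 'K \<Rightarrow> int" where
  "ord_at P f = (THE k. \<exists>t\<in>P. \<exists>u\<in>Units (subring_of_type P).
     nonunits P = PIdl\<^bsub>subring_of_type P\<^esub> t \<and> f = u * t powi k)"

abbreviation Weil_divisors :: "'K::field set set \<Rightarrow> ('K set \<Rightarrow>\<^sub>0 int) monoid" where
  "Weil_divisors \<XX> \<equiv> free_Abelian_group (prime_divisors \<XX>)"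

definition principal_divisors :: "'K::field set set \<Rightarrow> ('K set \<Rightarrow>\<^sub>0 int) set" where
  "principal_divisors \<XX> = {D \<in> carrier (Weil_divisors \<XX>).
     \<exists>f. f \<noteq> 0 \<and> (\<forall>P\<in>prime_divisors \<XX>. Poly_Mapping.lookup D P = ord_at P f)}"

definition Cartier_divisors :: "'K::field set set \<Rightarrow> ('K set \<Rightarrow>\<^sub>0 int) set" where
  "Cartier_divisors \<XX> = {D \<in> carrier (Weil_divisors \<XX>).
     \<forall>x\<in>points \<XX>. \<exists>U. zariski_open \<XX> U \<and> x \<in> U \<and>
       (\<exists>f. f \<noteq> 0 \<and> (\<forall>P\<in>prime_divisors \<XX> \<inter> U. Poly_Mapping.lookup D P = ord_at P f))}"

definition divisor_class :: "'K::field set set \<Rightarrow> ('K set \<Rightarrow>\<^sub>0 int) \<Rightarrow> ('K set \<Rightarrow>\<^sub>0 int) set" where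
  "divisor_class \<XX> D = principal_divisors \<XX> #>\<^bsub>Weil_divisors \<XX>\<^esub> D"

definition Cl :: "'K::field set set \<Rightarrow> ('K set \<Rightarrow>\<^sub>0 int) set monoid" where
  "Cl \<XX> = Weil_divisors \<XX> Mod principal_divisors \<XX>"

text \<open>The Picard group of a normal variety, in its canonical embedding into the class group.\<close>

definition Pic :: "'K::field set set \<Rightarrow> ('K set \<Rightarrow>\<^sub>0 int) set set" where
  "Pic \<XX> = divisor_class \<XX> ` Cartier_divisors \<XX>"

definition Q_factorial :: "'K::field set set \<Rightarrow> bool" where
  "Q_factorial \<XX> \<longleftrightarrow>
     (\<forall>D\<in>carrier (Weil_divisors \<XX>). \<exists>m>0. frag_cmul m D \<in> Cartier_divisors \<XX>)"

definition valuation_ring :: "'K::field set \<Rightarrow> bool" where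
  "valuation_ring R \<longleftrightarrow> subring R ring_of_type_algebra \<and> (\<forall>f. f \<in> R \<or> inverse f \<in> R)"

text \<open>Completeness of a variety over the ground field \<open>k \<subseteq> K\<close>, in Zariski's form: every valuation
  ring of \<open>K / k\<close> has a centre on the variety, i.e. dominates one of its local rings.\<close>

definition complete_variety :: "'K::field set \<Rightarrow> 'K set set \<Rightarrow> bool" where
  "complete_variety k \<XX> \<longleftrightarrow>
     (\<forall>R. valuation_ring R \<and> k \<subseteq> R \<longrightarrow>
       (\<exists>x\<in>points \<XX>. x \<subseteq> R \<and> nonunits x = nonunits R \<inter> x))"

section \<open>Purity\<close>

definition Tors :: "('a, 'b) monoid_scheme \<Rightarrow> 'a set" where
  "Tors G = {x \<in> carrier G. \<exists>m>0. x [^]\<^bsub>G\<^esub> (m::nat) = \<one>\<^bsub>G\<^esub>}"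

text \<open>A basis of a free subgroup consists of elements of the group, so its type is no restriction.\<close>

definition free_part :: "('a, 'b) monoid_scheme \<Rightarrow> 'a set \<Rightarrow> bool" where
  "free_part G L \<longleftrightarrow> subgroup L G \<and>
     (\<exists>B::'a set. G\<lparr>carrier := L\<rparr> \<cong> free_Abelian_group B) \<and>
     L \<inter> Tors G = {\<one>\<^bsub>G\<^esub>} \<and> L <#>\<^bsub>G\<^esub> Tors G = carrier G"

definition pure :: "'K::field set set \<Rightarrow> bool" where
  "pure \<XX> \<longleftrightarrow> (\<exists>L. free_part (Cl \<XX>) L \<and> Pic \<XX> \<subseteq> L)"

section \<open>Fans and toric varieties\<close>

definition real_vec :: "int^'n \<Rightarrow> real^'n" where
  "real_vec v = (\<chi> i. real_of_int (v $ i))"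

definition rational_cone :: "(real^'n) set \<Rightarrow> bool" where
  "rational_cone \<sigma> \<longleftrightarrow> (\<exists>S. finite S \<and> \<sigma> = convex_cone hull (real_vec ` S))"

text \<open>The nonempty convex-geometric faces of a polyhedral cone are its intersections with
  supporting hyperplanes through the origin; \<open>face_of\<close> also admits the empty set.\<close>

definition fan :: "(real^'n) set set \<Rightarrow> bool" where
  "fan \<Sigma> \<longleftrightarrow> finite \<Sigma> \<and>
     (\<forall>\<sigma>\<in>\<Sigma>. rational_cone \<sigma> \<and> (\<forall>x. x \<in> \<sigma> \<and> - x \<in> \<sigma> \<longrightarrow> x = 0)) \<and>
     (\<forall>\<sigma>\<in>\<Sigma>. \<forall>\<tau>. \<tau> face_of \<sigma> \<and> \<tau> \<noteq> {} \<longrightarrow> \<tau> \<in> \<Sigma>) \<and>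
     (\<forall>\<sigma>\<in>\<Sigma>. \<forall>\<tau>\<in>\<Sigma>. \<sigma> \<inter> \<tau> face_of \<sigma> \<and> \<sigma> \<inter> \<tau> face_of \<tau>)"

text \<open>
  The lattice \<open>N\<close> is \<open>int^'n\<close>; its dual \<open>M\<close> is \<open>'n \<Rightarrow>\<^sub>0 int\<close>, so that the group algebra
  \<open>k[M]\<close> is the ring \<open>('n \<Rightarrow>\<^sub>0 int) \<Rightarrow>\<^sub>0 'k\<close> with its convolution product.  The linear
  order on the index type serves only to make the library's integral domain instance applicable.
\<close>

type_synonym ('n, 'k) toric_field = "(('n \<Rightarrow>\<^sub>0 int) \<Rightarrow>\<^sub>0 'k) fract"

definition pairing :: "('n::finite \<Rightarrow>\<^sub>0 int) \<Rightarrow> real^'n \<Rightarrow> real" where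
  "pairing m v = (\<Sum>i\<in>UNIV. real_of_int (Poly_Mapping.lookup m i) * v $ i)"

text \<open>The image in the fraction field of the span of the characters \<open>\<chi>\<^sup>m\<close>, \<open>m \<in> S\<close>.\<close>

definition character_span ::
    "('n::{finite,linorder} \<Rightarrow>\<^sub>0 int) set \<Rightarrow> ('n, 'k::field) toric_field set" where
  "character_span S = (\<lambda>f. Fract f 1) ` {f. Poly_Mapping.keys f \<subseteq> S}"

definition ground_field :: "('n::{finite,linorder}, 'k::field) toric_field set" where
  "ground_field = character_span {0}"

definition dual_monoid :: "(real^'n) set \<Rightarrow> ('n::finite \<Rightarrow>\<^sub>0 int) set" where
  "dual_monoid \<sigma> = {m. \<forall>v\<in>\<sigma>. pairing m v \<ge> 0}"

definition toric_variety ::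
    "(real^'n::{finite,linorder}) set set \<Rightarrow> ('n, 'k::field) toric_field set set" where
  "toric_variety \<Sigma> = (\<lambda>\<sigma>. character_span (dual_monoid \<sigma>)) ` \<Sigma>"

definition primitive_generators :: "(real^'n) set set \<Rightarrow> (int^'n) set" where
  "primitive_generators \<Sigma> =
     {v. Gcd (range (vec_nth v)) = 1 \<and> convex_cone hull {real_vec v} \<in> \<Sigma>}"

text \<open>The invariant prime divisor of the ray \<open>\<rho>\<close> generated by \<open>v\<close>.  It is the closure of
  the torus orbit of \<open>\<rho>\<close>, which is the closed subset of the chart of \<open>\<rho>\<close> whose ideal is
  spanned by the characters \<open>\<chi>\<^sup>m\<close> with \<open>\<langle>m, v\<rangle> > 0\<close>.\<close>

definition ray_divisor :: "int^'n::{finite,linorder} \<Rightarrow> ('n, 'k::field) toric_field set" where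
  "ray_divisor v = localization
     (character_span (dual_monoid (convex_cone hull {real_vec v})))
     (character_span {m. pairing m (real_vec v) > 0})"

section \<open>Fan matrix, weight matrix and lattices\<close>

definition fan_matrix :: "(real^'n) set set \<Rightarrow> int^'j^'n \<Rightarrow> bool" where
  "fan_matrix \<Sigma> V \<longleftrightarrow> bij_betw (\<lambda>j. column j V) UNIV (primitive_generators \<Sigma>)"

text \<open>The class map on torus invariant divisors, given by their coefficient vectors.\<close>

definition class_of_invariant :: "('n::{finite,linorder}, 'k::field) toric_field set set \<Rightarrow>
    int^'j^'n::{finite,linorder} \<Rightarrow> int^'j \<Rightarrow> (('n, 'k) toric_field set \<Rightarrow>\<^sub>0 int) set" where
  "class_of_invariant \<XX> V a =
     divisor_class \<XX> (\<Sum>j\<in>UNIV. frag_cmul (a $ j) (frag_of (ray_divisor (column j V))))"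

definition integer_vectors :: "(int^'r) monoid" where
  "integer_vectors = \<lparr>carrier = UNIV, monoid.mult = (+), one = 0\<rparr>"

definition weight_matrix :: "('n::{finite,linorder}, 'k::field) toric_field set set \<Rightarrow>
    int^'j^'n::{finite,linorder} \<Rightarrow> ((('n, 'k) toric_field set \<Rightarrow>\<^sub>0 int) set \<Rightarrow> (int^'r) \<times> 't) \<Rightarrow> int^'j^'r \<Rightarrow> bool" where
  "weight_matrix \<XX> V \<phi> Q \<longleftrightarrow> (\<forall>a. Q *v a = fst (\<phi> (class_of_invariant \<XX> V a)))"

definition int_span :: "(int^'m) set \<Rightarrow> (int^'m) set" where
  "int_span S = {\<Sum>v\<in>S. c v *s v | c. True}"

definition row_lattice :: "int^'j^'n \<Rightarrow> (int^'j) set" where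
  "row_lattice A = int_span (rows A)"

definition column_lattice :: "int^'j^'r \<Rightarrow> 'j set \<Rightarrow> (int^'r) set" where
  "column_lattice A I = int_span ((\<lambda>j. column j A) ` I)"

definition I_Sigma :: "(real^'n) set set \<Rightarrow> int^'j^'n \<Rightarrow> 'j set set" where
  "I_Sigma \<Sigma> V = {I. let \<sigma> = convex_cone hull ((\<lambda>j. real_vec (column j V)) ` (- I))
                     in \<sigma> \<in> \<Sigma> \<and> dim \<sigma> = CARD('n)}"

definition E_of :: "'j set \<Rightarrow> (int^'j) set" where
  "E_of I = {a. \<forall>i. i \<notin> I \<longrightarrow> a $ i = 0}"

definition a_of :: "int^'j^'r \<Rightarrow> int^'r \<Rightarrow> 'j set \<Rightarrow> int^'j" where
  "a_of Q x I = (THE a. a \<in> E_of I \<and> Q *v a = x)"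

end

theory Submission
  imports Defs
begin

text \<open>
  The rows of \<open>V\<close> span the divisors of the characters \<open>\<chi>\<^sup>m\<close>, since \<open>\<chi>\<^sup>m\<close> has order \<open>\<langle>m, v\<^sub>j\<rangle>\<close> along
  \<open>D\<^sub>j\<close>. An invariant divisor \<open>\<Sum> a\<^sub>j D\<^sub>j\<close> is Cartier iff on every maximal cone \<open>\<langle>V\<^sup>I\<rangle>\<close> it agrees with a
  character \<open>m\<^sub>I\<close>, that is, \<open>a - V\<^sup>T m\<^sub>I \<in> E\<^sub>I\<close> for some \<open>m\<^sub>I\<close>. As \<open>a - V\<^sup>T m\<^sub>I\<close> has the same class \<open>x\<close> as \<open>a\<close>, it
  must be \<open>a\<^sub>I\<close>, so \<open>a\<^sub>I - a\<^sub>J = V\<^sup>T (m\<^sub>J - m\<^sub>I)\<close>. Conversely, if all these differences lie in the row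
  lattice, then \<open>a\<^sub>I\<close> for any fixed \<open>I\<close> is a Cartier divisor of class \<open>x\<close>; its torsion component
  vanishes because the Picard group lies in the free part. This is carried out in
  \<open>Pic_imp_lattice_conditions\<close> and \<open>lattice_conditions_imp_Pic\<close>. The uniqueness of \<open>a\<^sub>I\<close>
  (\<open>kernel_meets_E_trivially\<close>) holds because a divisor whose free class is zero has a multiple that
  is the divisor of a character, and a character of order zero along all rays of a full-dimensional
  cone is trivial.

  The remaining work is to establish the three facts about toric varieties on which this rests,
  starting from a description by local rings in the function field.

  First, every divisor is equivalent to an invariant one, and the invariant principal divisors are
  the divisors of characters (\<open>equivalent_invariant_divisor\<close>, \<open>D_principal_iff\<close>). The group algebra
  of the lattice \<open>M\<close> is factorial: one variable is adjoined at a time, by an analogue of the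
  lemma of Gauss (\<open>prime_in_insert\<close>) and pseudo-division with respect to the width of the Newton
  polytope in that variable (\<open>least_width_divides\<close>). Its units are monomials, because widths are additive. A prime divisor of the
  toric variety is the valuation ring of a ray or of a prime element of the group algebra: a prime
  of height one of an affine chart that contains a character contains the centre of a ray
  valuation, and any other one comes from the torus. The valuation of a ray is the lowest
  weight of the terms of a Laurent polynomial. Clearing denominators by characters needs enough
  characters that are positive on prescribed rays, which the lemma of Farkas provides.

  Second, Cartier divisors are given by characters on the cones (\<open>Cartier_local_character\<close>,
  \<open>Cartier_of_local_characters\<close>). A local equation at the distinguished point of the chart of a
  cone is compared with its lowest terms along the sum of the generators of the cone.

  Third, a complete toric variety has a fan whose cones of full dimension cover the space
  (\<open>complete_fan_covers\<close>, \<open>cone_in_I_Sigma\<close>). For every lattice vector \<open>u\<close>, the monomial valuation of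
  weight \<open>u\<close> has a centre on some chart, so that \<open>u\<close> lies in its cone; a covering by finitely
  many closed cones is already achieved by those with interior points.
\<close>

(* The order-theoretic interpretation of the integers declares transitivity of \<le> on int as an
   introduction rule, on which the classical reasoner diverges. *)
declare int.le_trans [rule del] int.le_cong_l [rule del] int.le_cong_r [rule del]
  int.weak_refl [rule del] int.le_antisym [rule del] int.refl [rule del]

section \<open>Prime spectra, localizations and discrete valuations of a field\<close>

definition ring_closed :: "'K::field set \<Rightarrow> bool" where
  "ring_closed A \<longleftrightarrow> 1 \<in> A \<and> (\<forall>x\<in>A. \<forall>y\<in>A. x - y \<in> A \<and> x * y \<in> A)"

lemma ring_closedD:
  assumes "ring_closed A"
  shows "1 \<in> A" "0 \<in> A" "x \<in> A \<Longrightarrow> - x \<in> A" "x \<in> A \<Longrightarrow> y \<in> A \<Longrightarrow> x - y \<in> A"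
    "x \<in> A \<Longrightarrow> y \<in> A \<Longrightarrow> x + y \<in> A" "x \<in> A \<Longrightarrow> y \<in> A \<Longrightarrow> x * y \<in> A"
proof -
  have *: "1 \<in> A" "\<And>x y. x \<in> A \<Longrightarrow> y \<in> A \<Longrightarrow> x - y \<in> A" "\<And>x y. x \<in> A \<Longrightarrow> y \<in> A \<Longrightarrow> x * y \<in> A"
    using assms by (auto simp: ring_closed_def)
  have 0: "0 \<in> A" using *(2)[OF *(1) *(1)] by simp
  have neg: "- x \<in> A" if "x \<in> A" for x using *(2)[OF 0 that] by simp
  show "1 \<in> A" "0 \<in> A" "x \<in> A \<Longrightarrow> - x \<in> A" "x \<in> A \<Longrightarrow> y \<in> A \<Longrightarrow> x - y \<in> A"
    "x \<in> A \<Longrightarrow> y \<in> A \<Longrightarrow> x * y \<in> A" using * 0 neg by auto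
  show "x \<in> A \<Longrightarrow> y \<in> A \<Longrightarrow> x + y \<in> A" using *(2)[of x "- y"] neg by auto
qed

lemma ring_closed_power: "ring_closed A \<Longrightarrow> x \<in> A \<Longrightarrow> x ^ n \<in> A"
  by (induction n) (auto intro: ring_closedD)

lemma ring_closed_iff_subring:
  fixes A :: "'K::field set"
  shows "ring_closed A \<longleftrightarrow> subring A ring_of_type_algebra"
proof -
  interpret R: ring "ring_of_type_algebra :: 'K ring" by (rule ring_from_type_algebra)
  have minus: "\<ominus>\<^bsub>ring_of_type_algebra\<^esub> x = - x" for x :: 'K
    by (rule R.minus_equality) (auto simp: ring_of_type_algebra_def)
  show ?thesis
  proof
    assume A: "ring_closed A"
    show "subring A ring_of_type_algebra"
      by (rule R.subringI; (unfold minus)?; (use ring_closedD[OF A] in \<open>auto simp: ring_of_type_algebra_def\<close>))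
  next
    assume A: "subring A ring_of_type_algebra"
    have 1: "1 \<in> A" using subringE(3)[OF A] by (simp add: ring_of_type_algebra_def)
    have neg: "- x \<in> A" if "x \<in> A" for x
      using subringE(5)[OF A that] minus by simp
    have mul: "x * y \<in> A" if "x \<in> A" "y \<in> A" for x y
      using subringE(6)[OF A that] by (simp add: ring_of_type_algebra_def)
    have add: "x + y \<in> A" if "x \<in> A" "y \<in> A" for x y
      using subringE(7)[OF A that] by (simp add: ring_of_type_algebra_def)
    have "x - y \<in> A" if "x \<in> A" "y \<in> A" for x y
      using add[OF that(1) neg[OF that(2)]] by simp
    with 1 mul show "ring_closed A" by (auto simp: ring_closed_def)
  qed
qed

lemma subring_of_type_simps [simp]:
  "carrier (subring_of_type A) = A"
  "x \<otimes>\<^bsub>subring_of_type A\<^esub> y = x * y" "x \<oplus>\<^bsub>subring_of_type A\<^esub> y = x + y"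
  "\<one>\<^bsub>subring_of_type A\<^esub> = 1" "\<zero>\<^bsub>subring_of_type A\<^esub> = 0"
  by (auto simp: subring_of_type_def ring_of_type_algebra_def)

lemma cring_subring_of_type:
  assumes A: "ring_closed A" shows "cring (subring_of_type A)"
proof (rule cringI)
  show "abelian_group (subring_of_type A)"
  proof (rule abelian_groupI)
    fix x assume "x \<in> carrier (subring_of_type A)"
    then show "\<exists>y\<in>carrier (subring_of_type A). y \<oplus>\<^bsub>subring_of_type A\<^esub> x = \<zero>\<^bsub>subring_of_type A\<^esub>"
      by (intro bexI[of _ "- x"]) (auto intro: ring_closedD[OF A])
  qed (auto intro: ring_closedD[OF A] simp: algebra_simps)
  show "Group.comm_monoid (subring_of_type A)"
    by (rule Group.comm_monoidI) (auto intro: ring_closedD[OF A] simp: algebra_simps)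
qed (auto simp: algebra_simps)

lemma Spec_iff:
  assumes A: "ring_closed A"
  shows "p \<in> Spec A \<longleftrightarrow> p \<subseteq> A \<and> 0 \<in> p \<and> 1 \<notin> p \<and> (\<forall>x\<in>p. \<forall>y\<in>p. x + y \<in> p) \<and>
    (\<forall>a\<in>A. \<forall>x\<in>p. a * x \<in> p) \<and> (\<forall>a\<in>A. \<forall>b\<in>A. a * b \<in> p \<longrightarrow> a \<in> p \<or> b \<in> p)" (is "_ \<longleftrightarrow> ?P")
proof
  interpret R: cring "subring_of_type A" by (rule cring_subring_of_type[OF A])
  assume "p \<in> Spec A"
  then interpret p: primeideal p "subring_of_type A" by (simp add: Spec_def)
  have "p \<subseteq> A" using p.a_subset by simp
  moreover have "1 \<notin> p" using p.one_imp_carrier p.I_notcarr by auto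
  ultimately show ?P
    using p.a_closed p.zero_closed p.I_l_closed p.I_prime by (auto 4 4)
next
  interpret R: cring "subring_of_type A" by (rule cring_subring_of_type[OF A])
  assume p: ?P
  have neg: "- x \<in> p" if "x \<in> p" for x
  proof -
    have "(- 1) * x \<in> p" using p that ring_closedD(1,3)[OF A] by blast
    then show ?thesis by simp
  qed
  have inv: "inv\<^bsub>add_monoid (subring_of_type A)\<^esub> x = - x" if "x \<in> A" for x
    using R.minus_equality[of "-x" x] that ring_closedD(3)[OF A that] by (simp add: a_inv_def)
  have "ideal p (subring_of_type A)"
  proof (rule idealI)
    show "ring (subring_of_type A)" by (rule R.ring_axioms)
    show "subgroup p (add_monoid (subring_of_type A))"
      by (rule subgroup.intro) (use p neg inv in auto)
  next
    fix a x assume "a \<in> p" "x \<in> carrier (subring_of_type A)"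
    then have "x * a \<in> p" using p by simp
    then show "x \<otimes>\<^bsub>subring_of_type A\<^esub> a \<in> p" "a \<otimes>\<^bsub>subring_of_type A\<^esub> x \<in> p"
      by (simp_all add: mult.commute)
  qed
  then have "primeideal p (subring_of_type A)"
    by (rule primeidealI) (use p R.cring_axioms ring_closedD(1)[OF A] in auto)
  then show "p \<in> Spec A" by (simp add: Spec_def)
qed

lemma SpecD:
  assumes "ring_closed A" "p \<in> Spec A"
  shows "p \<subseteq> A" "0 \<in> p" "1 \<notin> p" "x \<in> p \<Longrightarrow> y \<in> p \<Longrightarrow> x + y \<in> p" "a \<in> A \<Longrightarrow> x \<in> p \<Longrightarrow> a * x \<in> p"
    "a \<in> A \<Longrightarrow> x \<in> p \<Longrightarrow> x * a \<in> p" "a \<in> A \<Longrightarrow> b \<in> A \<Longrightarrow> a * b \<in> p \<Longrightarrow> a \<in> p \<or> b \<in> p"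
  using assms(2) unfolding Spec_iff[OF assms(1)] by (simp_all add: mult.commute[of x a] subset_iff)

lemma Spec_power:
  assumes "ring_closed A" "p \<in> Spec A" "x \<in> A" "x ^ n \<in> p" shows "x \<in> p"
  using assms(4)
proof (induction n)
  case 0 then show ?case using SpecD(3)[OF assms(1,2)] by simp
next
  case (Suc n)
  then show ?case using SpecD(7)[OF assms(1,2) assms(3) ring_closed_power[OF assms(1,3), of n]] by auto
qed

lemma Spec_prod:
  assumes A: "ring_closed A" and p: "p \<in> Spec A" and "finite I"
    and "\<And>i. i \<in> I \<Longrightarrow> x i \<in> A" "\<And>i. i \<in> I \<Longrightarrow> x i \<notin> p"
  shows "(\<Prod>i\<in>I. x i) \<in> A \<and> (\<Prod>i\<in>I. x i) \<notin> p"
  using assms(3-5)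
proof (induction I rule: finite_induct)
  case empty then show ?case using SpecD[OF A p] ring_closedD[OF A] by auto
next
  case (insert i I)
  then show ?case using SpecD(7)[OF A p, of "x i" "prod x I"] ring_closedD(6)[OF A, of "x i" "prod x I"] by auto
qed

lemma zero_in_Spec: "ring_closed A \<Longrightarrow> {0} \<in> Spec A"
  by (subst Spec_iff) (auto dest: ring_closedD(2))

subsection \<open>Localizations\<close>

lemma localization_mem_iff: "x \<in> localization A p \<longleftrightarrow> (\<exists>a\<in>A. \<exists>b\<in>A - p. x = a / b)"
  by (auto simp: localization_def)

context
  fixes A p :: "'K::field set"
  assumes A: "ring_closed A" and p: "p \<in> Spec A"
begin

lemma subset_localization: "A \<subseteq> localization A p"
proof
  fix a assume "a \<in> A"
  then show "a \<in> localization A p" unfolding localization_mem_iff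
    by (intro bexI[of _ a] bexI[of _ 1]) (use SpecD[OF A p] ring_closedD[OF A] in auto)
qed

lemma localization_denominator: "b \<in> A - p \<Longrightarrow> inverse b \<in> localization A p"
  unfolding localization_mem_iff
  by (intro bexI[of _ 1] bexI[of _ b]) (use ring_closedD[OF A] in \<open>auto simp: field_simps\<close>)

lemma complement_mult: "a \<in> A - p \<Longrightarrow> b \<in> A - p \<Longrightarrow> a * b \<in> A - p"
  using SpecD(7)[OF A p] ring_closedD[OF A] by auto

lemma complement_nonzero: "a \<in> A - p \<Longrightarrow> a \<noteq> 0"
  using SpecD[OF A p] by auto

lemma ring_closed_localization: "ring_closed (localization A p)"
  unfolding ring_closed_def
proof (intro conjI ballI)
  show "1 \<in> localization A p" using subset_localization ring_closedD[OF A] by auto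
  fix x y assume "x \<in> localization A p" "y \<in> localization A p"
  then obtain a b c d where x: "x = a / b" "a \<in> A" "b \<in> A - p" and y: "y = c / d" "c \<in> A" "d \<in> A - p"
    unfolding localization_mem_iff by blast
  have nz: "b \<noteq> 0" "d \<noteq> 0" using x y complement_nonzero by auto
  have bd: "b * d \<in> A - p" using x y complement_mult by blast
  have "x - y = (a * d - c * b) / (b * d)" using x y nz by (simp add: field_simps)
  moreover have "a * d - c * b \<in> A" using x y ring_closedD[OF A] by auto
  ultimately show "x - y \<in> localization A p" using bd unfolding localization_mem_iff by blast
  have "x * y = (a * c) / (b * d)" using x y nz by (simp add: field_simps)
  moreover have "a * c \<in> A" using x y ring_closedD[OF A] by auto
  ultimately show "x * y \<in> localization A p" using bd unfolding localization_mem_iff by blast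
qed

text \<open>For a prime contained in \<open>p\<close>, this is its extension to the local ring.
  Extending is injective, which bounds the number of primes of the local ring from below.\<close>

definition extension :: "'K set \<Rightarrow> 'K set" where
  "extension q = {a / b | a b. a \<in> q \<and> b \<in> A - p}"

lemma extension_contraction:
  assumes q: "q \<in> Spec A" and sub: "q \<subseteq> p" and a: "a \<in> A" "a \<in> extension q"
  shows "a \<in> q"
proof -
  obtain c b where cb: "a = c / b" "c \<in> q" "b \<in> A - p" using a unfolding extension_def by blast
  have "a * b \<in> q" using cb complement_nonzero by simp
  then show ?thesis using SpecD(7)[OF A q a(1), of b] cb(3) sub by blast
qed

lemma extension_in_Spec:
  assumes q: "q \<in> Spec A" and sub: "q \<subseteq> p"
  shows "extension q \<in> Spec (localization A p)"
  unfolding Spec_iff[OF ring_closed_localization]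
proof (intro conjI ballI impI)
  note Sq = SpecD[OF A q]
  show "extension q \<subseteq> localization A p"
    using Sq(1) unfolding extension_def localization_def by blast
  have "1 \<in> A - p" using SpecD[OF A p] ring_closedD[OF A] by auto
  then show "0 \<in> extension q" unfolding extension_def using Sq(2)
    by (intro CollectI exI[of _ 0] exI[of _ 1]) auto
  show "1 \<notin> extension q" using extension_contraction[OF q sub, of 1] Sq(3) ring_closedD(1)[OF A] by blast
  fix x y assume "x \<in> extension q" "y \<in> extension q"
  then obtain a b c d where x: "x = a / b" "a \<in> q" "b \<in> A - p" and y: "y = c / d" "c \<in> q" "d \<in> A - p"
    unfolding extension_def by blast
  have nz: "b \<noteq> 0" "d \<noteq> 0" using x y complement_nonzero by auto
  have "x + y = (a * d + c * b) / (b * d)" using x y nz by (simp add: field_simps)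
  moreover have "a * d + c * b \<in> q"
    using Sq(4)[OF Sq(6)[of d a] Sq(6)[of b c]] x y by simp
  ultimately show "x + y \<in> extension q"
    using complement_mult[OF x(3) y(3)] unfolding extension_def by blast
next
  note Sq = SpecD[OF A q]
  fix x y assume "x \<in> localization A p" "y \<in> extension q"
  then obtain a b c d where x: "x = a / b" "a \<in> A" "b \<in> A - p" and y: "y = c / d" "c \<in> q" "d \<in> A - p"
    unfolding extension_def localization_def by blast
  have "x * y = (a * c) / (b * d)" using x y by simp
  moreover have "a * c \<in> q" using x y Sq(5) by blast
  ultimately show "x * y \<in> extension q"
    using complement_mult[OF x(3) y(3)] unfolding extension_def by blast
next
  note Sq = SpecD[OF A q]
  fix x y assume xy: "x \<in> localization A p" "y \<in> localization A p" "x * y \<in> extension q"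
  then obtain a b c d e f where x: "x = a / b" "a \<in> A" "b \<in> A - p" and y: "y = c / d" "c \<in> A" "d \<in> A - p"
    and e: "x * y = e / f" "e \<in> q" "f \<in> A - p"
    unfolding extension_def localization_def by blast
  have nz: "b \<noteq> 0" "d \<noteq> 0" "f \<noteq> 0" using x y e complement_nonzero by auto
  have "(a * c) * f = e * (b * d)" using x(1) y(1) e(1) nz by (auto simp: divide_simps mult_ac)
  moreover have "e * (b * d) \<in> q" using x y Sq(6)[of "b * d" e] e ring_closedD(6)[OF A, of b d] by blast
  ultimately have "(a * c) * f \<in> q" by metis
  moreover have "f \<notin> q" using e sub by auto
  ultimately have "a * c \<in> q" using Sq(7)[of "a * c" f] x y e ring_closedD(6)[OF A, of a c] by blast
  then have "a \<in> q \<or> c \<in> q" using Sq(7) x y by blast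
  then show "x \<in> extension q \<or> y \<in> extension q"
    using x y unfolding extension_def by blast
qed

text \<open>A prime strictly between zero and \<open>p\<close> would extend to a third prime of the local ring.\<close>

lemma height_one_prime_minimal:
  assumes card: "card (Spec (localization A p)) = 2" and q: "q \<in> Spec A" "q \<subseteq> p" "q \<noteq> {0}"
  shows "q = p"
proof (rule ccontr)
  assume "q \<noteq> p"
  have inj: "extension q1 \<noteq> extension q2"
    if "q1 \<in> Spec A" "q1 \<subseteq> p" "q2 \<in> Spec A" "q2 \<subseteq> p" "q1 \<noteq> q2" for q1 q2
  proof -
    have sub: "q' \<subseteq> extension q'" for q'
    proof
      fix a assume "a \<in> q'"
      then show "a \<in> extension q'" unfolding extension_def
        by (intro CollectI exI[of _ a] exI[of _ 1])
          (use SpecD(3)[OF A p] ring_closedD(1)[OF A] in auto)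
    qed
    have "extension q' \<inter> A = q'" if "q' \<in> Spec A" "q' \<subseteq> p" for q'
      using sub[of q'] SpecD(1)[OF A that(1)] extension_contraction[OF that] by blast
    with that show ?thesis by metis
  qed
  have "{0} \<subseteq> p" using SpecD(2)[OF A p] by simp
  have z: "{0} \<in> Spec A" by (rule zero_in_Spec[OF A])
  have np: "p \<noteq> {0}" using q SpecD(2)[OF A q(1)] by blast
  have "card {extension {0}, extension q, extension p} = 3"
    using inj[OF z \<open>{0} \<subseteq> p\<close> q(1,2)] inj[OF z \<open>{0} \<subseteq> p\<close> p subset_refl] inj[OF q(1,2) p subset_refl]
      q \<open>q \<noteq> p\<close> np by (auto simp: card_insert_if)
  moreover have "{extension {0}, extension q, extension p} \<subseteq> Spec (localization A p)"
    using extension_in_Spec z q p \<open>{0} \<subseteq> p\<close> by auto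
  moreover have "finite (Spec (localization A p))" using card card.infinite by fastforce
  ultimately have "3 \<le> card (Spec (localization A p))" by (metis card_mono)
  then show False using card by simp
qed

text \<open>The localization at the zero ideal is the fraction field, whose spectrum is a
  point.\<close>

lemma height_one_prime_nonzero:
  assumes card: "card (Spec (localization A p)) = 2"
  shows "p \<noteq> {0}"
proof
  assume p0: "p = {0}"
  let ?L = "localization A p"
  have L: "ring_closed ?L" by (rule ring_closed_localization)
  have inv: "inverse x \<in> ?L" if x: "x \<in> ?L" "x \<noteq> 0" for x
  proof -
    obtain a b where "x = a / b" "a \<in> A" "b \<in> A - p" using x(1) unfolding localization_mem_iff by blast
    then have "inverse x = b / a" "a \<in> A - p" using x(2) p0 by (simp, force)
    then show ?thesis using \<open>b \<in> A - p\<close> unfolding localization_mem_iff by blast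
  qed
  have "q = {0}" if q: "q \<in> Spec ?L" for q
  proof -
    have "x \<notin> q" if "x \<noteq> 0" for x
    proof
      assume "x \<in> q"
      then have "inverse x * x \<in> q" using SpecD(5)[OF L q inv] SpecD(1)[OF L q] that by blast
      then show False using SpecD(3)[OF L q] that by simp
    qed
    then show ?thesis using SpecD(2)[OF L q] by auto
  qed
  then have "Spec ?L \<subseteq> {{0}}" by blast
  then have "card (Spec ?L) \<le> 1" by (metis card.empty card_mono finite.simps is_singletonI is_singleton_altdef)
  with card show False by simp
qed

end

subsection \<open>Discrete valuations\<close>

definition val_ring :: "('K::field \<Rightarrow> int) \<Rightarrow> 'K set" where
  "val_ring \<nu> = {x. x = 0 \<or> 0 \<le> \<nu> x}"

locale integer_valuation =
  fixes \<nu> :: "'a::idom \<Rightarrow> int"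
  assumes mult: "x \<noteq> 0 \<Longrightarrow> y \<noteq> 0 \<Longrightarrow> \<nu> (x * y) = \<nu> x + \<nu> y"
    and add: "x \<noteq> 0 \<Longrightarrow> y \<noteq> 0 \<Longrightarrow> x + y \<noteq> 0 \<Longrightarrow> min (\<nu> x) (\<nu> y) \<le> \<nu> (x + y)"
begin

lemma one [simp]: "\<nu> 1 = 0" using mult[of 1 1] by simp

lemma minus [simp]: "\<nu> (- x) = \<nu> x"
proof (cases "x = 0")
  case False
  have "\<nu> (-1) = 0" using mult[of "-1" "-1"] by simp
  then show ?thesis using mult[of "-1" x] False by simp
qed simp

lemma power: "x \<noteq> 0 \<Longrightarrow> \<nu> (x ^ n) = int n * \<nu> x"
  by (induction n) (auto simp: mult algebra_simps)

end

locale field_valuation = integer_valuation \<nu> for \<nu> :: "'K::field \<Rightarrow> int"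
begin

lemma inverse: "x \<noteq> 0 \<Longrightarrow> \<nu> (inverse x) = - \<nu> x"
  using mult[of x "inverse x"] by simp

lemma divide: "x \<noteq> 0 \<Longrightarrow> y \<noteq> 0 \<Longrightarrow> \<nu> (x / y) = \<nu> x - \<nu> y"
  by (simp add: divide_inverse mult inverse)

lemma power_int: "x \<noteq> 0 \<Longrightarrow> \<nu> (x powi k) = k * \<nu> x"
  by (auto simp: power_int_def power inverse)

lemma prod: "finite I \<Longrightarrow> (\<And>i. i \<in> I \<Longrightarrow> x i \<noteq> 0) \<Longrightarrow> \<nu> (\<Prod>i\<in>I. x i) = (\<Sum>i\<in>I. \<nu> (x i))"
  by (induction I rule: finite_induct) (auto simp: mult)

lemma ring_closed_val_ring: "ring_closed (val_ring \<nu>)"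
  unfolding ring_closed_def
proof (intro conjI ballI)
  show "1 \<in> val_ring \<nu>" by (simp add: val_ring_def)
  fix x y assume xy: "x \<in> val_ring \<nu>" "y \<in> val_ring \<nu>"
  then show "x - y \<in> val_ring \<nu>" using add[of x "- y"]
    by (cases "x = 0"; cases "y = 0"; cases "x = y") (auto simp: val_ring_def min_def split: if_splits)
  show "x * y \<in> val_ring \<nu>" using xy by (cases "x = 0"; cases "y = 0") (auto simp: val_ring_def mult)
qed

lemma valuation_ring_val_ring: "valuation_ring (val_ring \<nu>)"
  unfolding valuation_ring_def ring_closed_iff_subring[symmetric]
  using ring_closed_val_ring inverse by (fastforce simp: val_ring_def)

lemma Units_val_ring: "Units (subring_of_type (val_ring \<nu>)) = {x. x \<noteq> 0 \<and> \<nu> x = 0}"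
proof (intro Set.set_eqI iffI)
  fix x assume "x \<in> Units (subring_of_type (val_ring \<nu>))"
  then obtain y where y: "y \<in> val_ring \<nu>" "x * y = 1" "x \<in> val_ring \<nu>"
    unfolding Units_def by auto
  then have "x \<noteq> 0" "y \<noteq> 0" by auto
  then show "x \<in> {x. x \<noteq> 0 \<and> \<nu> x = 0}" using mult[of x y] y by (auto simp: val_ring_def)
next
  fix x assume "x \<in> {x. x \<noteq> 0 \<and> \<nu> x = 0}"
  then have "inverse x \<in> val_ring \<nu>" "x \<in> val_ring \<nu>" "inverse x * x = 1" "x * inverse x = 1"
    by (auto simp: val_ring_def inverse)
  then show "x \<in> Units (subring_of_type (val_ring \<nu>))"
    unfolding Units_def by auto
qed

lemma nonunits_val_ring: "nonunits (val_ring \<nu>) = {x. x = 0 \<or> 0 < \<nu> x}"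
proof -
  have "nonunits (val_ring \<nu>) = val_ring \<nu> - {x. x \<noteq> 0 \<and> \<nu> x = 0}"
    by (simp only: nonunits_def Units_val_ring)
  also have "\<dots> = {x. x = 0 \<or> 0 < \<nu> x}" unfolding val_ring_def by force
  finally show ?thesis .
qed

text \<open>If \<open>A\<close> lies in the valuation ring, this is the contraction of the maximal
  ideal to \<open>A\<close>.\<close>

definition centre :: "'K set \<Rightarrow> 'K set" where
  "centre A = {a \<in> A. a = 0 \<or> 0 < \<nu> a}"

lemma centre_in_Spec:
  assumes A: "ring_closed A" and sub: "A \<subseteq> val_ring \<nu>"
  shows "centre A \<in> Spec A"
  unfolding Spec_iff[OF A]
proof (intro conjI ballI impI)
  have nn: "0 \<le> \<nu> a" if "a \<in> A" "a \<noteq> 0" for a using sub that by (auto simp: val_ring_def)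
  fix x y assume xy: "x \<in> centre A" "y \<in> centre A"
  then have "x + y \<in> A" using ring_closedD(5)[OF A] by (simp add: centre_def)
  with xy show "x + y \<in> centre A" using add[of x y]
    by (cases "x = 0"; cases "y = 0"; cases "x + y = 0") (auto simp: centre_def min_def split: if_splits)
next
  have nn: "0 \<le> \<nu> a" if "a \<in> A" "a \<noteq> 0" for a using sub that by (auto simp: val_ring_def)
  fix a x assume ax: "a \<in> A" "x \<in> centre A"
  then have "a * x \<in> A" using ring_closedD(6)[OF A] by (simp add: centre_def)
  with ax show "a * x \<in> centre A" using nn[of a]
    by (cases "a = 0"; cases "x = 0") (auto simp: centre_def mult)
next
  have nn: "0 \<le> \<nu> a" if "a \<in> A" "a \<noteq> 0" for a using sub that by (auto simp: val_ring_def)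
  fix a b assume "a \<in> A" "b \<in> A" "a * b \<in> centre A"
  then show "a \<in> centre A \<or> b \<in> centre A"
    using nn[of a] nn[of b] by (cases "a = 0"; cases "b = 0") (auto simp: centre_def mult)
qed (use ring_closedD(1,2)[OF A] in \<open>auto simp: centre_def\<close>)

text \<open>If every element of the valuation ring is a fraction of elements of \<open>A\<close> whose
  denominator has value zero, then the local ring of the centre is the valuation ring.\<close>

lemma localization_centre:
  assumes A: "ring_closed A" and sub: "A \<subseteq> val_ring \<nu>"
    and frac: "\<And>x. x \<noteq> 0 \<Longrightarrow> 0 \<le> \<nu> x \<Longrightarrow> \<exists>a\<in>A. \<exists>b\<in>A. b \<noteq> 0 \<and> \<nu> b = 0 \<and> x = a / b"
  shows "localization A (centre A) = val_ring \<nu>"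
proof
  show "localization A (centre A) \<subseteq> val_ring \<nu>"
  proof
    fix x assume "x \<in> localization A (centre A)"
    then obtain a b where ab: "x = a / b" "a \<in> A" "b \<in> A" "b \<notin> centre A"
      unfolding localization_mem_iff by blast
    then have b: "b \<noteq> 0" "\<nu> b \<le> 0" by (auto simp: centre_def)
    have "a \<in> val_ring \<nu>" "b \<in> val_ring \<nu>" using sub ab by blast+
    then have "\<nu> b = 0" "a = 0 \<or> 0 \<le> \<nu> a" using b by (simp_all add: val_ring_def)
    then show "x \<in> val_ring \<nu>"
      using ab(1) b divide[of a b] by (cases "a = 0") (simp_all add: val_ring_def)
  qed
  show "val_ring \<nu> \<subseteq> localization A (centre A)"
  proof
    fix x assume x: "x \<in> val_ring \<nu>"
    show "x \<in> localization A (centre A)"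
    proof (cases "x = 0")
      case True then show ?thesis
        using subset_localization[OF A centre_in_Spec[OF A sub]] ring_closedD(2)[OF A] by auto
    next
      case False
      then obtain a b where "a \<in> A" "b \<in> A" "b \<noteq> 0" "\<nu> b = 0" "x = a / b"
        using frac[of x] x unfolding val_ring_def by blast
      moreover from this have "b \<in> A - centre A" by (simp add: centre_def)
      ultimately show ?thesis unfolding localization_mem_iff by blast
    qed
  qed
qed

end

locale discrete_valuation = field_valuation \<nu> for \<nu> :: "'K::field \<Rightarrow> int" +
  assumes uniformizer: "\<exists>t. t \<noteq> 0 \<and> \<nu> t = 1"
begin

text \<open>Every nonzero element is a unit times a power of the uniformizer, so a nonzero prime
  contains the uniformizer.\<close>

lemma Spec_val_ring: "Spec (val_ring \<nu>) = {{0}, nonunits (val_ring \<nu>)}"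
proof
  let ?V = "val_ring \<nu>"
  note V = ring_closed_val_ring
  obtain t where t: "t \<noteq> 0" "\<nu> t = 1" using uniformizer by blast
  have "nonunits ?V = centre ?V"
    unfolding nonunits_val_ring centre_def unfolding val_ring_def by fastforce
  then show "{{0}, nonunits ?V} \<subseteq> Spec ?V"
    using centre_in_Spec[OF V subset_refl] zero_in_Spec[OF V] by simp
  show "Spec ?V \<subseteq> {{0}, nonunits ?V}"
  proof
    fix p assume p: "p \<in> Spec ?V"
    note Sp = SpecD[OF V p]
    have pos: "0 < \<nu> x" if "x \<in> p" "x \<noteq> 0" for x
    proof (rule ccontr)
      assume "\<not> 0 < \<nu> x"
      moreover have "x \<in> ?V" using Sp(1) that by blast
      then have "0 \<le> \<nu> x" using that by (simp add: val_ring_def)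
      ultimately have "inverse x \<in> ?V" using that inverse[of x] by (simp add: val_ring_def)
      then have "inverse x * x \<in> p" using Sp(5) that(1) by blast
      then show False using that Sp(3) by simp
    qed
    show "p \<in> {{0}, nonunits ?V}"
    proof (cases "p = {0}")
      case False
      then obtain x where x: "x \<in> p" "x \<noteq> 0" using Sp(2) by blast
      have "x / t ^ nat (\<nu> x) \<noteq> 0" "\<nu> (x / t ^ nat (\<nu> x)) = 0"
        using x t pos[OF x] divide[of x "t ^ nat (\<nu> x)"] power[of t "nat (\<nu> x)"] by simp_all
      then have "inverse (x / t ^ nat (\<nu> x)) \<in> ?V"
        using inverse[of "x / t ^ nat (\<nu> x)"] by (simp add: val_ring_def)
      then have "inverse (x / t ^ nat (\<nu> x)) * x \<in> p" by (rule Sp(5)[OF _ x(1)])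
      moreover have "inverse (x / t ^ nat (\<nu> x)) * x = t ^ nat (\<nu> x)"
        using x(2) t(1) by (simp add: field_simps)
      ultimately have tn: "t ^ nat (\<nu> x) \<in> p" by metis
      have "t \<in> ?V" using t by (simp add: val_ring_def)
      then have tp: "t \<in> p" by (rule Spec_power[OF V p _ tn])
      have big: "y \<in> p" if "y \<noteq> 0" "0 < \<nu> y" for y
      proof -
        have "y / t \<in> ?V" using that t divide[of y t] by (simp add: val_ring_def)
        then have "y / t * t \<in> p" using tp Sp(5) by blast
        then show ?thesis using t by simp
      qed
      have "p = nonunits ?V" unfolding nonunits_val_ring
      proof (rule subset_antisym; rule subsetI)
        fix y assume "y \<in> p"
        then show "y \<in> {x. x = 0 \<or> 0 < \<nu> x}" using pos[of y] by blast
      next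
        fix y assume "y \<in> {x. x = 0 \<or> 0 < \<nu> x}"
        then show "y \<in> p" using big[of y] Sp(2) by (cases "y = 0") simp_all
      qed
      then show ?thesis by simp
    qed simp
  qed
qed

lemma card_Spec_val_ring: "card (Spec (val_ring \<nu>)) = 2"
proof -
  obtain t where "t \<noteq> 0" "\<nu> t = 1" using uniformizer by blast
  then have "t \<in> nonunits (val_ring \<nu>)" by (simp add: nonunits_val_ring)
  then have "{0} \<noteq> nonunits (val_ring \<nu>)" using \<open>t \<noteq> 0\<close> by blast
  then show ?thesis unfolding Spec_val_ring by simp
qed

text \<open>The generators of the maximal ideal are the elements of value one, so the order
  defined by powers of such a generator is the valuation.\<close>

lemma ord_at_val_ring:
  assumes f: "f \<noteq> 0" shows "ord_at (val_ring \<nu>) f = \<nu> f"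
proof -
  let ?V = "val_ring \<nu>"
  obtain t where t: "t \<noteq> 0" "\<nu> t = 1" using uniformizer by blast
  have PIdl: "PIdl\<^bsub>subring_of_type ?V\<^esub> s = {a * s | a. a \<in> ?V}" for s
    by (simp add: cgenideal_def)
  have gen: "nonunits ?V = {a * s | a. a \<in> ?V} \<longleftrightarrow> s \<noteq> 0 \<and> \<nu> s = 1" (is "?N = ?G s \<longleftrightarrow> _") for s
  proof
    assume eq: "?N = ?G s"
    have "t \<in> ?N" using t by (simp add: nonunits_val_ring)
    then have "t \<in> ?G s" by (simp only: eq)
    then obtain a where a: "t = a * s" "a \<in> ?V" by (elim CollectE exE conjE)
    have nz: "a \<noteq> 0" "s \<noteq> 0" using t(1) unfolding a(1) by simp_all
    have "1 * s \<in> ?G s" using ring_closedD(1)[OF ring_closed_val_ring] by (intro CollectI exI conjI) (rule refl)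
    then have "s \<in> ?N" by (simp only: eq mult_1)
    then have "0 < \<nu> s" using nz(2) unfolding nonunits_val_ring by simp
    moreover have "0 \<le> \<nu> a" using a(2) nz(1) unfolding val_ring_def by simp
    moreover have "\<nu> a + \<nu> s = 1" using mult[OF nz] t(2) unfolding a(1) by simp
    ultimately show "s \<noteq> 0 \<and> \<nu> s = 1" using nz(2) by linarith
  next
    assume s: "s \<noteq> 0 \<and> \<nu> s = 1"
    show "?N = ?G s"
    proof (rule subset_antisym; rule subsetI)
      fix x assume "x \<in> ?N"
      then have x: "x = 0 \<or> 0 < \<nu> x" unfolding nonunits_val_ring by simp
      have "x / s \<in> ?V"
        using x s divide[of x s] unfolding val_ring_def by (cases "x = 0") simp_all
      moreover have "x = x / s * s" using s by simp
      ultimately show "x \<in> ?G s" by (intro CollectI exI[of _ "x / s"] conjI)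
    next
      fix x assume "x \<in> ?G s"
      then obtain a where a: "x = a * s" "a \<in> ?V" by (elim CollectE exE conjE)
      then show "x \<in> ?N" using s mult[of a s]
        unfolding nonunits_val_ring a(1) unfolding val_ring_def by (cases "a = 0") simp_all
    qed
  qed
  have iff: "(\<exists>s\<in>?V. \<exists>u\<in>{x. x \<noteq> 0 \<and> \<nu> x = 0}. (s \<noteq> 0 \<and> \<nu> s = 1) \<and> f = u * s powi k) \<longleftrightarrow> k = \<nu> f" for k
  proof
    assume "\<exists>s\<in>?V. \<exists>u\<in>{x. x \<noteq> 0 \<and> \<nu> x = 0}. (s \<noteq> 0 \<and> \<nu> s = 1) \<and> f = u * s powi k"
    then obtain s u where s: "s \<noteq> 0" "\<nu> s = 1" and u: "u \<noteq> 0" "\<nu> u = 0" and eq: "f = u * s powi k"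
      by (elim bexE conjE CollectE)
    have "s powi k \<noteq> 0" using s(1) by simp
    then have "\<nu> f = \<nu> u + \<nu> (s powi k)" unfolding eq by (rule mult[OF u(1)])
    then show "k = \<nu> f" using power_int[OF s(1), of k] s(2) u(2) by simp
  next
    assume k: "k = \<nu> f"
    define c where "c = t powi k"
    have c: "c \<noteq> 0" "\<nu> c = k" using t power_int[OF t(1), of k] unfolding c_def by simp_all
    have "f / c \<noteq> 0" using f c(1) by simp
    moreover have "\<nu> (f / c) = 0" using divide[OF f c(1)] c(2) k by linarith
    moreover have "f = f / c * c" using c(1) by simp
    moreover have "t \<in> ?V" using t unfolding val_ring_def by simp
    ultimately show "\<exists>s\<in>?V. \<exists>u\<in>{x. x \<noteq> 0 \<and> \<nu> x = 0}. (s \<noteq> 0 \<and> \<nu> s = 1) \<and> f = u * s powi k"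
      unfolding c_def using t by (intro bexI[of _ t] bexI[of _ "f / t powi k"] conjI CollectI)
  qed
  show ?thesis unfolding ord_at_def PIdl Units_val_ring gen iff by (rule the_equality) (rule refl)
qed

end

subsection \<open>Extending a valuation to the fraction field\<close>

definition fract_val :: "('a::idom \<Rightarrow> int) \<Rightarrow> 'a fract \<Rightarrow> int" where
  "fract_val \<nu> z = (SOME k. \<exists>a b. a \<noteq> 0 \<and> b \<noteq> 0 \<and> z = Fract a b \<and> k = \<nu> a - \<nu> b)"

lemma nonzero_fract_cases:
  fixes z :: "'a::idom fract" assumes "z \<noteq> 0"
  obtains a b where "a \<noteq> 0" "b \<noteq> 0" "z = Fract a b"
  using assms by (cases z rule: Fract_cases_nonzero) blast+

lemma Fract_eq_zero_iff: "b \<noteq> 0 \<Longrightarrow> Fract a b = 0 \<longleftrightarrow> a = 0"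
  unfolding Zero_fract_def by (subst eq_fract) auto

context integer_valuation
begin

lemma fract_val_Fract [simp]:
  assumes "a \<noteq> 0" "b \<noteq> 0" shows "fract_val \<nu> (Fract a b) = \<nu> a - \<nu> b"
proof -
  have "\<nu> c - \<nu> d = \<nu> a - \<nu> b" if "c \<noteq> 0" "d \<noteq> 0" "Fract a b = Fract c d" for c d
  proof -
    have "a * d = c * b" using that(3) eq_fract(1)[OF assms(2) that(2)] by blast
    then have "\<nu> a + \<nu> d = \<nu> c + \<nu> b" using mult that assms by metis
    then show ?thesis by simp
  qed
  then show ?thesis unfolding fract_val_def using assms by (intro some_equality) blast+
qed

lemma field_valuation_fract_val: "field_valuation (fract_val \<nu>)"
proof (unfold_locales)
  fix x y :: "'a fract" assume "x \<noteq> 0" "y \<noteq> 0"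
  obtain a b where x: "a \<noteq> 0" "b \<noteq> 0" "x = Fract a b" using \<open>x \<noteq> 0\<close> by (rule nonzero_fract_cases)
  obtain c d where y: "c \<noteq> 0" "d \<noteq> 0" "y = Fract c d" using \<open>y \<noteq> 0\<close> by (rule nonzero_fract_cases)
  show "fract_val \<nu> (x * y) = fract_val \<nu> x + fract_val \<nu> y"
    using x y by (simp add: mult)
  assume nz: "x + y \<noteq> 0"
  have eq: "x + y = Fract (a * d + c * b) (b * d)" using x y add_fract by blast
  then have "a * d + c * b \<noteq> 0" using nz x y Fract_eq_zero_iff[of "b * d"] by simp
  then have "min (\<nu> (a * d)) (\<nu> (c * b)) \<le> \<nu> (a * d + c * b)" using add x y by simp
  then show "min (fract_val \<nu> x) (fract_val \<nu> y) \<le> fract_val \<nu> (x + y)"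
    unfolding eq using x y \<open>a * d + c * b \<noteq> 0\<close> by (simp add: mult)
qed

end

section \<open>Gradings of the group algebra of a lattice\<close>

type_synonym ('n, 'k) group_algebra = "('n \<Rightarrow>\<^sub>0 int) \<Rightarrow>\<^sub>0 'k"

definition part :: "('m \<Rightarrow> bool) \<Rightarrow> ('m \<Rightarrow>\<^sub>0 'k::zero) \<Rightarrow> 'm \<Rightarrow>\<^sub>0 'k" where
  "part P f = Poly_Mapping.mapp (\<lambda>m c. if P m then c else 0) f"

lemma lookup_part: "Poly_Mapping.lookup (part P f) m = (if P m then Poly_Mapping.lookup f m else 0)"
  by (simp add: part_def lookup_mapp in_keys_iff when_def)

lemma keys_part: "Poly_Mapping.keys (part P f) = {m \<in> Poly_Mapping.keys f. P m}"
  by (rule Set.set_eqI) (simp add: in_keys_iff lookup_part)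

lemma part_add: "part P (f + g) = part P f + part P g"
  by (rule poly_mapping_eqI) (simp add: lookup_part lookup_add)

lemma part_complement: "part P f + part (\<lambda>m. \<not> P m) f = (f :: 'm \<Rightarrow>\<^sub>0 'k::monoid_add)"
  by (rule poly_mapping_eqI) (simp add: lookup_part lookup_add)

lemma part_id: "(\<And>m. m \<in> Poly_Mapping.keys f \<Longrightarrow> P m) \<Longrightarrow> part P f = f"
  by (rule poly_mapping_eqI) (metis lookup_part not_in_keys_iff_lookup_eq_zero)

lemma part_zero: "(\<And>m. m \<in> Poly_Mapping.keys f \<Longrightarrow> \<not> P m) \<Longrightarrow> part P f = 0"
  by (rule poly_mapping_eqI) (metis lookup_part lookup_zero not_in_keys_iff_lookup_eq_zero)

lemma keys_mult_elim:
  assumes "m \<in> Poly_Mapping.keys (f * g)"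
  obtains a b where "a \<in> Poly_Mapping.keys f" "b \<in> Poly_Mapping.keys g" "m = a + b"
  using keys_mult[of f g] assms by blast

lemma keys_add_elim:
  assumes "m \<in> Poly_Mapping.keys (f + g)"
  shows "m \<in> Poly_Mapping.keys f \<or> m \<in> Poly_Mapping.keys g"
  using keys_add[of f g] assms by blast

abbreviation character :: "('n \<Rightarrow>\<^sub>0 int) \<Rightarrow> ('n, 'k::field) group_algebra" where
  "character m \<equiv> Poly_Mapping.single m 1"

lemma character_mult: "character a * character b = character (a + b)"
  by (simp add: mult_single)

lemma character_nonzero [simp]: "character m \<noteq> 0"
  by (metis keys_single keys_zero insert_not_empty zero_neq_one)

lemma keys_character_mult:
  "Poly_Mapping.keys (character a * f) = (+) a ` Poly_Mapping.keys (f :: ('n, 'k::field) group_algebra)"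
proof -
  have sub: "Poly_Mapping.keys (character b * g) \<subseteq> (+) b ` Poly_Mapping.keys g"
    for b and g :: "('n, 'k) group_algebra"
  proof
    fix m assume "m \<in> Poly_Mapping.keys (character b * g)"
    then obtain c d where "c \<in> Poly_Mapping.keys (character b :: ('n, 'k) group_algebra)"
      "d \<in> Poly_Mapping.keys g" "m = c + d" by (rule keys_mult_elim)
    then show "m \<in> (+) b ` Poly_Mapping.keys g" by simp
  qed
  have inv: "character (- a) * (character a * f) = f"
    by (simp add: mult.assoc[symmetric] mult_single)
  show ?thesis
  proof (rule subset_antisym)
    show "(+) a ` Poly_Mapping.keys f \<subseteq> Poly_Mapping.keys (character a * f)"
    proof
      fix m assume "m \<in> (+) a ` Poly_Mapping.keys f"
      then obtain d where d: "d \<in> Poly_Mapping.keys f" "m = a + d" by blast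
      have "d \<in> (+) (- a) ` Poly_Mapping.keys (character a * f)"
        using sub[of "- a" "character a * f"] d(1) unfolding inv by blast
      then show "m \<in> Poly_Mapping.keys (character a * f)" using d(2) by force
    qed
  qed (rule sub)
qed

definition low :: "('m \<Rightarrow> int) \<Rightarrow> ('m \<Rightarrow>\<^sub>0 'k::zero) \<Rightarrow> int" where
  "low w f = Min (w ` Poly_Mapping.keys f)"

definition init :: "('m \<Rightarrow> int) \<Rightarrow> ('m \<Rightarrow>\<^sub>0 'k::zero) \<Rightarrow> 'm \<Rightarrow>\<^sub>0 'k" where
  "init w f = part (\<lambda>m. w m = low w f) f"

lemma low_le: "m \<in> Poly_Mapping.keys f \<Longrightarrow> low w f \<le> w m"
  unfolding low_def by (rule Min_le) simp_all

lemma low_attained: "f \<noteq> 0 \<Longrightarrow> \<exists>m\<in>Poly_Mapping.keys f. w m = low w f"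
proof -
  assume "f \<noteq> 0"
  then have "Poly_Mapping.keys f \<noteq> {}"
    by (metis ex_in_conv lookup_zero not_in_keys_iff_lookup_eq_zero poly_mapping_eqI)
  then have "Min (w ` Poly_Mapping.keys f) \<in> w ` Poly_Mapping.keys f" by (intro Min_in) simp_all
  then show ?thesis unfolding low_def by force
qed

lemma low_ge:
  assumes "f \<noteq> 0" "\<And>m. m \<in> Poly_Mapping.keys f \<Longrightarrow> d \<le> w m" shows "d \<le> low w f"
  using low_attained[OF assms(1), of w] assms(2) by metis

lemma low_eqI:
  assumes "\<And>m. m \<in> Poly_Mapping.keys f \<Longrightarrow> d \<le> w m" "n \<in> Poly_Mapping.keys f" "w n = d"
  shows "low w f = d"
proof -
  have "f \<noteq> 0" using assms(2) by force
  then show ?thesis using low_ge[of f d w] low_le[OF assms(2), of w] assms by force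
qed

lemma init_nonzero: "f \<noteq> 0 \<Longrightarrow> init w f \<noteq> 0"
  using low_attained[of f w] keys_part[of "\<lambda>m. w m = low w f" f] unfolding init_def by force

lemma keys_init: "m \<in> Poly_Mapping.keys (init w f) \<longleftrightarrow> m \<in> Poly_Mapping.keys f \<and> w m = low w f"
  unfolding init_def by (simp add: keys_part)

locale weight =
  fixes w :: "('n::linorder \<Rightarrow>\<^sub>0 int) \<Rightarrow> int"
  assumes add: "w (a + b) = w a + w b"
begin

lemma zero [simp]: "w 0 = 0" using add[of 0 0] by simp

lemma minus: "w (- a) = - w a" using add[of a "- a"] by simp

lemma low_character: "low w (character m :: ('n, 'k::field) group_algebra) = w m"
  by (rule low_eqI[where n = m]) simp_all

text \<open>Lowest parts multiply without cancellation: the graded ring of the filtration by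
  \<open>w\<close> is the group algebra itself, which is a domain.\<close>

lemma
  fixes f g :: "('n, 'k::field) group_algebra"
  assumes "f \<noteq> 0" "g \<noteq> 0"
  shows low_mult: "low w (f * g) = low w f + low w g"
    and init_mult: "init w (f * g) = init w f * init w g"
proof -
  let ?l = "low w f + low w g"
  define f1 where "f1 = part (\<lambda>m. w m \<noteq> low w f) f"
  define g1 where "g1 = part (\<lambda>m. w m \<noteq> low w g) g"
  have f: "f = init w f + f1" unfolding init_def f1_def by (simp add: part_complement)
  have g: "g = init w g + g1" unfolding init_def g1_def by (simp add: part_complement)
  define rest where "rest = init w f * g1 + f1 * g"
  have eq: "f * g = init w f * init w g + rest"
  proof -
    have "f * g = init w f * g + f1 * g" using f by (metis distrib_right)
    also have "init w f * g = init w f * init w g + init w f * g1" using g by (metis distrib_left)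
    finally show ?thesis unfolding rest_def by (simp add: add.assoc)
  qed
  have f1: "low w f < w m" if "m \<in> Poly_Mapping.keys f1" for m
    using that low_le[of m f w] unfolding f1_def keys_part by simp
  have g1: "low w g < w m" if "m \<in> Poly_Mapping.keys g1" for m
    using that low_le[of m g w] unfolding g1_def keys_part by simp
  have rest: "?l < w m" if m: "m \<in> Poly_Mapping.keys rest" for m
  proof -
    consider "m \<in> Poly_Mapping.keys (init w f * g1)" | "m \<in> Poly_Mapping.keys (f1 * g)"
      using keys_add_elim[OF m[unfolded rest_def]] by blast
    then show ?thesis
    proof cases
      case 1
      then obtain a b where "a \<in> Poly_Mapping.keys (init w f)" "b \<in> Poly_Mapping.keys g1" "m = a + b"
        by (rule keys_mult_elim)
      then show ?thesis using g1[of b] keys_init[of a w f] add[of a b] by simp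
    next
      case 2
      then obtain a b where "a \<in> Poly_Mapping.keys f1" "b \<in> Poly_Mapping.keys g" "m = a + b"
        by (rule keys_mult_elim)
      then show ?thesis using f1[of a] low_le[of b g w] add[of a b] by simp
    qed
  qed
  have main: "w m = ?l" if m: "m \<in> Poly_Mapping.keys (init w f * init w g)" for m
  proof -
    obtain a b where "a \<in> Poly_Mapping.keys (init w f)" "b \<in> Poly_Mapping.keys (init w g)" "m = a + b"
      using m by (rule keys_mult_elim)
    then show ?thesis using keys_init[of a w f] keys_init[of b w g] add[of a b] by simp
  qed
  have part: "part (\<lambda>m. w m = ?l) (f * g) = init w f * init w g"
  proof -
    have "part (\<lambda>m. w m = ?l) (init w f * init w g) = init w f * init w g"
      by (rule part_id) (rule main)
    moreover have "part (\<lambda>m. w m = ?l) rest = 0"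
      by (rule part_zero) (use rest in force)
    ultimately show ?thesis unfolding eq part_add by simp
  qed
  have "init w f * init w g \<noteq> 0" using init_nonzero[OF assms(1)] init_nonzero[OF assms(2)] by simp
  then obtain n where "n \<in> Poly_Mapping.keys (init w f * init w g)"
    using low_attained[of "init w f * init w g" w] by blast
  then have n: "n \<in> Poly_Mapping.keys (f * g)" "w n = ?l"
    using main keys_part[of "\<lambda>m. w m = ?l" "f * g"] unfolding part by blast+
  show low: "low w (f * g) = ?l"
  proof (rule low_eqI)
    fix m assume "m \<in> Poly_Mapping.keys (f * g)"
    then have "m \<in> Poly_Mapping.keys (init w f * init w g) \<or> m \<in> Poly_Mapping.keys rest"
      unfolding eq by (rule keys_add_elim)
    then show "?l \<le> w m" using main[of m] rest[of m] by linarith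
  qed (use n in simp_all)
  show "init w (f * g) = init w f * init w g" using part low by (simp add: init_def)
qed

lemma low_add_ge:
  fixes f g :: "('n, 'k::field) group_algebra"
  assumes "f + g \<noteq> 0" shows "min (low w f) (low w g) \<le> low w (f + g)"
proof (rule low_ge[OF assms])
  fix m assume "m \<in> Poly_Mapping.keys (f + g)"
  then have "m \<in> Poly_Mapping.keys f \<or> m \<in> Poly_Mapping.keys g" by (rule keys_add_elim)
  then show "min (low w f) (low w g) \<le> w m" using low_le[of m f w] low_le[of m g w] by linarith
qed

lemma integer_valuation_low:
  "integer_valuation (low w :: ('n, 'k::field) group_algebra \<Rightarrow> int)"
  by (unfold_locales) (simp_all add: low_mult low_add_ge)

lemma weight_uminus: "weight (\<lambda>m. - w m)"
  by unfold_locales (simp add: add)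

text \<open>The width of the Newton polytope in the direction \<open>w\<close>, the degree of a
  Laurent polynomial if \<open>w\<close> is a coordinate.\<close>

definition width :: "('n, 'k::field) group_algebra \<Rightarrow> nat" where
  "width f = nat (- low (\<lambda>m. - w m) f - low w f)"

lemma width_int: 
  assumes "f \<noteq> 0" shows "int (width f) = - low (\<lambda>m. - w m) f - low w f"
proof -
  obtain m where "m \<in> Poly_Mapping.keys f" using low_attained[OF assms] by blast
  then have "low w f \<le> w m" "low (\<lambda>m. - w m) f \<le> - w m" by (rule low_le)+
  then show ?thesis unfolding width_def by simp
qed

lemma width_mult:
  fixes f g :: "('n, 'k::field) group_algebra"
  assumes "f \<noteq> 0" "g \<noteq> 0" shows "width (f * g) = width f + width g"
proof -
  have "int (width (f * g)) = int (width f) + int (width g)"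
    using width_int[OF assms(1)] width_int[OF assms(2)] width_int[of "f * g"] assms
      low_mult[OF assms] weight.low_mult[OF weight_uminus assms] by simp
  then show ?thesis by linarith
qed

lemma width_zero:
  assumes "width f = 0" "m \<in> Poly_Mapping.keys f" shows "w m = low w f"
proof -
  have "f \<noteq> 0" using assms(2) by force
  then have "low (\<lambda>m. - w m) f = - low w f" using width_int[of f] assms(1) by simp
  then show ?thesis using low_le[OF assms(2), of w] low_le[OF assms(2), of "\<lambda>m. - w m"] by simp
qed

lemma width_one [simp]: "width (1 :: ('n, 'k::field) group_algebra) = 0"
  using width_mult[of 1 1] by simp

lemma width_character [simp]: "width (character m :: ('n, 'k::field) group_algebra) = 0"
  unfolding width_def low_character weight.low_character[OF weight_uminus] by simp

lemma width_unit:
  fixes f :: "('n, 'k::field) group_algebra"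
  assumes "f dvd 1" shows "width f = 0"
proof -
  obtain g where g: "1 = f * g" using assms by (rule dvdE)
  then have "f \<noteq> 0" "g \<noteq> 0" by auto
  then show ?thesis using width_mult[of f g] g by (metis add_is_0 width_one)
qed

end

definition coord :: "'n \<Rightarrow> ('n \<Rightarrow>\<^sub>0 int) \<Rightarrow> int" where
  "coord i m = Poly_Mapping.lookup m i"

lemma weight_coord: "weight (coord i)"
  by unfold_locales (simp add: coord_def lookup_add)

lemma monomial_unit: "c \<noteq> 0 \<Longrightarrow> (Poly_Mapping.single m c :: ('n::linorder, 'k::field) group_algebra) dvd 1"
  by (rule dvdI[of _ _ "Poly_Mapping.single (- m) (inverse c)"]) (simp add: mult_single)

text \<open>A unit has width zero for all coordinate functions, so that its Newton polytope is a point.\<close>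

lemma unit_is_monomial:
  fixes f :: "('n::linorder, 'k::field) group_algebra"
  assumes "f dvd 1" shows "\<exists>m c. c \<noteq> 0 \<and> f = Poly_Mapping.single m c"
proof -
  have "f \<noteq> 0" using assms by auto
  then obtain m where m: "m \<in> Poly_Mapping.keys f" using low_attained by blast
  have "n = m" if n: "n \<in> Poly_Mapping.keys f" for n
  proof (rule poly_mapping_eqI)
    fix i
    have "coord i n = coord i m"
      using weight.width_zero[OF weight_coord weight.width_unit[OF weight_coord assms]] m n by metis
    then show "Poly_Mapping.lookup n i = Poly_Mapping.lookup m i" by (simp add: coord_def)
  qed
  then have "f = Poly_Mapping.single m (Poly_Mapping.lookup f m)"
    by (intro poly_mapping_eqI) (metis lookup_single_eq lookup_single_not_eq not_in_keys_iff_lookup_eq_zero)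
  moreover have "Poly_Mapping.lookup f m \<noteq> 0" using m by (simp add: in_keys_iff)
  ultimately show ?thesis by blast
qed

lemma character_unit: "(character m :: ('n::linorder, 'k::field) group_algebra) dvd 1"
  by (rule monomial_unit) simp

lemma character_mult_cancel: "character (- m) * (character m * f) = (f :: ('n::linorder, 'k::field) group_algebra)"
  by (simp add: mult.assoc[symmetric] mult_single)

section \<open>Unique factorization of Laurent polynomials\<close>

definition supported_on :: "'n set \<Rightarrow> ('n, 'k::field) group_algebra set" where
  "supported_on J = {f. \<forall>m\<in>Poly_Mapping.keys f. Poly_Mapping.keys m \<subseteq> J}"

lemma supported_on_iff_coord:
  "f \<in> supported_on J \<longleftrightarrow> (\<forall>m\<in>Poly_Mapping.keys f. \<forall>i. i \<notin> J \<longrightarrow> coord i m = 0)"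
  unfolding supported_on_def coord_def by (simp add: subset_iff in_keys_iff) blast

lemma supported_on_add: "f \<in> supported_on J \<Longrightarrow> g \<in> supported_on J \<Longrightarrow> f + g \<in> supported_on J"
  unfolding supported_on_def using keys_add_elim[of _ f g] by blast

lemma supported_on_uminus: "f \<in> supported_on J \<Longrightarrow> - f \<in> supported_on J"
  unfolding supported_on_def by (simp add: in_keys_iff)

lemma supported_on_mult:
  fixes f g :: "('n::linorder, 'k::field) group_algebra"
  assumes "f \<in> supported_on J" "g \<in> supported_on J" shows "f * g \<in> supported_on J"
  unfolding supported_on_iff_coord
proof (intro ballI allI impI)
  fix m i assume "m \<in> Poly_Mapping.keys (f * g)" "i \<notin> J"
  then obtain a b where "a \<in> Poly_Mapping.keys f" "b \<in> Poly_Mapping.keys g" "m = a + b"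
    by (elim keys_mult_elim)
  then show "coord i m = 0" using assms \<open>i \<notin> J\<close> weight.add[OF weight_coord, of i a b]
    unfolding supported_on_iff_coord by simp
qed

lemma supported_on_one: "1 \<in> supported_on J"
  by (simp add: supported_on_def)

lemma supported_on_character: "Poly_Mapping.keys m \<subseteq> J \<Longrightarrow> character m \<in> supported_on J"
  by (simp add: supported_on_def)

lemma supported_on_mono:
  assumes "I \<subseteq> J" shows "supported_on I \<subseteq> supported_on J"
proof
  fix f assume "f \<in> supported_on I"
  then show "f \<in> supported_on J" using assms unfolding supported_on_def by fast
qed

lemma supported_on_part: "f \<in> supported_on J \<Longrightarrow> part P f \<in> supported_on J"
  by (simp add: supported_on_def keys_part)

lemma supported_on_quotient:
  fixes d q :: "('n::linorder, 'k::field) group_algebra"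
  assumes "q * d \<in> supported_on J" "d \<in> supported_on J" "d \<noteq> 0" "q \<noteq> 0"
  shows "q \<in> supported_on J"
  unfolding supported_on_iff_coord
proof (intro ballI allI impI)
  fix m i assume m: "m \<in> Poly_Mapping.keys q" and i: "i \<notin> J"
  interpret weight "coord i" by (rule weight_coord)
  have low0: "low (coord i) f = 0 \<and> width f = 0" if f: "f \<in> supported_on J" "f \<noteq> 0"
    for f :: "('n, 'k) group_algebra"
  proof -
    have z: "coord i m = 0" if "m \<in> Poly_Mapping.keys f" for m
      using f(1) i that unfolding supported_on_iff_coord by blast
    obtain n where n: "n \<in> Poly_Mapping.keys f" using low_attained[OF f(2)] by blast
    have "low (coord i) f = 0" "low (\<lambda>m. - coord i m) f = 0"
      by (rule low_eqI[OF _ n]; use z n in simp)+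
    then show ?thesis by (simp add: width_def)
  qed
  have "q * d \<noteq> 0" using assms by simp
  then have "low (coord i) q + low (coord i) d = 0" "width q + width d = 0"
    using low0[OF assms(1)] low_mult[OF assms(4,3)] width_mult[OF assms(4,3)] by simp_all
  then have "low (coord i) q = 0" "width q = 0" using low0[OF assms(2,3)] by simp_all
  then show "coord i m = 0" using width_zero[OF _ m] by simp
qed

definition prime_in :: "('n::linorder, 'k::field) group_algebra set \<Rightarrow> ('n, 'k) group_algebra \<Rightarrow> bool" where
  "prime_in A p \<longleftrightarrow> p \<in> A \<and> p \<noteq> 0 \<and> \<not> p dvd 1 \<and> (\<forall>a\<in>A. \<forall>b\<in>A. p dvd a * b \<longrightarrow> p dvd a \<or> p dvd b)"

lemma prime_inD:
  assumes "prime_in A p"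
  shows "p \<in> A" "p \<noteq> 0" "\<not> p dvd 1" "a \<in> A \<Longrightarrow> b \<in> A \<Longrightarrow> p dvd a * b \<Longrightarrow> p dvd a \<or> p dvd b"
  using assms unfolding prime_in_def by blast+

text \<open>Divisibility by a Laurent polynomial not involving the variable \<open>x\<close> is tested on the
  coefficients with respect to \<open>x\<close>.\<close>

lemma dvd_part_coord:
  fixes p a :: "('n::linorder, 'k::field) group_algebra"
  assumes p: "p \<in> supported_on J" and x: "x \<notin> J" and dvd: "p dvd a"
  shows "p dvd part (\<lambda>m. coord x m = d) a"
proof -
  interpret weight "coord x" by (rule weight_coord)
  obtain c where c: "a = p * c" using dvd by (rule dvdE)
  let ?P = "\<lambda>m. coord x m = d"
  have p0: "coord x m = 0" if "m \<in> Poly_Mapping.keys p" for m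
    using p x that unfolding supported_on_iff_coord by blast
  have "part ?P (p * part ?P c) = p * part ?P c"
  proof (rule part_id)
    fix m assume "m \<in> Poly_Mapping.keys (p * part ?P c)"
    then obtain u v where "u \<in> Poly_Mapping.keys p" "v \<in> Poly_Mapping.keys (part ?P c)" "m = u + v"
      by (rule keys_mult_elim)
    then show "coord x m = d" using p0[of u] add[of u v] by (simp add: keys_part)
  qed
  moreover have "part ?P (p * part (\<lambda>m. \<not> ?P m) c) = 0"
  proof (rule part_zero)
    fix m assume "m \<in> Poly_Mapping.keys (p * part (\<lambda>m. \<not> ?P m) c)"
    then obtain u v where "u \<in> Poly_Mapping.keys p" "v \<in> Poly_Mapping.keys (part (\<lambda>m. \<not> ?P m) c)" "m = u + v"
      by (rule keys_mult_elim)
    then show "coord x m \<noteq> d" using p0[of u] add[of u v] by (simp add: keys_part)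
  qed
  moreover have "a = p * part ?P c + p * part (\<lambda>m. \<not> ?P m) c"
    unfolding c distrib_left[symmetric] part_complement by (rule refl)
  ultimately have "part ?P a = p * part ?P c" by (simp add: part_add)
  then show ?thesis by simp
qed

lemma part_eq_sum_coord:
  fixes a :: "('n::linorder, 'k::field) group_algebra"
  shows "part (\<lambda>m. Q (coord x m)) a = (\<Sum>d\<in>{d \<in> coord x ` Poly_Mapping.keys a. Q d}. part (\<lambda>m. coord x m = d) a)"
proof (rule poly_mapping_eqI)
  fix m
  let ?D = "{d \<in> coord x ` Poly_Mapping.keys a. Q d}"
  have "Poly_Mapping.lookup (\<Sum>d\<in>?D. part (\<lambda>m. coord x m = d) a) m
    = (\<Sum>d\<in>?D. if d = coord x m then Poly_Mapping.lookup a m else 0)"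
    unfolding lookup_sum lookup_part by (intro sum.cong refl) (simp add: eq_commute)
  also have "\<dots> = (if coord x m \<in> ?D then Poly_Mapping.lookup a m else 0)" by (subst sum.delta) simp_all
  also have "\<dots> = Poly_Mapping.lookup (part (\<lambda>m. Q (coord x m)) a) m"
    unfolding lookup_part by (cases "m \<in> Poly_Mapping.keys a") (simp_all add: in_keys_iff)
  finally show "Poly_Mapping.lookup (part (\<lambda>m. Q (coord x m)) a) m =
    Poly_Mapping.lookup (\<Sum>d\<in>?D. part (\<lambda>m. coord x m = d) a) m" by simp
qed

lemma coord_single: "coord i (Poly_Mapping.single x d) = (if i = x then d else 0)"
  by (simp add: coord_def lookup_single when_def)

text \<open>The coefficient of the lowest power of the variable \<open>x\<close>, which no longer
  involves \<open>x\<close>.\<close>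

definition init_coeff :: "'n::linorder \<Rightarrow> ('n, 'k::field) group_algebra \<Rightarrow> ('n, 'k) group_algebra" where
  "init_coeff x f = character (- Poly_Mapping.single x (low (coord x) f)) * init (coord x) f"

lemma init_eq_coeff:
  "init (coord x) f = character (Poly_Mapping.single x (low (coord x) f)) * init_coeff x f"
  unfolding init_coeff_def
  by (rule character_mult_cancel[of "- Poly_Mapping.single x (low (coord x) f)", unfolded minus_minus, symmetric])

lemma init_coeff_nonzero: "f \<noteq> 0 \<Longrightarrow> init_coeff x f \<noteq> 0"
  using init_nonzero[of f "coord x"] by (simp add: init_coeff_def)

lemma init_coeff_supported:
  assumes "f \<in> supported_on (insert x J)" shows "init_coeff x f \<in> supported_on J"
  unfolding supported_on_iff_coord
proof (intro ballI allI impI)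
  fix m i assume m: "m \<in> Poly_Mapping.keys (init_coeff x f)" and i: "i \<notin> J"
  obtain n where n: "n \<in> Poly_Mapping.keys (init (coord x) f)" "m = - Poly_Mapping.single x (low (coord x) f) + n"
    using m unfolding init_coeff_def keys_character_mult by blast
  then have n': "n \<in> Poly_Mapping.keys f" "coord x n = low (coord x) f" by (simp_all add: keys_init)
  have "coord i m = - coord i (Poly_Mapping.single x (low (coord x) f)) + coord i n"
    unfolding n(2) weight.add[OF weight_coord] weight.minus[OF weight_coord] by (rule refl)
  moreover have "i \<noteq> x \<Longrightarrow> coord i n = 0" using assms n'(1) i unfolding supported_on_iff_coord by blast
  ultimately show "coord i m = 0" using n'(2) by (cases "i = x") (simp_all add: coord_single)
qed

lemma init_coeff_mult:
  fixes f g :: "('n::linorder, 'k::field) group_algebra"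
  assumes "f \<noteq> 0" "g \<noteq> 0" shows "init_coeff x (f * g) = init_coeff x f * init_coeff x g"
proof -
  interpret weight "coord x" by (rule weight_coord)
  have "init_coeff x (f * g) =
    character (- Poly_Mapping.single x (low (coord x) f) + - Poly_Mapping.single x (low (coord x) g)) *
      (init (coord x) f * init (coord x) g)"
    unfolding init_coeff_def low_mult[OF assms] init_mult[OF assms] by (simp add: single_add)
  then show ?thesis unfolding init_coeff_def character_mult[symmetric] by (simp add: mult_ac)
qed

lemma init_coeff_supported_id:
  fixes p :: "('n::linorder, 'k::field) group_algebra"
  assumes "p \<in> supported_on J" "x \<notin> J" "p \<noteq> 0" shows "init_coeff x p = p"
proof -
  have z: "coord x m = 0" if "m \<in> Poly_Mapping.keys p" for m
    using assms(1,2) that unfolding supported_on_iff_coord by blast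
  obtain n where "n \<in> Poly_Mapping.keys p" using low_attained[OF assms(3)] by blast
  then have low: "low (coord x) p = 0" using z by (intro low_eqI) simp_all
  have "init (coord x) p = p" unfolding init_def low by (rule part_id) (rule z)
  then show ?thesis by (simp add: init_coeff_def low)
qed

text \<open>The analogue of the lemma of Gauss: if \<open>p\<close> divides neither factor, then
  after removing the coefficients divisible by \<open>p\<close> the lowest coefficients of the
  factors are not divisible by \<open>p\<close>, and hence neither is their product.\<close>

lemma prime_in_insert:
  fixes p :: "('n::linorder, 'k::field) group_algebra"
  assumes p: "prime_in (supported_on J) p" and x: "x \<notin> J"
  shows "prime_in (supported_on (insert x J)) p"
  unfolding prime_in_def
proof (intro conjI ballI impI)
  interpret weight "coord x" by (rule weight_coord)
  let ?B = "supported_on (insert x J) :: ('n, 'k) group_algebra set"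
  show "p \<in> ?B" using prime_inD(1)[OF p] supported_on_mono[of J "insert x J"] by blast
  show "p \<noteq> 0" "\<not> p dvd 1" using prime_inD[OF p] by blast+
  fix a b assume ab: "a \<in> ?B" "b \<in> ?B" "p dvd a * b"
  \<comment> \<open>Only the coefficients not divisible by \<open>p\<close> matter; the lowest of them is the initial one.\<close>
  define red where "red a = part (\<lambda>m. \<not> p dvd part (\<lambda>n. coord x n = coord x m) a) a" for a
  have red: "p dvd a - red a" for a
  proof -
    have "p dvd part (\<lambda>m. p dvd part (\<lambda>n. coord x n = coord x m) a) a"
      unfolding part_eq_sum_coord[of "\<lambda>d. p dvd part (\<lambda>n. coord x n = d) a"]
      by (rule dvd_sum) simp
    moreover have "a - red a = part (\<lambda>m. p dvd part (\<lambda>n. coord x n = coord x m) a) a"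
      using part_complement[of "\<lambda>m. p dvd part (\<lambda>n. coord x n = coord x m) a" a]
      unfolding red_def by (simp add: algebra_simps)
    ultimately show ?thesis by simp
  qed
  have ndvd: "\<not> p dvd init_coeff x (red a)" if nz: "red a \<noteq> 0" for a
  proof
    assume "p dvd init_coeff x (red a)"
    then have dvd: "p dvd init (coord x) (red a)" unfolding init_eq_coeff[of x "red a"] by simp
    obtain m where m: "m \<in> Poly_Mapping.keys (red a)" "coord x m = low (coord x) (red a)"
      using low_attained[OF nz] by blast
    have nd: "\<not> p dvd part (\<lambda>n. coord x n = coord x m) a" using m(1) unfolding red_def keys_part by simp
    have "init (coord x) (red a) = part (\<lambda>n. coord x n = coord x m) a"
    proof (rule poly_mapping_eqI)
      fix k
      have "Poly_Mapping.lookup (init (coord x) (red a)) k =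
        (if coord x k = coord x m then Poly_Mapping.lookup (red a) k else 0)"
        by (simp only: init_def m(2) lookup_part)
      moreover have "Poly_Mapping.lookup (red a) k =
        (if \<not> p dvd part (\<lambda>n. coord x n = coord x k) a then Poly_Mapping.lookup a k else 0)"
        by (simp only: red_def lookup_part)
      ultimately show "Poly_Mapping.lookup (init (coord x) (red a)) k =
        Poly_Mapping.lookup (part (\<lambda>n. coord x n = coord x m) a) k"
        using nd by (cases "coord x k = coord x m") (simp_all add: lookup_part)
    qed
    then show False using dvd nd by simp
  qed
  have redB: "red a \<in> ?B" if "a \<in> ?B" for a
    unfolding red_def by (rule supported_on_part[OF that])
  show "p dvd a \<or> p dvd b"
  proof (cases "red a = 0 \<or> red b = 0")
    case True
    then show ?thesis using red[of a] red[of b] by (metis diff_zero)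
  next
    case False
    have "a * b - red a * red b = a * (b - red b) + (a - red a) * red b" by (simp add: algebra_simps)
    moreover have "p dvd \<dots>" using red[of a] red[of b] by (intro dvd_add dvd_mult dvd_mult2)
    ultimately have "p dvd a * b - red a * red b" by metis
    from dvd_diff[OF ab(3) this] have "p dvd red a * red b" by simp
    then have "p dvd init (coord x) (red a * red b)"
      unfolding init_def by (rule dvd_part_coord[OF prime_inD(1)[OF p] x])
    then have "p dvd init_coeff x (red a * red b)" unfolding init_coeff_def by (rule dvd_mult)
    then have "p dvd init_coeff x (red a) * init_coeff x (red b)" using init_coeff_mult False by metis
    then show ?thesis
      using prime_inD(4)[OF p init_coeff_supported[OF redB[OF ab(1)]] init_coeff_supported[OF redB[OF ab(2)]]]
        ndvd[of a] ndvd[of b] False by blast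
  qed
qed

text \<open>Factorizations are in the subring \<open>A\<close>, with as many prime factors as the
  index says. The number is recorded because an induction on the length of a factorization of the
  lowest coefficient controls the factors free of \<open>x\<close> that can be split off.\<close>

inductive factored :: "('n::linorder, 'k::field) group_algebra set \<Rightarrow> nat \<Rightarrow> ('n, 'k) group_algebra \<Rightarrow> bool"
  for A where
  unit: "u \<in> A \<Longrightarrow> u dvd 1 \<Longrightarrow> factored A 0 u"
| prime: "factored A n f \<Longrightarrow> prime_in A p \<Longrightarrow> factored A (Suc n) (p * f)"

lemma factored_nonzero: "factored A n f \<Longrightarrow> f \<noteq> 0"
proof (induction rule: factored.induct)
  case (unit u)
  then show ?case by (metis dvd_0_left_iff zero_neq_one)
next
  case (prime n f p)
  then show ?case using prime_inD(2)[of A p] by simp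
qed

lemma factored_in:
  assumes "factored (supported_on J) n f" shows "f \<in> supported_on J"
  using assms by (induction rule: factored.induct) (auto intro: supported_on_mult prime_inD(1))

lemma factored_mult_unit:
  assumes "factored (supported_on J) n f" "u \<in> supported_on J" "u dvd 1"
  shows "factored (supported_on J) n (u * f)"
  using assms(1)
proof (induction rule: factored.induct)
  case (unit v)
  have "u * v dvd 1" using mult_dvd_mono[OF assms(3) unit(2)] by simp
  then show ?case using supported_on_mult[OF assms(2) unit(1)] by (intro factored.unit)
next
  case (prime n f p)
  then show ?case using factored.prime[OF prime(3) prime(2)] by (simp add: mult.left_commute)
qed

lemma factored_mult:
  assumes "factored (supported_on J) n f" "factored (supported_on J) k g"
  shows "factored (supported_on J) (n + k) (f * g)"
  using assms(1)
proof (induction rule: factored.induct)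
  case (unit u)
  then show ?case using factored_mult_unit[OF assms(2)] by simp
next
  case (prime n f p)
  then show ?case using factored.prime[OF prime(3) prime(2)] by (simp add: mult.assoc)
qed

lemma factored_one: "factored (supported_on J) 0 1"
  by (rule factored.unit) (simp_all add: supported_on_one)

lemma factored_insert:
  assumes "factored (supported_on J) n f" "x \<notin> J"
  shows "factored (supported_on (insert x J)) n f"
  using assms(1)
proof (induction rule: factored.induct)
  case (unit u)
  then show ?case using supported_on_mono[of J "insert x J"] by (intro factored.unit) blast+
next
  case (prime n f p)
  then show ?case using prime_in_insert[OF _ assms(2)] by (intro factored.prime)
qed

text \<open>The prime divides one of the prime factors and hence is associated with it.\<close>

lemma factored_cancel_prime:
  assumes "factored (supported_on J) n f" "prime_in (supported_on J) p" "f = p * s" "s \<in> supported_on J"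
  shows "\<exists>k. n = Suc k \<and> factored (supported_on J) k s"
  using assms(1,3,4)
proof (induction arbitrary: s rule: factored.induct)
  case (unit u)
  then have "p dvd 1" using dvd_trans[of p u 1] by simp
  then show ?case using prime_inD(3)[OF assms(2)] by blast
next
  case (prime n f q)
  have q: "q \<noteq> 0" "p \<noteq> 0" using prime_inD(2)[OF prime(2)] prime_inD(2)[OF assms(2)] by blast+
  have "p dvd q * f" using prime(4) by simp
  then consider "p dvd q" | "p dvd f"
    using prime_inD(4)[OF assms(2) prime_inD(1)[OF prime(2)] factored_in[OF prime(1)]] by blast
  then show ?case
  proof cases
    case 1
    then obtain u where u: "q = p * u" by (rule dvdE)
    have u0: "u \<noteq> 0" using q(1) u by auto
    have "u * p \<in> supported_on J" using prime_inD(1)[OF prime(2)] u by (simp add: mult.commute)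
    then have uJ: "u \<in> supported_on J"
      by (rule supported_on_quotient) (use prime_inD(1)[OF assms(2)] q u0 in simp_all)
    have "q dvd p \<or> q dvd u"
      using prime_inD(4)[OF prime(2) prime_inD(1)[OF assms(2)] uJ] u by simp
    moreover have "\<not> q dvd u"
    proof
      assume "q dvd u"
      then obtain v where v: "u = q * v" by (rule dvdE)
      then have "u * 1 = u * (p * v)" using u by (simp add: mult_ac)
      then have "1 = p * v" using u0 by (metis mult_cancel_left)
      then show False using prime_inD(3)[OF assms(2)] by (metis dvdI)
    qed
    ultimately obtain v where v: "p = q * v" by (auto elim: dvdE)
    then have "p * 1 = p * (u * v)" using u by (simp add: mult_ac)
    then have "1 = u * v" using q(2) by (metis mult_cancel_left)
    then have "u dvd 1" by (metis dvdI)
    moreover have "p * s = p * (u * f)" using prime(4) u by (metis mult.assoc)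
    then have "s = u * f" using q(2) by (metis mult_cancel_left)
    ultimately show ?thesis using factored_mult_unit[OF prime(1) uJ] by blast
  next
    case 2
    then obtain t where t: "f = p * t" by (rule dvdE)
    have t0: "t \<noteq> 0" using t factored_nonzero[OF prime(1)] by auto
    have "t * p \<in> supported_on J" using factored_in[OF prime(1)] t by (simp add: mult.commute)
    then have tJ: "t \<in> supported_on J"
      by (rule supported_on_quotient) (use prime_inD(1)[OF assms(2)] q t0 in simp_all)
    obtain k where k: "n = Suc k" "factored (supported_on J) k t" using prime(3)[OF t tJ] by blast
    have "p * s = p * (q * t)" using prime(4) t by (metis mult.left_commute)
    then have "s = q * t" using q(2) by (metis mult_cancel_left)
    then show ?thesis using factored.prime[OF k(2) prime(2)] k(1) by blast
  qed
qed

text \<open>Cancelling the primes of \<open>s\<close> one by one in \<open>s e = q d\<close>.\<close>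

lemma factored_split:
  assumes "factored (supported_on J) n s" "x \<notin> J"
    "s * e = q * d" "q \<noteq> 0" "d \<noteq> 0" "q \<in> supported_on (insert x J)" "d \<in> supported_on (insert x J)"
  shows "\<exists>q' d' c k. e = q' * d' \<and> d = c * d' \<and> factored (supported_on J) k c \<and>
    q' \<in> supported_on (insert x J) \<and> d' \<in> supported_on (insert x J)"
  using assms(1,3-7)
proof (induction arbitrary: q d rule: factored.induct)
  case (unit u)
  obtain v where v: "1 = u * v" using unit(2) by (rule dvdE)
  have "v \<noteq> 0" "u \<noteq> 0" using v by auto
  then have vJ: "v \<in> supported_on J"
    by (intro supported_on_quotient[of v u]) (use v unit(1) supported_on_one in \<open>simp_all add: mult.commute\<close>)
  have "e = (v * u) * e" using v by (simp add: mult.commute)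
  also have "\<dots> = (v * q) * d" using unit(3) by (simp add: mult.assoc)
  finally have "e = (v * q) * d" .
  moreover have "v * q \<in> supported_on (insert x J)"
    using vJ unit(6) supported_on_mono[of J "insert x J"] by (intro supported_on_mult) blast+
  ultimately show ?case using factored_one unit(7) by (metis mult_1)
next
  case (prime n f p)
  have p: "p \<noteq> 0" "p \<in> supported_on (insert x J)" "prime_in (supported_on (insert x J)) p"
    using prime_inD(2)[OF prime(2)] prime_inD(1)[OF prime_in_insert[OF prime(2) assms(2)]]
      prime_in_insert[OF prime(2) assms(2)] by blast+
  have eq: "p * (f * e) = q * d" using prime(4) by (simp add: mult.assoc)
  then have "p dvd q * d" by (metis dvdI)
  then consider "p dvd q" | "p dvd d" using prime_inD(4)[OF p(3) prime(7,8)] by blast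
  then show ?case
  proof cases
    case 1
    then obtain q1 where q1: "q = p * q1" by (rule dvdE)
    have q10: "q1 \<noteq> 0" using q1 prime(5) by auto
    have "q1 * p \<in> supported_on (insert x J)" using prime(7) q1 by (simp add: mult.commute)
    then have q1J: "q1 \<in> supported_on (insert x J)" by (rule supported_on_quotient) (use p q10 in simp_all)
    have "p * (f * e) = p * (q1 * d)" using eq q1 by (simp add: mult.assoc)
    then have "f * e = q1 * d" using p(1) by (metis mult_cancel_left)
    then show ?thesis by (rule prime(3)[OF _ q10 prime(6) q1J prime(8)])
  next
    case 2
    then obtain d1 where d1: "d = p * d1" by (rule dvdE)
    have d10: "d1 \<noteq> 0" using d1 prime(6) by auto
    have "d1 * p \<in> supported_on (insert x J)" using prime(8) d1 by (simp add: mult.commute)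
    then have d1J: "d1 \<in> supported_on (insert x J)" by (rule supported_on_quotient) (use p d10 in simp_all)
    have "p * (f * e) = p * (q * d1)" using eq d1 by (simp add: mult.left_commute)
    then have "f * e = q * d1" using p(1) by (metis mult_cancel_left)
    then obtain q' d' c k where *: "e = q' * d'" "d1 = c * d'" "factored (supported_on J) k c"
      "q' \<in> supported_on (insert x J)" "d' \<in> supported_on (insert x J)"
      using prime(3)[OF _ prime(5) d10 prime(7) d1J] by blast
    have "d = (p * c) * d'" using d1 *(2) by (simp add: mult.assoc)
    then show ?thesis using * factored.prime[OF *(3) prime(2)] by blast
  qed
qed

text \<open>The primes of \<open>s\<close> remain prime after adjoining \<open>x\<close>. Each of
  them divides the cofactor of \<open>f\<close> in \<open>s e\<close>, since it does not divide
  \<open>f\<close>, and can be cancelled.\<close>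

lemma dvd_cancel_factored:
  assumes "factored (supported_on J) n s" "x \<notin> J" "f \<noteq> 0"
    "f \<in> supported_on (insert x J)" "e \<in> supported_on (insert x J)" "f dvd s * e"
    and np: "\<And>p. prime_in (supported_on J) p \<Longrightarrow> \<not> p dvd f"
  shows "f dvd e"
  using assms(1,6)
proof (induction rule: factored.induct)
  case (unit u)
  obtain v where v: "1 = u * v" using unit(2) by (rule dvdE)
  have "f dvd v * (u * e)" using unit(3) by (rule dvd_mult)
  moreover have "v * (u * e) = e" using v by (simp add: mult_ac flip: mult.assoc)
  ultimately show ?case by simp
next
  case (prime n s p)
  have p: "p \<noteq> 0" "prime_in (supported_on (insert x J)) p"
    using prime_inD(2)[OF prime(2)] prime_in_insert[OF prime(2) assms(2)] by blast+
  obtain c where c: "p * s * e = f * c" using prime(4) by (rule dvdE)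
  show ?case
  proof (cases "e = 0")
    case False
    have "s \<noteq> 0" using factored_nonzero[OF prime(1)] .
    then have "p * s * e \<noteq> 0" using p(1) False by simp
    then have c0: "c \<noteq> 0" using c by auto
    have "p * s * e \<in> supported_on (insert x J)"
      using factored_in[OF prime(1)] prime_inD(1)[OF p(2)] assms(5) supported_on_mono[of J "insert x J"]
      by (intro supported_on_mult) blast+
    then have "c * f \<in> supported_on (insert x J)" using c by (simp add: mult.commute)
    then have cJ: "c \<in> supported_on (insert x J)" by (rule supported_on_quotient) (use assms(3,4) c0 in simp_all)
    have "p dvd f * c" unfolding c[symmetric] by (simp add: mult.assoc)
    then have "p dvd c" using prime_inD(4)[OF p(2) assms(4) cJ] np[OF prime(2)] by blast
    then obtain c1 where "c = p * c1" by (rule dvdE)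
    then have "p * (s * e) = p * (f * c1)" using c by (simp add: mult_ac)
    then have "s * e = f * c1" using p(1) by (metis mult_cancel_left)
    then show ?thesis by (intro prime(3)) simp
  qed simp
qed

text \<open>Pseudo-division. The ideal \<open>I\<close> need not be principal, but
  \<open>e\<close> times the lowest coefficient of \<open>d\<close> and a suitable multiple of
  \<open>d\<close> have the same lowest part, and their difference has smaller width than
  \<open>e\<close>. The multipliers that accumulate in this way do not involve \<open>x\<close>, and
  have factorizations.\<close>

lemma least_width_divides:
  fixes d e :: "('n::linorder, 'k::field) group_algebra"
  assumes fac: "\<And>s :: ('n, 'k) group_algebra. s \<in> supported_on J \<Longrightarrow> s \<noteq> 0 \<Longrightarrow> \<exists>n. factored (supported_on J) n s"
    and Id: "d \<in> I" and IB: "I \<subseteq> supported_on (insert x J)" and d: "d \<noteq> 0"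
    and Iadd: "\<And>a b. a \<in> I \<Longrightarrow> b \<in> I \<Longrightarrow> a + b \<in> I"
    and Imult: "\<And>a b. a \<in> supported_on (insert x J) \<Longrightarrow> b \<in> I \<Longrightarrow> a * b \<in> I"
    and min: "\<And>a. a \<in> I \<Longrightarrow> a \<noteq> 0 \<Longrightarrow> weight.width (coord x) d \<le> weight.width (coord x) a"
    and e: "e \<in> I"
  shows "\<exists>s n q. factored (supported_on J) n s \<and> q \<in> supported_on (insert x J) \<and> s * e = q * d"
  using e
proof (induction "weight.width (coord x) e" arbitrary: e rule: less_induct)
  case (less e)
  interpret weight "coord x" by (rule weight_coord)
  let ?B = "supported_on (insert x J) :: ('n, 'k) group_algebra set"
  have JB: "supported_on J \<subseteq> ?B" by (rule supported_on_mono) blast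
  show ?case
  proof (cases "e = 0")
    case True
    have "1 * e = 0 * d" "0 \<in> ?B" using True by (simp_all add: supported_on_def)
    then show ?thesis using factored_one by blast
  next
    case False
    have dB: "d \<in> ?B" and eB: "e \<in> ?B" using IB Id less(2) by blast+
    \<comment> \<open>The multiplier of \<open>e\<close> and the multiplier \<open>c\<close> of \<open>d\<close> that matches the lowest parts, with the
      power of \<open>x\<close> by which they differ.\<close>
    define s where "s = init_coeff x d"
    have sJ: "s \<in> supported_on J" "s \<noteq> 0"
      unfolding s_def using init_coeff_supported[OF dB] init_coeff_nonzero[OF d] by blast+
    define c where "c = character (Poly_Mapping.single x (low (coord x) e - low (coord x) d)) * init_coeff x e"
    have ch: "(character (Poly_Mapping.single x k) :: ('n, 'k) group_algebra) \<in> ?B" for k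
      by (rule supported_on_character) simp
    have cB: "c \<in> ?B" unfolding c_def using init_coeff_supported[OF eB] JB ch
      by (intro supported_on_mult) blast+
    have c0: "c \<noteq> 0" unfolding c_def using init_coeff_nonzero[OF False, of x] by simp
    define r where "r = s * e + (- c) * d"
    have rI: "r \<in> I" unfolding r_def
      using sJ JB less(2) Id supported_on_uminus[OF cB] by (intro Iadd Imult) blast+
    have low_s: "low (coord x) s = 0" "width s = 0"
    proof -
      have z: "coord x m = 0" if "x \<notin> J" "m \<in> Poly_Mapping.keys s" for m
        using sJ(1) that unfolding supported_on_iff_coord by blast
      have zz: "coord x m = 0" if m: "m \<in> Poly_Mapping.keys s" for m
      proof -
        obtain n where n: "n \<in> Poly_Mapping.keys (init (coord x) d)"
          "m = - Poly_Mapping.single x (low (coord x) d) + n"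
          using m unfolding s_def init_coeff_def keys_character_mult by blast
        have "coord x n = low (coord x) d" using n(1) by (simp add: keys_init)
        then show ?thesis unfolding n(2) add minus by (simp add: coord_single)
      qed
      obtain n where n: "n \<in> Poly_Mapping.keys s" using low_attained[OF sJ(2)] by blast
      have "low (coord x) s = 0" "low (\<lambda>m. - coord x m) s = 0"
        by (rule low_eqI[OF _ n]; use zz n in simp)+
      then show "low (coord x) s = 0" "width s = 0" by (simp_all add: width_def)
    qed
    have init_c: "init (coord x) (s * e) = init (coord x) (c * d)"
    proof -
      have hom: "init (coord x) h = h" if "width h = 0" for h :: "('n, 'k) group_algebra"
        unfolding init_def by (rule part_id) (rule width_zero[OF that])
      have w0: "width (init_coeff x h) = 0" if hz: "h \<noteq> 0" for h :: "('n, 'k) group_algebra"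
      proof -
        have "width (init (coord x) h) = 0"
        proof -
          obtain n where n: "n \<in> Poly_Mapping.keys (init (coord x) h)"
            using low_attained[OF init_nonzero[OF hz]] by blast
          have "low (coord x) (init (coord x) h) = low (coord x) h"
            "low (\<lambda>m. - coord x m) (init (coord x) h) = - low (coord x) h"
            by (rule low_eqI[OF _ n]; use n in \<open>simp add: keys_init\<close>)+
          then show ?thesis by (simp add: width_def)
        qed
        then show ?thesis unfolding init_coeff_def
          using width_mult[OF character_nonzero init_nonzero[OF hz]] by simp
      qed
      have wc: "width c = 0" unfolding c_def
        using width_mult[OF character_nonzero init_coeff_nonzero[OF False]] w0[OF False] by simp
      have "init (coord x) (s * e) = s * init (coord x) e"
        unfolding init_mult[OF sJ(2) False] hom[OF low_s(2)] by (rule refl)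
      also have "\<dots> = character (Poly_Mapping.single x (low (coord x) e)) * (s * init_coeff x e)"
        unfolding init_eq_coeff[of x e] by (rule mult.left_commute)
      also have "\<dots> = c * (character (Poly_Mapping.single x (low (coord x) d)) * s)"
      proof -
        have "character (Poly_Mapping.single x (low (coord x) e)) =
          character (Poly_Mapping.single x (low (coord x) e - low (coord x) d)) *
            (character (Poly_Mapping.single x (low (coord x) d)) :: ('n, 'k) group_algebra)"
          by (simp add: character_mult single_add[symmetric])
        then show ?thesis unfolding c_def by (simp only: mult_ac)
      qed
      also have "\<dots> = c * init (coord x) d" unfolding s_def init_eq_coeff[of x d] by (rule refl)
      also have "\<dots> = init (coord x) (c * d)"
        unfolding init_mult[OF c0 d] hom[OF wc] by (rule refl)
      finally show ?thesis .
    qed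
    have se0: "s * e \<noteq> 0" and cd0: "c * d \<noteq> 0" using sJ(2) False c0 d by simp_all
    have low_se: "low (coord x) (s * e) = low (coord x) e" using low_mult[OF sJ(2) False] low_s(1) by simp
    have low_cd: "low (coord x) (c * d) = low (coord x) e"
    proof -
      obtain m where "m \<in> Poly_Mapping.keys (init (coord x) (c * d))"
        using low_attained[OF init_nonzero[OF cd0]] by blast
      then have "coord x m = low (coord x) (c * d)" "coord x m = low (coord x) (s * e)"
        using keys_init[of m "coord x" "s * e"] keys_init[of m "coord x" "c * d"] init_c by metis+
      then show ?thesis using low_se by simp
    qed
    have width_se: "width (s * e) = width e" using width_mult[OF sJ(2) False] low_s(2) by simp
    have width_cd: "width (c * d) = width d"
    proof -
      have "low (coord x) c = low (coord x) e - low (coord x) d"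
        using low_mult[OF c0 d] low_cd by simp
      have "width c = 0"
      proof -
        have zz: "coord x m = low (coord x) e - low (coord x) d" if m: "m \<in> Poly_Mapping.keys c" for m
        proof -
          obtain n where n: "n \<in> Poly_Mapping.keys (init_coeff x e)"
            "m = Poly_Mapping.single x (low (coord x) e - low (coord x) d) + n"
            using m unfolding c_def keys_character_mult by blast
          obtain k where k: "k \<in> Poly_Mapping.keys (init (coord x) e)"
            "n = - Poly_Mapping.single x (low (coord x) e) + k"
            using n(1) unfolding init_coeff_def keys_character_mult by blast
          have "coord x k = low (coord x) e" using k(1) by (simp add: keys_init)
          then show ?thesis unfolding n(2) k(2) add minus by (simp add: coord_single)
        qed
        obtain n where n: "n \<in> Poly_Mapping.keys c" using low_attained[OF c0] by blast
        have "low (coord x) c = low (coord x) e - low (coord x) d"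
          "low (\<lambda>m. - coord x m) c = - (low (coord x) e - low (coord x) d)"
          by (rule low_eqI[OF _ n]; use zz n in simp)+
        then show ?thesis by (simp add: width_def)
      qed
      then show ?thesis using width_mult[OF c0 d] by simp
    qed
    \<comment> \<open>The lowest part cancels, and at the upper end nothing is added since \<open>c d\<close> starts in the same
      degree as \<open>e\<close> and is not wider than \<open>e\<close>.\<close>
    have de: "width d \<le> width e" by (rule min[OF less(2) False])
    have small: "width r < width e" if r0: "r \<noteq> 0"
    proof -
      have "low (coord x) e + 1 \<le> low (coord x) r"
      proof (rule low_ge[OF r0])
        fix m assume m: "m \<in> Poly_Mapping.keys r"
        have "Poly_Mapping.lookup r m = Poly_Mapping.lookup (s * e) m - Poly_Mapping.lookup (c * d) m"
          unfolding r_def by (simp add: lookup_minus)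
        then have ne: "Poly_Mapping.lookup (s * e) m \<noteq> Poly_Mapping.lookup (c * d) m"
          using m by (simp add: in_keys_iff)
        have "coord x m \<noteq> low (coord x) e"
        proof
          assume *: "coord x m = low (coord x) e"
          have "Poly_Mapping.lookup (init (coord x) (s * e)) m = Poly_Mapping.lookup (s * e) m"
            "Poly_Mapping.lookup (init (coord x) (c * d)) m = Poly_Mapping.lookup (c * d) m"
            unfolding init_def lookup_part low_se low_cd using * by simp_all
          then show False using ne init_c by simp
        qed
        moreover have "m \<in> Poly_Mapping.keys (s * e) \<or> m \<in> Poly_Mapping.keys (c * d)"
          using ne by (metis not_in_keys_iff_lookup_eq_zero)
        then have "low (coord x) e \<le> coord x m"
          using low_le[of m "s * e" "coord x"] low_le[of m "c * d" "coord x"] low_se low_cd by linarith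
        ultimately show "low (coord x) e + 1 \<le> coord x m" by linarith
      qed
      moreover have "low (\<lambda>m. - coord x m) e \<le> low (\<lambda>m. - coord x m) r"
      proof -
        have r: "r = s * e + - (c * d)" unfolding r_def by simp
        have "min (low (\<lambda>m. - coord x m) (s * e)) (low (\<lambda>m. - coord x m) (- (c * d))) \<le> low (\<lambda>m. - coord x m) r"
          unfolding r by (rule weight.low_add_ge[OF weight_uminus]) (use r0 r in simp)
        moreover have "low (\<lambda>m. - coord x m) (- (c * d)) = low (\<lambda>m. - coord x m) (c * d)"
          unfolding low_def by simp
        moreover have "low (\<lambda>m. - coord x m) (s * e) = low (\<lambda>m. - coord x m) e"
          using width_int[OF se0] width_int[OF False] width_se low_se by simp
        moreover have "low (\<lambda>m. - coord x m) (c * d) = - int (width d) - low (coord x) e"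
          using width_int[OF cd0] width_cd low_cd by simp
        moreover have "low (\<lambda>m. - coord x m) e = - int (width e) - low (coord x) e"
          using width_int[OF False] by simp
        ultimately show ?thesis using de by linarith
      qed
      ultimately show ?thesis using width_int[OF r0] width_int[OF False] by linarith
    qed
    obtain s' n q where s': "factored (supported_on J) n s'" "q \<in> ?B" "s' * r = q * d"
    proof (cases "r = 0")
      case True
      have "1 * r = 0 * d" "0 \<in> ?B" using True by (simp_all add: supported_on_def)
      then show ?thesis using that factored_one by blast
    next
      case False
      then show ?thesis using less(1)[OF small[OF False] rI] that by blast
    qed
    obtain k where k: "factored (supported_on J) k s" using fac[OF sJ] by blast
    have "s * e = r + c * d" unfolding r_def by simp
    then have "(s' * s) * e = s' * (r + c * d)" by (simp add: mult.assoc)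
    also have "\<dots> = (q + s' * c) * d" using s'(3) by (simp add: distrib_left distrib_right mult.assoc)
    finally have "(s' * s) * e = (q + s' * c) * d" .
    moreover have "q + s' * c \<in> ?B" using s'(2) factored_in[OF s'(1)] JB cB
      by (intro supported_on_add supported_on_mult) blast+
    ultimately show ?thesis using factored_mult[OF s'(1) k] by blast
  qed
qed

text \<open>Adjoining one variable. An element that neither splits into two factors of smaller width
  nor has a prime factor free of \<open>x\<close> is prime, because modulo factors free of \<open>x\<close> the ideal
  that it generates together with another element is principal.\<close>

lemma prime_in_of_indecomposable:
  fixes f :: "('n::linorder, 'k::field) group_algebra"
  assumes fac: "\<And>s :: ('n, 'k) group_algebra. s \<in> supported_on J \<Longrightarrow> s \<noteq> 0 \<Longrightarrow> \<exists>n. factored (supported_on J) n s"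
    and x: "x \<notin> J" and fB: "f \<in> supported_on (insert x J)" and f0: "f \<noteq> 0"
    and pos: "weight.width (coord x) f > 0"
    and np: "\<And>p. prime_in (supported_on J) p \<Longrightarrow> \<not> p dvd f"
    and indec: "\<And>g h. g \<in> supported_on (insert x J) \<Longrightarrow> h \<in> supported_on (insert x J) \<Longrightarrow> f = g * h \<Longrightarrow>
      weight.width (coord x) g = 0 \<or> weight.width (coord x) h = 0"
  shows "prime_in (supported_on (insert x J)) f"
  unfolding prime_in_def
proof (intro conjI ballI impI)
  interpret weight "coord x" by (rule weight_coord)
  let ?B = "supported_on (insert x J) :: ('n, 'k) group_algebra set"
  have JB: "supported_on J \<subseteq> ?B" by (rule supported_on_mono) blast
  show "f \<in> ?B" "f \<noteq> 0" by fact+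
  show "\<not> f dvd 1" using width_unit pos by force
  fix g h assume gh: "g \<in> ?B" "h \<in> ?B" "f dvd g * h"
  define I where "I = {a * f + b * g | a b. a \<in> ?B \<and> b \<in> ?B}"
  have IB: "I \<subseteq> ?B" unfolding I_def using fB gh(1) by (blast intro: supported_on_add supported_on_mult)
  have zero: "0 \<in> ?B" by (simp add: supported_on_def)
  have "1 * f + 0 * g \<in> I" "0 * f + 1 * g \<in> I" unfolding I_def using supported_on_one zero by blast+
  then have fI: "f \<in> I" and gI: "g \<in> I" by simp_all
  define k where "k = (LEAST k. \<exists>a\<in>I. a \<noteq> 0 \<and> width a = k)"
  have "\<exists>k. \<exists>a\<in>I. a \<noteq> 0 \<and> width a = k" using fI f0 by blast
  from LeastI_ex[OF this] obtain d where d: "d \<in> I" "d \<noteq> 0" "width d = k" unfolding k_def by blast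
  have min: "width d \<le> width a" if "a \<in> I" "a \<noteq> 0" for a
    unfolding d(3) k_def using that by (intro Least_le) blast
  have Iadd: "a + b \<in> I" if ab: "a \<in> I" "b \<in> I" for a b
  proof -
    obtain a1 a2 b1 b2 where "a = a1 * f + a2 * g" "b = b1 * f + b2 * g" "a1 \<in> ?B" "a2 \<in> ?B" "b1 \<in> ?B" "b2 \<in> ?B"
      using ab unfolding I_def by blast
    moreover from this have "a + b = (a1 + b1) * f + (a2 + b2) * g" by (simp add: algebra_simps)
    ultimately show ?thesis unfolding I_def using supported_on_add by blast
  qed
  have Imult: "a * b \<in> I" if ab: "a \<in> ?B" "b \<in> I" for a b
  proof -
    obtain b1 b2 where "b = b1 * f + b2 * g" "b1 \<in> ?B" "b2 \<in> ?B" using ab unfolding I_def by blast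
    moreover from this have "a * b = (a * b1) * f + (a * b2) * g" by (simp add: algebra_simps)
    ultimately show ?thesis unfolding I_def using supported_on_mult[OF ab(1)] by blast
  qed
  have div: "\<exists>s n q. factored (supported_on J) n s \<and> q \<in> ?B \<and> s * e = q * d" if "e \<in> I" for e
    by (rule least_width_divides[where I = I]) (fact fac d IB Iadd Imult min that)+
  have dB: "d \<in> ?B" using d(1) IB by blast
  obtain s n q where s: "factored (supported_on J) n s" "q \<in> ?B" "s * f = q * d"
    using div[OF fI] by blast
  have "q \<noteq> 0" using s factored_nonzero[OF s(1)] f0 by auto
  then obtain q' d' c m where split: "f = q' * d'" "d = c * d'" "factored (supported_on J) m c"
    "q' \<in> ?B" "d' \<in> ?B"
    using factored_split[OF s(1) x s(3) _ d(2) s(2) dB] by blast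
  have nz: "q' \<noteq> 0" "d' \<noteq> 0" using split(1) f0 by auto
  \<comment> \<open>The unit is a power of \<open>x\<close>.\<close>
  have width0: "\<exists>u a. u dvd 1 \<and> u \<in> ?B \<and> a \<in> supported_on J \<and> a \<noteq> 0 \<and> e = u * a"
    if e: "e \<in> ?B" "e \<noteq> 0" "width e = 0" for e
  proof -
    have "init (coord x) e = e" unfolding init_def by (rule part_id) (rule width_zero[OF e(3)])
    then have "e = character (Poly_Mapping.single x (low (coord x) e)) * init_coeff x e"
      using init_eq_coeff[of x e] by simp
    moreover have "character (Poly_Mapping.single x (low (coord x) e)) \<in> ?B"
      by (rule supported_on_character) simp
    ultimately show ?thesis
      using character_unit init_coeff_supported[OF e(1)] init_coeff_nonzero[OF e(2)] by blast
  qed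
  \<comment> \<open>The generator \<open>d\<close> is, up to a factor \<open>c\<close> free of \<open>x\<close>, a divisor \<open>d'\<close> of \<open>f\<close>. By indecomposability
    either \<open>d'\<close> is associated with \<open>f\<close>, and then \<open>f\<close> divides \<open>g\<close>, or \<open>d'\<close> is itself free of \<open>x\<close> and
    \<open>d\<close> is a combination of \<open>f\<close> and \<open>g\<close>, and then \<open>f\<close> divides \<open>h\<close>.\<close>
  show "f dvd g \<or> f dvd h"
  proof (cases "width q' = 0")
    case True
    obtain u a where ua: "u dvd 1" "u \<in> ?B" "a \<in> supported_on J" "a \<noteq> 0" "q' = u * a"
      using width0[OF split(4) nz(1) True] by blast
    obtain l where l: "factored (supported_on J) l a" using fac[OF ua(3,4)] by blast
    have "a dvd 1" using l
    proof cases
      case (prime n a' p)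
      have "p dvd f" unfolding split(1) ua(5) prime by simp
      then show ?thesis using np[OF prime(4)] by blast
    qed
    then have "q' dvd 1" unfolding ua(5) using mult_dvd_mono[OF ua(1)] by simp
    then obtain v where v: "1 = q' * v" by (rule dvdE)
    have "d' = (q' * v) * d'" using v by simp
    also have "\<dots> = f * v" using split(1) by (simp add: mult_ac)
    finally have "f dvd d'" by (metis dvdI)
    then have "f dvd d" unfolding split(2) by simp
    obtain s2 n2 q2 where s2: "factored (supported_on J) n2 s2" "s2 * g = q2 * d"
      using div[OF gI] by blast
    have "f dvd s2 * g" unfolding s2(2) using \<open>f dvd d\<close> by simp
    then show ?thesis using dvd_cancel_factored[OF s2(1) x f0 fB gh(1) _ np] by blast
  next
    case False
    then have "width d' = 0" using indec[OF split(4,5,1)] by simp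
    then obtain u a where ua: "u dvd 1" "u \<in> ?B" "a \<in> supported_on J" "a \<noteq> 0" "d' = u * a"
      using width0[OF split(5) nz(2)] by blast
    obtain l where l: "factored (supported_on J) l a" using fac[OF ua(3,4)] by blast
    obtain v where v: "1 = u * v" using ua(1) by (rule dvdE)
    obtain a1 a2 where "d = a1 * f + a2 * g" using d(1) unfolding I_def by blast
    then have "d * h = f * (a1 * h) + a2 * (g * h)" by (simp add: algebra_simps)
    moreover have "f dvd f * (a1 * h) + a2 * (g * h)" using gh(3) by (intro dvd_add) simp_all
    ultimately have "f dvd d * h" by simp
    then have "f dvd v * (d * h)" by (rule dvd_mult)
    also have "v * (d * h) = (u * v) * (c * a * h)" unfolding split(2) ua(5) by (simp only: mult_ac)
    also have "\<dots> = c * a * h" unfolding v[symmetric] by simp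
    finally have "f dvd c * a * h" .
    then show ?thesis
      using dvd_cancel_factored[OF factored_mult[OF split(3) l] x f0 fB gh(2) _ np] by blast
  qed
qed

text \<open>Either \<open>f\<close> is prime, or it is free of \<open>x\<close> up to a unit, or
  it splits into factors of smaller width, or it has a prime factor free of \<open>x\<close>. In the
  last case the width does not drop, but the number of prime factors of the lowest coefficient
  does.\<close>

lemma factored_insert_variable:
  fixes f :: "('n::linorder, 'k::field) group_algebra"
  assumes fac: "\<And>s :: ('n, 'k) group_algebra. s \<in> supported_on J \<Longrightarrow> s \<noteq> 0 \<Longrightarrow> \<exists>n. factored (supported_on J) n s"
    and x: "x \<notin> J"
  shows "f \<in> supported_on (insert x J) \<Longrightarrow> f \<noteq> 0 \<Longrightarrow> \<exists>n. factored (supported_on (insert x J)) n f"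
proof (induction "weight.width (coord x) f" arbitrary: f rule: less_induct)
  case (less f)
  interpret weight "coord x" by (rule weight_coord)
  let ?B = "supported_on (insert x J) :: ('n, 'k) group_algebra set"
  note outer = less(1)
  have main: "\<exists>n. factored ?B n g"
    if "factored (supported_on J) l (init_coeff x g)" "g \<in> ?B" "g \<noteq> 0" "width g = width f" for l g
    using that
  proof (induction l arbitrary: g rule: less_induct)
    case (less l g)
    note g = less(3,4,5)
    consider (content) p where "prime_in (supported_on J) p" "p dvd g"
      | (split) a b where "a \<in> ?B" "b \<in> ?B" "g = a * b" "width a < width g" "width b < width g"
      | (homogeneous) "width g = 0"
      | (prime) "prime_in ?B g"
    proof -
      have pr: "prime_in ?B g" if np: "\<And>p. prime_in (supported_on J) p \<Longrightarrow> \<not> p dvd g"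
        and ns: "\<And>a b. a \<in> ?B \<Longrightarrow> b \<in> ?B \<Longrightarrow> g = a * b \<Longrightarrow> width a < width g \<Longrightarrow> width b < width g \<Longrightarrow> False"
        and pos: "width g \<noteq> 0"
      proof (rule prime_in_of_indecomposable[OF fac x g(1,2) _ np])
        fix a b assume ab: "a \<in> ?B" "b \<in> ?B" "g = a * b"
        then have "a \<noteq> 0" "b \<noteq> 0" using g(2) by auto
        then have "width g = width a + width b" using ab(3) width_mult by blast
        then show "width a = 0 \<or> width b = 0"
          using ns[OF ab] by (cases "width a = 0"; cases "width b = 0") simp_all
      qed (use pos in simp_all)
      show ?thesis
      proof (rule ccontr)
        assume nt: "\<not> thesis"
        have 1: "\<not> p dvd g" if "prime_in (supported_on J) p" for p using content[OF that] nt by blast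
        have 2: False if "a \<in> ?B" "b \<in> ?B" "g = a * b" "width a < width g" "width b < width g" for a b
          using split[OF that] nt by simp
        have 3: "width g \<noteq> 0" using homogeneous nt by metis
        have "prime_in ?B g" by (rule pr) (fact 1 2 3)+
        then show False using prime nt by simp
      qed
    qed
    then show ?case
    proof cases
      case content
      then obtain h where h: "g = p * h" by (elim dvdE)
      note p = prime_in_insert[OF content(1) x]
      have p0: "p \<noteq> 0" "h \<noteq> 0" using h g(2) by auto
      have "h * p \<in> ?B" using g(1) h by (simp add: mult.commute)
      then have hB: "h \<in> ?B" by (rule supported_on_quotient[OF _ prime_inD(1)[OF p] p0])
      have "init_coeff x g = p * init_coeff x h"
        unfolding h init_coeff_mult[OF p0] init_coeff_supported_id[OF prime_inD(1)[OF content(1)] x p0(1)]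
        by (rule refl)
      then obtain k where k: "l = Suc k" "factored (supported_on J) k (init_coeff x h)"
        using factored_cancel_prime[OF less(2) content(1) _ init_coeff_supported[OF hB]] by blast
      have "width p = 0"
      proof -
        have z: "coord x m = 0" if "m \<in> Poly_Mapping.keys p" for m
          using prime_inD(1)[OF content(1)] x that unfolding supported_on_iff_coord by blast
        obtain n where n: "n \<in> Poly_Mapping.keys p" using low_attained[OF p0(1)] by blast
        have "low (coord x) p = 0" "low (\<lambda>m. - coord x m) p = 0"
          by (rule low_eqI[OF _ n]; use z n in simp)+
        then show ?thesis by (simp add: width_def)
      qed
      then have "width h = width f" using width_mult[OF p0] h g(3) by simp
      then obtain n where "factored ?B n h" using less(1)[OF _ k(2) hB p0(2)] k(1) by blast
      then have "factored ?B (Suc n) g" unfolding h by (rule factored.prime[OF _ p])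
      then show ?thesis by blast
    next
      case split
      have "a \<noteq> 0" "b \<noteq> 0" using split(3) g(2) by auto
      then obtain m n where "factored ?B m a" "factored ?B n b"
        using outer[of a] outer[of b] split g(3) by metis
      then show ?thesis using factored_mult split(3) by blast
    next
      case homogeneous
      have "init (coord x) g = g" unfolding init_def by (rule part_id) (rule width_zero[OF homogeneous])
      then have eq: "g = character (Poly_Mapping.single x (low (coord x) g)) * init_coeff x g"
        using init_eq_coeff[of x g] by simp
      have "factored ?B l (character (Poly_Mapping.single x (low (coord x) g)) * init_coeff x g)"
        by (rule factored_mult_unit[OF factored_insert[OF less(2) x] _ character_unit])
          (rule supported_on_character, simp)
      then show ?thesis using eq by metis
    next
      case prime
      then have "factored ?B (Suc 0) (g * 1)" by (rule factored.prime[OF factored_one])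
      then show ?thesis by auto
    qed
  qed
  obtain l where "factored (supported_on J) l (init_coeff x f)"
    using fac[OF init_coeff_supported[OF less(2)] init_coeff_nonzero[OF less(3)]] by blast
  then show ?case using main less(2,3) by blast
qed

lemma factored_supported_on:
  fixes f :: "('n::linorder, 'k::field) group_algebra"
  assumes "finite J" "f \<in> supported_on J" "f \<noteq> 0"
  shows "\<exists>n. factored (supported_on J) n f"
  using assms
proof (induction J arbitrary: f rule: finite_induct)
  case empty
  have key: "m = 0" if "m \<in> Poly_Mapping.keys f" for m
    using empty(1) that unfolding supported_on_def by fastforce
  have "f = Poly_Mapping.single 0 (Poly_Mapping.lookup f 0)"
    by (rule poly_mapping_eqI)
      (metis key lookup_single_eq lookup_single_not_eq not_in_keys_iff_lookup_eq_zero)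
  moreover have "Poly_Mapping.lookup f 0 \<noteq> 0"
    using calculation empty(2) by (metis single_zero)
  ultimately have "f dvd 1" using monomial_unit by metis
  then show ?case using factored.unit[OF empty(1)] by blast
next
  case (insert x J)
  then show ?case using factored_insert_variable[of J x f] by blast
qed

text \<open>The group algebra arises from the field by adjoining all variables.\<close>

theorem group_algebra_factorial_induct [consumes 1, case_names unit prime]:
  fixes f :: "('n::{finite,linorder}, 'k::field) group_algebra"
  assumes "f \<noteq> 0"
    and unit: "\<And>u. u dvd 1 \<Longrightarrow> P u"
    and prime: "\<And>p f. prime_elem p \<Longrightarrow> f \<noteq> 0 \<Longrightarrow> P f \<Longrightarrow> P (p * f)"
  shows "P f"
proof -
  have U: "g \<in> supported_on UNIV" for g :: "('n, 'k) group_algebra" by (simp add: supported_on_def)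
  obtain n where "factored (supported_on UNIV) n f"
    using factored_supported_on[OF finite U assms(1)] by blast
  then show ?thesis
  proof (induction rule: factored.induct)
    case (unit u)
    then show ?case using assms(2) by blast
  next
    case (prime n f p)
    have "prime_elem p"
      unfolding prime_elem_def using prime_inD[OF prime(2)] U by blast
    then show ?case using assms(3)[OF _ factored_nonzero[OF prime(1)] prime(3)] by blast
  qed
qed

section \<open>Valuations of the function field of the torus\<close>

definition padic :: "('n::{finite,linorder}, 'k::field) group_algebra \<Rightarrow> ('n, 'k) group_algebra \<Rightarrow> int" where
  "padic p f = (THE n. \<exists>k g. n = int k \<and> f = p ^ k * g \<and> \<not> p dvd g)"

lemma prime_elem_factor:
  fixes q :: "'a::idom"
  assumes "prime_elem q" "q = p * c" shows "p dvd 1 \<or> c dvd 1"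
proof -
  have q0: "q \<noteq> 0" using assms(1) by (simp add: prime_elem_def)
  have "q dvd p * c" using assms(2) by simp
  then consider "q dvd p" | "q dvd c" using prime_elem_dvd_mult_iff[OF assms(1)] by blast
  then show ?thesis
  proof cases
    case 1
    then obtain v where "p = q * v" by (rule dvdE)
    then have "q * 1 = q * (c * v)" using assms(2) by (metis mult.left_commute mult.commute mult_1_right)
    then have "1 = c * v" using q0 by (metis mult_cancel_left)
    then show ?thesis by (metis dvdI)
  next
    case 2
    then obtain v where "c = q * v" by (rule dvdE)
    then have "q * 1 = q * (p * v)" using assms(2) by (metis mult.left_commute mult_1_right)
    then have "1 = p * v" using q0 by (metis mult_cancel_left)
    then show ?thesis by (metis dvdI)
  qed
qed

context
  fixes p :: "('n::{finite,linorder}, 'k::field) group_algebra"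
  assumes p: "prime_elem p"
begin

lemma prime_nonzero: "p \<noteq> 0" and prime_nonunit: "\<not> p dvd 1"
  using p unfolding prime_elem_def by blast+

lemma prime_dvd_unit: "u dvd 1 \<Longrightarrow> \<not> p dvd u"
  using prime_nonunit dvd_trans by blast

lemma padic_exists: "f \<noteq> 0 \<Longrightarrow> \<exists>k g. f = p ^ k * g \<and> \<not> p dvd g"
proof (induction rule: group_algebra_factorial_induct)
  case (unit u)
  then have "u = p ^ 0 * u" "\<not> p dvd u" using prime_dvd_unit by simp_all
  then show ?case by blast
next
  case (prime q f)
  then obtain k g where kg: "f = p ^ k * g" "\<not> p dvd g" by blast
  show ?case
  proof (cases "p dvd q")
    case True
    then obtain c where c: "q = p * c" by (rule dvdE)
    have "c dvd 1" using prime_elem_factor[OF prime(1) c] prime_nonunit by blast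
    then have "\<not> p dvd c * g" using prime_dvd_unit prime_elem_dvd_mult_iff[OF p] kg(2) by blast
    moreover have "q * f = p ^ Suc k * (c * g)" unfolding c kg(1) by (simp add: mult_ac)
    ultimately show ?thesis by blast
  next
    case False
    then have "\<not> p dvd q * g" using prime_elem_dvd_mult_iff[OF p] kg(2) by blast
    moreover have "q * f = p ^ k * (q * g)" unfolding kg(1) by (simp add: mult_ac)
    ultimately show ?thesis by blast
  qed
qed

lemma padic_power_dvd:
  assumes "\<not> p dvd g" shows "p ^ l dvd p ^ k * g \<longleftrightarrow> l \<le> k"
proof
  assume "p ^ l dvd p ^ k * g"
  then obtain h where h: "p ^ k * g = p ^ l * h" by (rule dvdE)
  show "l \<le> k"
  proof (rule ccontr)
    assume "\<not> l \<le> k"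
    then obtain d where d: "l = k + Suc d" by (metis less_imp_Suc_add not_le add_Suc_right)
    have "p ^ k * g = p ^ k * (p * (p ^ d * h))" unfolding h d by (simp add: power_add mult_ac)
    then have "g = p * (p ^ d * h)" using prime_nonzero by (metis mult_cancel_left power_not_zero)
    then show False using assms by (metis dvdI)
  qed
qed (simp add: le_imp_power_dvd)

lemma padic_eq:
  assumes "\<not> p dvd g" shows "padic p (p ^ k * g) = int k"
  unfolding padic_def
proof (rule the_equality)
  show "\<exists>l h. int k = int l \<and> p ^ k * g = p ^ l * h \<and> \<not> p dvd h" using assms by blast
  fix n assume "\<exists>l h. n = int l \<and> p ^ k * g = p ^ l * h \<and> \<not> p dvd h"
  then obtain l h where l: "n = int l" "p ^ k * g = p ^ l * h" "\<not> p dvd h" by blast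
  have "k \<le> l" using padic_power_dvd[OF l(3), of k l] unfolding l(2)[symmetric] by simp
  moreover have "l \<le> k" using padic_power_dvd[OF assms, of l k] unfolding l(2) by simp
  ultimately show "n = int k" using l(1) by simp
qed

lemma padic_cases:
  assumes "f \<noteq> 0" obtains k g where "f = p ^ k * g" "\<not> p dvd g" "padic p f = int k"
  using padic_exists[OF assms] padic_eq by metis

lemma padic_ge_iff: "f \<noteq> 0 \<Longrightarrow> int k \<le> padic p f \<longleftrightarrow> p ^ k dvd f"
  by (rule padic_cases[of f]) (use padic_power_dvd in simp_all)

lemma padic_nonneg: "f \<noteq> 0 \<Longrightarrow> 0 \<le> padic p f"
  using padic_ge_iff[of f 0] by simp

lemma padic_pos_iff: "f \<noteq> 0 \<Longrightarrow> 0 < padic p f \<longleftrightarrow> p dvd f"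
  using padic_ge_iff[of f 1] int_one_le_iff_zero_less[of "padic p f"] by simp

lemma integer_valuation_padic: "integer_valuation (padic p)"
proof
  fix f g :: "('n, 'k) group_algebra" assume nz: "f \<noteq> 0" "g \<noteq> 0"
  obtain k a where a: "f = p ^ k * a" "\<not> p dvd a" "padic p f = int k" by (rule padic_cases[OF nz(1)])
  obtain l b where b: "g = p ^ l * b" "\<not> p dvd b" "padic p g = int l" by (rule padic_cases[OF nz(2)])
  have "f * g = p ^ (k + l) * (a * b)" unfolding a(1) b(1) by (simp add: power_add mult_ac)
  moreover have "\<not> p dvd a * b" using a(2) b(2) prime_elem_dvd_mult_iff[OF p] by blast
  ultimately show "padic p (f * g) = padic p f + padic p g" using a(3) b(3) padic_eq by simp
  assume s: "f + g \<noteq> 0"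
  have "p ^ (min k l) dvd f" "p ^ (min k l) dvd g"
    using padic_ge_iff[OF nz(1), of "min k l"] padic_ge_iff[OF nz(2), of "min k l"] a(3) b(3) by simp_all
  then have "p ^ (min k l) dvd f + g" by (rule dvd_add)
  then have "int (min k l) \<le> padic p (f + g)" using padic_ge_iff[OF s] by simp
  then show "min (padic p f) (padic p g) \<le> padic p (f + g)" using a(3) b(3) by simp
qed

lemma padic_unit: "u dvd 1 \<Longrightarrow> padic p u = 0"
  using padic_eq[of u 0] prime_dvd_unit[of u] by simp

lemma padic_self: "padic p p = 1"
  using padic_eq[of 1 1] prime_nonunit by simp

lemma padic_associated:
  assumes q: "prime_elem q" "p dvd q" shows "padic p q = 1"
proof -
  interpret integer_valuation "padic p" by (rule integer_valuation_padic)
  obtain c where c: "q = p * c" using q(2) by (rule dvdE)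
  have "c dvd 1" using prime_elem_factor[OF q(1) c] prime_nonunit by blast
  moreover from this have "c \<noteq> 0" by auto
  ultimately show ?thesis using mult[OF prime_nonzero \<open>c \<noteq> 0\<close>] padic_unit padic_self c by simp
qed

lemma padic_not_dvd: "f \<noteq> 0 \<Longrightarrow> \<not> p dvd f \<Longrightarrow> padic p f = 0"
  using padic_pos_iff[of f] padic_nonneg[of f] by simp

end

lemma prime_elem_dvd_sym:
  fixes p q :: "('n::{finite,linorder}, 'k::field) group_algebra"
  assumes "prime_elem p" "prime_elem q" "p dvd q" shows "q dvd p"
proof -
  obtain c where c: "q = p * c" using assms(3) by (rule dvdE)
  have "c dvd 1" using prime_elem_factor[OF assms(2) c] prime_nonunit[OF assms(1)] by blast
  then obtain v where v: "1 = c * v" by (rule dvdE)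
  have "q * v = p * (c * v)" unfolding c by (rule mult.assoc)
  then have "p = q * v" unfolding v[symmetric] by simp
  then show ?thesis by (rule dvdI)
qed

lemma padic_eq_of_dvd:
  fixes p q :: "('n::{finite,linorder}, 'k::field) group_algebra"
  assumes "prime_elem p" "prime_elem q" "p dvd q" "f \<noteq> 0" shows "padic p f = padic q f"
proof -
  have le: "padic a f \<le> padic b f" if ab: "prime_elem a" "prime_elem b" "b dvd a" for a b
  proof -
    obtain k g where k: "f = a ^ k * g" "padic a f = int k" using padic_cases[OF ab(1) assms(4)] by metis
    have "b ^ k dvd a ^ k" using ab(3) by (rule dvd_power_same)
    then have "b ^ k dvd f" unfolding k(1) by simp
    then show ?thesis using padic_ge_iff[OF ab(2) assms(4), of k] k(2) by simp
  qed
  show ?thesis using le[of p q] le[of q p] assms(1-3) prime_elem_dvd_sym[OF assms(1-3)] by simp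
qed

lemma dvd_of_padic_le:
  fixes a b :: "('n::{finite,linorder}, 'k::field) group_algebra"
  assumes "b \<noteq> 0" "a \<noteq> 0" "\<And>p. prime_elem p \<Longrightarrow> padic p b \<le> padic p a"
  shows "b dvd a"
  using assms
proof (induction arbitrary: a rule: group_algebra_factorial_induct)
  case (unit u)
  then show ?case using dvd_trans[OF unit(1) one_dvd] by blast
next
  case (prime p b)
  have p0: "p \<noteq> 0" by (rule prime_nonzero[OF prime(1)])
  have val: "padic q (p * c) = padic q p + padic q c" if "prime_elem q" "c \<noteq> 0" for q c
    by (rule integer_valuation.mult[OF integer_valuation_padic[OF that(1)] p0 that(2)])
  have "1 \<le> padic p (p * b)" using val[OF prime(1,2)] padic_self[OF prime(1)] padic_nonneg[OF prime(1,2)] by simp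
  then have "0 < padic p a" using prime(5)[OF prime(1)] by simp
  then have "p dvd a" using padic_pos_iff[OF prime(1) prime(4)] by simp
  then obtain c where c: "a = p * c" by (rule dvdE)
  have c0: "c \<noteq> 0" using c prime(4) by auto
  have "padic q b \<le> padic q c" if q: "prime_elem q" for q
    using prime(5)[OF q] val[OF q prime(2)] val[OF q c0] c by simp
  then have "b dvd c" by (rule prime(3)[OF c0])
  then show ?case unfolding c by (rule mult_dvd_mono[OF dvd_refl])
qed

lemma padic_bounded:
  fixes f :: "('n::{finite,linorder}, 'k::field) group_algebra"
  assumes "f \<noteq> 0" shows "\<exists>N. \<forall>p. prime_elem p \<longrightarrow> padic p f \<le> int N"
  using assms
proof (induction rule: group_algebra_factorial_induct)
  case (unit u)
  then have "padic p u \<le> int 0" if "prime_elem p" for p using padic_unit[OF that unit] by simp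
  then show ?case by blast
next
  case (prime q f)
  then obtain N where N: "\<And>p. prime_elem p \<Longrightarrow> padic p f \<le> int N" by blast
  have q0: "q \<noteq> 0" by (rule prime_nonzero[OF prime(1)])
  have "padic p (q * f) \<le> int (Suc N)" if p: "prime_elem p" for p
    using integer_valuation.mult[OF integer_valuation_padic[OF p] q0 prime(2)] N[OF p]
      padic_associated[OF p prime(1)] padic_not_dvd[OF p q0] by (cases "p dvd q") simp_all
  then show ?case by blast
qed

abbreviation torus_val :: "('n::{finite,linorder}, 'k::field) group_algebra \<Rightarrow> ('n, 'k) toric_field \<Rightarrow> int" where
  "torus_val p \<equiv> fract_val (padic p)"

lemma discrete_valuation_torus_val: "prime_elem p \<Longrightarrow> discrete_valuation (torus_val p)"
proof -
  assume p: "prime_elem p"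
  interpret P: integer_valuation "padic p" by (rule integer_valuation_padic[OF p])
  interpret field_valuation "torus_val p" by (rule P.field_valuation_fract_val)
  have "Fract p 1 \<noteq> 0" using prime_nonzero[OF p] by (simp add: Fract_eq_zero_iff)
  moreover have "torus_val p (Fract p 1) = 1"
    using P.fract_val_Fract[OF prime_nonzero[OF p], of 1] padic_self[OF p] by simp
  ultimately show ?thesis by unfold_locales blast
qed

lemma val_ring_torus_eq:
  fixes p q :: "('n::{finite,linorder}, 'k::field) group_algebra"
  assumes "prime_elem p" "prime_elem q" "p dvd q"
  shows "val_ring (torus_val p) = val_ring (torus_val q)"
proof -
  have eq: "torus_val p z = torus_val q z" if z: "z \<noteq> 0" for z
  proof -
    obtain a b where ab: "a \<noteq> 0" "b \<noteq> 0" "z = Fract a b" using z by (rule nonzero_fract_cases)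
    then show ?thesis
      using padic_eq_of_dvd[OF assms ab(1)] padic_eq_of_dvd[OF assms ab(2)]
        integer_valuation.fract_val_Fract[OF integer_valuation_padic[OF assms(1)] ab(1,2)]
        integer_valuation.fract_val_Fract[OF integer_valuation_padic[OF assms(2)] ab(1,2)] by simp
  qed
  show ?thesis unfolding val_ring_def
  proof (rule Collect_cong)
    fix z show "(z = 0 \<or> 0 \<le> torus_val p z) = (z = 0 \<or> 0 \<le> torus_val q z)"
      using eq[of z] by (cases "z = 0") simp_all
  qed
qed

lemma finite_prime_val_rings:
  fixes f :: "('n::{finite,linorder}, 'k::field) group_algebra"
  assumes "f \<noteq> 0" shows "finite ((\<lambda>p. val_ring (torus_val p)) ` {p. prime_elem p \<and> p dvd f})"
  using assms
proof (induction rule: group_algebra_factorial_induct)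
  case (unit u)
  have empty: "{p. prime_elem p \<and> p dvd u} = {}"
    unfolding Collect_empty_eq using prime_dvd_unit[OF _ unit] by simp
  show ?case unfolding empty by simp
next
  case (prime q f)
  have "(\<lambda>p. val_ring (torus_val p)) ` {p. prime_elem p \<and> p dvd q * f} \<subseteq>
    insert (val_ring (torus_val q)) ((\<lambda>p. val_ring (torus_val p)) ` {p. prime_elem p \<and> p dvd f})"
  proof
    fix R assume "R \<in> (\<lambda>p. val_ring (torus_val p)) ` {p. prime_elem p \<and> p dvd q * f}"
    then obtain p where p: "prime_elem p" "p dvd q * f" "R = val_ring (torus_val p)" by blast
    then consider "p dvd q" | "p dvd f" using prime_elem_dvd_mult_iff[OF p(1)] by blast
    then show "R \<in> insert (val_ring (torus_val q)) ((\<lambda>p. val_ring (torus_val p)) ` {p. prime_elem p \<and> p dvd f})"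
    proof cases
      case 1
      have "R = val_ring (torus_val q)" unfolding p(3) by (rule val_ring_torus_eq[OF p(1) prime(1) 1])
      then show ?thesis by (simp only: insert_iff simp_thms)
    next
      case 2
      show ?thesis unfolding p(3) by (rule insertI2, rule imageI) (simp add: p(1) 2)
    qed
  qed
  then show ?case by (rule finite_subset) (simp add: prime(3))
qed

lemma torus_val_Fract:
  "prime_elem p \<Longrightarrow> a \<noteq> 0 \<Longrightarrow> b \<noteq> 0 \<Longrightarrow> torus_val p (Fract a b) = padic p a - padic p b"
  by (rule integer_valuation.fract_val_Fract[OF integer_valuation_padic])

text \<open>A numerator and denominator with the same orders at all primes divide each other, so
  that their quotient is a unit of the group algebra.\<close>

lemma torus_unit_is_monomial:
  fixes z :: "('n::{finite,linorder}, 'k::field) toric_field"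
  assumes "z \<noteq> 0" and "\<And>p. prime_elem p \<Longrightarrow> torus_val p z = 0"
  shows "\<exists>m c. c \<noteq> 0 \<and> z = Fract (Poly_Mapping.single m c) 1"
proof -
  obtain a b where ab: "a \<noteq> 0" "b \<noteq> 0" "z = Fract a b" using assms(1) by (rule nonzero_fract_cases)
  have eq: "padic p a = padic p b" if "prime_elem p" for p
    using assms(2)[OF that] torus_val_Fract[OF that ab(1,2)] ab(3) by simp
  have "b dvd a" by (rule dvd_of_padic_le[OF ab(2,1)]) (simp add: eq)
  then obtain u where u: "a = b * u" by (rule dvdE)
  have "a dvd b" by (rule dvd_of_padic_le[OF ab(1,2)]) (simp add: eq)
  then obtain v where v: "b = a * v" by (rule dvdE)
  have "b = b * u * v" unfolding u[symmetric] by (rule v)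
  then have "b * (u * v) = b" by (subst mult.assoc[symmetric]) (rule sym)
  then have "u * v = 1" using ab(2) by (simp only: mult_cancel_left2) simp
  then have "u dvd 1" by (intro dvdI[of _ _ v]) (rule sym)
  from unit_is_monomial[OF this] obtain m c where mc: "c \<noteq> 0" "u = Poly_Mapping.single m c"
    by (elim exE conjE)
  have "z = Fract u 1" unfolding ab(3) u by (subst eq_fract) (simp_all add: ab(2))
  then show ?thesis unfolding mc(2) using mc(1) by (intro exI conjI)
qed

definition wt :: "int ^ 'n::{finite,linorder} \<Rightarrow> ('n::{finite,linorder} \<Rightarrow>\<^sub>0 int) \<Rightarrow> int" where
  "wt v m = (\<Sum>i\<in>UNIV. Poly_Mapping.lookup m i * v $ i)"

lemma wt_add: "wt v (a + b) = wt v a + wt v b"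
  by (simp add: wt_def lookup_add distrib_right sum.distrib)

lemma weight_wt: "weight (wt v)"
  by unfold_locales (rule wt_add)

lemma wt_minus: "wt v (- a) = - wt v a"
  by (rule weight.minus[OF weight_wt])

lemma wt_zero [simp]: "wt v 0 = 0"
  by (rule weight.zero[OF weight_wt])

lemma wt_cmul: "wt v (frag_cmul c m) = c * wt v m"
  by (simp add: wt_def sum_distrib_left mult.assoc)

lemma wt_sum: "wt v (\<Sum>i\<in>I. m i) = (\<Sum>i\<in>I. wt v (m i))"
  by (induction I rule: infinite_finite_induct) (simp_all add: wt_add)

lemma wt_single: fixes v :: "int ^ 'n::{finite,linorder}" shows "wt v (Poly_Mapping.single i c) = c * v $ i"
proof -
  have "wt v (Poly_Mapping.single i c) = (\<Sum>j\<in>UNIV. if j = i then c * v $ i else 0)"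
    unfolding wt_def by (intro sum.cong refl) (simp add: lookup_single when_def)
  then show ?thesis by simp
qed

abbreviation ray_val :: "int ^ 'n::{finite,linorder} \<Rightarrow> ('n::{finite,linorder}, 'k::field) toric_field \<Rightarrow> int" where
  "ray_val v \<equiv> fract_val (low (wt v))"

lemma integer_valuation_ray: "integer_valuation (low (wt v) :: ('n::{finite,linorder}, 'k::field) group_algebra \<Rightarrow> int)"
  by (rule weight.integer_valuation_low[OF weight_wt])

lemma field_valuation_ray_val: "field_valuation (ray_val v :: ('n::{finite,linorder}, 'k::field) toric_field \<Rightarrow> int)"
  by (rule integer_valuation.field_valuation_fract_val[OF integer_valuation_ray])

lemma ray_val_Fract:
  "a \<noteq> 0 \<Longrightarrow> b \<noteq> 0 \<Longrightarrow> ray_val v (Fract a b) = low (wt v) a - low (wt v) b"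
  by (rule integer_valuation.fract_val_Fract[OF integer_valuation_ray])

abbreviation chr :: "('n::{finite,linorder} \<Rightarrow>\<^sub>0 int) \<Rightarrow> ('n::{finite,linorder}, 'k::field) toric_field" where
  "chr m \<equiv> Fract (character m) 1"

lemma chr_nonzero [simp]: "chr m \<noteq> 0"
  by (simp add: Fract_eq_zero_iff)

lemma ray_val_chr: "ray_val v (chr m :: ('n::{finite,linorder}, 'k::field) toric_field) = wt v m"
proof -
  have "low (wt v) (1 :: ('n, 'k) group_algebra) = 0"
    by (rule integer_valuation.one[OF integer_valuation_ray])
  moreover have "low (wt v) (character m :: ('n, 'k) group_algebra) = wt v m"
    by (rule weight.low_character[OF weight_wt])
  ultimately show ?thesis using ray_val_Fract[of "character m" "1 :: ('n, 'k) group_algebra" v] by simp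
qed

lemma padic_character: "prime_elem p \<Longrightarrow> padic p (character m) = 0"
  by (rule padic_unit[OF _ character_unit])

lemma torus_val_chr: "prime_elem p \<Longrightarrow> torus_val p (chr m) = 0"
  using torus_val_Fract[of p "character m" 1] padic_character[of p m] padic_unit[of p 1] by simp

section \<open>Rational cones\<close>

lemma real_vec_nth [simp]: "real_vec v $ i = real_of_int (v $ i)"
  by (simp add: real_vec_def)

lemma real_vec_add: "real_vec (v + w) = real_vec v + real_vec w"
  by (simp add: vec_eq_iff)

lemma real_vec_scale: "real_vec (c *s v) = of_int c *\<^sub>R real_vec v"
  by (simp add: vec_eq_iff)

lemma real_vec_uminus: "real_vec (- v) = - real_vec v"
  by (simp add: vec_eq_iff)

lemma real_vec_zero [simp]: "real_vec 0 = 0"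
  by (simp add: vec_eq_iff)

lemma real_vec_inject: "real_vec v = real_vec w \<longleftrightarrow> v = w"
  by (simp add: vec_eq_iff)

lemma pairing_real_vec: "pairing m (real_vec v) = real_of_int (wt v m)"
  by (simp add: pairing_def wt_def)

lemma wt_linear:
  fixes v w :: "int ^ 'n::{finite,linorder}"
  shows "wt (c *s v + d *s w) m = c * wt v m + d * wt w m"
  unfolding wt_def by (simp add: algebra_simps sum.distrib sum_distrib_left)

lemma pairing_inner: "pairing m x = (\<chi> i. real_of_int (Poly_Mapping.lookup m i)) \<bullet> x"
  by (simp add: pairing_def inner_vec_def)

lemma pairing_nonneg_hull:
  assumes "\<And>s. s \<in> S \<Longrightarrow> 0 \<le> pairing m s" "x \<in> convex_cone hull S"
  shows "0 \<le> pairing m x"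
proof -
  have "convex_cone hull S \<subseteq> {x. 0 \<le> (\<chi> i. real_of_int (Poly_Mapping.lookup m i)) \<bullet> x}"
    by (rule hull_minimal) (use assms(1) in \<open>auto simp: pairing_inner convex_cone_halfspace_ge\<close>)
  then have "x \<in> {x. 0 \<le> (\<chi> i. real_of_int (Poly_Mapping.lookup m i)) \<bullet> x}" using assms(2) by blast
  then show ?thesis by (simp add: pairing_inner)
qed

lemma dual_monoid_hull:
  "m \<in> dual_monoid (convex_cone hull (real_vec ` S)) \<longleftrightarrow> (\<forall>v\<in>S. 0 \<le> wt v m)"
proof
  assume m: "m \<in> dual_monoid (convex_cone hull (real_vec ` S))"
  show "\<forall>v\<in>S. 0 \<le> wt v m"
  proof
    fix v assume "v \<in> S"
    then have "real_vec v \<in> convex_cone hull (real_vec ` S)" by (intro hull_inc) blast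
    then have "0 \<le> pairing m (real_vec v)" using m unfolding dual_monoid_def by blast
    then show "0 \<le> wt v m" by (simp add: pairing_real_vec)
  qed
next
  assume "\<forall>v\<in>S. 0 \<le> wt v m"
  then have "0 \<le> pairing m s" if "s \<in> real_vec ` S" for s using that by (auto simp: pairing_real_vec)
  then show "m \<in> dual_monoid (convex_cone hull (real_vec ` S))"
    using pairing_nonneg_hull unfolding dual_monoid_def by blast
qed

text \<open>Farkas' lemma with an integral separating functional, by induction on the number of
  generators: if the functional \<open>m\<close> found for fewer generators is negative on \<open>a\<close>, all vectors
  are projected along \<open>a\<close> to the kernel of \<open>m\<close>.\<close>

lemma farkas_card:
  fixes w :: "int ^ 'n::{finite,linorder}"
  assumes "finite S" "card S \<le> n"
  shows "real_vec w \<in> convex_cone hull (real_vec ` S) \<or> (\<exists>m. (\<forall>v\<in>S. 0 \<le> wt v m) \<and> wt w m < 0)"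
  using assms
proof (induction n arbitrary: S w)
  case 0
  then have S: "S = {}" by simp
  show ?case
  proof (cases "w = 0")
    case False
    then obtain i where i: "w $ i \<noteq> 0" by (auto simp: vec_eq_iff)
    have "wt w (Poly_Mapping.single i (- (w $ i))) < 0"
      using i by (simp add: wt_single zero_less_mult_iff linorder_neq_iff disj_commute)
    then show ?thesis using S by blast
  qed (simp add: S)
next
  case (Suc n)
  show ?case
  proof (cases "S = {}")
    case True
    then show ?thesis using Suc.IH[of S w] by simp
  next
    case False
    then obtain a where a: "a \<in> S" by blast
    define S' where "S' = S - {a}"
    have S': "finite S'" "card S' \<le> n" "S = insert a S'"
      unfolding S'_def using Suc.prems a by (auto simp: card_Diff_singleton)
    let ?C = "convex_cone hull (real_vec ` S)"
    have sub: "convex_cone hull (real_vec ` S') \<subseteq> ?C" by (rule hull_mono) (use S'(3) in blast)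
    have aC: "real_vec a \<in> ?C" by (rule hull_inc) (use a in blast)
    consider (in_cone) "real_vec w \<in> convex_cone hull (real_vec ` S')"
      | (sep) m where "\<forall>v\<in>S'. 0 \<le> wt v m" "wt w m < 0"
      using Suc.IH[OF S'(1,2)] by blast
    then show ?thesis
    proof cases
      case in_cone
      then show ?thesis using sub by blast
    next
      case sep
      show ?thesis
      proof (cases "0 \<le> wt a m")
        case True
        then show ?thesis using sep S'(3) by blast
      next
        case False
        define pr where "pr v = (- wt a m) *s v + (wt v m) *s a" for v
        have prC: "real_vec v \<in> ?C" if v: "real_vec (pr v) \<in> ?C" "wt v m \<le> 0" for v
        proof -
          have "real_vec (pr v) + of_int (- wt v m) *\<^sub>R real_vec a \<in> ?C"
            using v aC by (intro convex_cone_hull_add convex_cone_hull_mul) simp_all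
          also have "real_vec (pr v) + of_int (- wt v m) *\<^sub>R real_vec a = of_int (- wt a m) *\<^sub>R real_vec v"
            unfolding pr_def real_vec_add real_vec_scale by simp
          finally have inC: "of_int (- wt a m) *\<^sub>R real_vec v \<in> ?C" .
          define r where "r = real_of_int (- wt a m)"
          have r: "0 < r" unfolding r_def using False by simp
          have "inverse r *\<^sub>R (r *\<^sub>R real_vec v) \<in> ?C"
            by (rule convex_cone_hull_mul) (use inC r in \<open>simp_all add: r_def\<close>)
          then show ?thesis using r by simp
        qed
        have prS: "real_vec (pr v) \<in> ?C" if "v \<in> S'" for v
        proof -
          have "real_vec v \<in> ?C" by (rule hull_inc) (use that S'(3) in blast)
          then show ?thesis unfolding pr_def real_vec_add real_vec_scale
            using aC sep(1) that False by (intro convex_cone_hull_add convex_cone_hull_mul) simp_all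
        qed
        have "card (pr ` S') \<le> n" using card_image_le[OF S'(1), of pr] S'(2) by simp
        then consider (c) "real_vec (pr w) \<in> convex_cone hull (real_vec ` pr ` S')"
          | (s) m' where "\<forall>v\<in>pr ` S'. 0 \<le> wt v m'" "wt (pr w) m' < 0"
          using Suc.IH[of "pr ` S'" "pr w"] S'(1) by blast
        then show ?thesis
        proof cases
          case c
          have "convex_cone hull (real_vec ` pr ` S') \<subseteq> ?C"
            by (rule hull_minimal) (use prS convex_cone_convex_cone_hull in \<open>blast+\<close>)
          then show ?thesis using c prC sep(2) by force
        next
          case s
          define m'' where "m'' = frag_cmul (- wt a m) m' + frag_cmul (wt a m') m"
          have "wt v m'' = wt (pr v) m'" for v
          proof -
            have "wt (pr v) m' = (- wt a m) * wt v m' + wt v m * wt a m'"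
              unfolding pr_def by (rule wt_linear)
            then show ?thesis unfolding m''_def wt_add wt_cmul by simp
          qed
          moreover have "wt a m'' = 0" unfolding m''_def wt_add wt_cmul by simp
          ultimately show ?thesis using s S'(3) by (intro disjI2 exI[of _ m'']) auto
        qed
      qed
    qed
  qed
qed

lemma farkas:
  fixes w :: "int ^ 'n::{finite,linorder}"
  assumes "finite S" "real_vec w \<notin> convex_cone hull (real_vec ` S)"
  shows "\<exists>m. (\<forall>v\<in>S. 0 \<le> wt v m) \<and> wt w m < 0"
  using farkas_card[OF assms(1) order_refl, of w] assms(2) by simp

lemma ray_hull: "convex_cone hull {x} = {c *\<^sub>R x | c. 0 \<le> c}"
  by (subst convex_cone_hull_convex_hull_nonempty) auto

text \<open>The least positive value of a functional at \<open>v\<close> divides all coordinates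
  of \<open>v\<close>, as otherwise division with remainder would give a smaller one.\<close>

lemma primitive_functional:
  fixes v :: "int ^ 'n::{finite,linorder}"
  assumes "Gcd (range (vec_nth v)) = 1"
  obtains m where "wt v m = 1"
proof -
  define P where "P d \<longleftrightarrow> 0 < d \<and> (\<exists>m. wt v m = int d)" for d
  obtain i where i: "v $ i \<noteq> 0"
  proof -
    have "\<exists>i. v $ i \<noteq> 0"
    proof (rule ccontr)
      assume "\<nexists>i. v $ i \<noteq> 0"
      then have "range (vec_nth v) \<subseteq> {0}" by auto
      then show False using assms by (metis Gcd_0_iff zero_neq_one)
    qed
    then show ?thesis using that by blast
  qed
  have "wt v (Poly_Mapping.single i (sgn (v $ i))) = int (nat \<bar>v $ i\<bar>)"
    unfolding wt_single by (metis abs_sgn mult.commute abs_ge_zero int_nat_eq)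
  then have "P (nat \<bar>v $ i\<bar>)" unfolding P_def using i by auto
  then have "P (LEAST d. P d)" by (rule LeastI)
  then obtain d m where d: "d = (LEAST d. P d)" "0 < d" "wt v m = int d" unfolding P_def by blast
  have "int d dvd v $ j" for j
  proof -
    let ?r = "v $ j mod int d"
    have "wt v (Poly_Mapping.single j 1 - frag_cmul (v $ j div int d) m) = ?r"
      unfolding diff_conv_add_uminus wt_add wt_minus wt_cmul d(3) wt_single
      by (simp add: minus_div_mult_eq_mod)
    moreover have "0 \<le> ?r" "?r < int d" using d(2) by simp_all
    ultimately have "0 < ?r \<Longrightarrow> P (nat ?r)" unfolding P_def by auto
    moreover have "\<not> P (nat ?r)"
      using not_less_Least[of "nat ?r" P] \<open>?r < int d\<close> \<open>0 \<le> ?r\<close> d(1) by (simp add: nat_less_iff)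
    ultimately have "?r = 0" using \<open>0 \<le> ?r\<close> by linarith
    then show ?thesis by (simp add: mod_eq_0_iff_dvd)
  qed
  then have "int d dvd Gcd (range (vec_nth v))" by (intro Gcd_greatest) auto
  then have "d = 1" using assms by simp
  then show ?thesis using that d(3) by simp
qed

lemma primitive_unique:
  fixes v w :: "int ^ 'n::{finite,linorder}"
  assumes v: "Gcd (range (vec_nth v)) = 1" and w: "Gcd (range (vec_nth w)) = 1"
    and vw: "real_vec w \<in> convex_cone hull {real_vec v}"
  shows "w = v"
proof -
  obtain c where c: "real_vec w = c *\<^sub>R real_vec v" "0 \<le> c" using vw unfolding ray_hull by blast
  obtain m where m: "wt v m = 1" by (rule primitive_functional[OF v])
  have coord: "real_of_int (w $ i) = c * real_of_int (v $ i)" for i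
    using arg_cong[OF c(1), of "\<lambda>x. x $ i"] by simp
  have "real_of_int (wt w m) = c * real_of_int (wt v m)"
    unfolding wt_def by (simp add: coord sum_distrib_left mult.left_commute)
  then have cint: "c = real_of_int (wt w m)" using m by simp
  have eq: "w $ i = wt w m * v $ i" for i
    using coord[of i] unfolding cint by (simp only: of_int_mult[symmetric] of_int_eq_iff)
  then have "wt w m dvd Gcd (range (vec_nth w))" by (intro Gcd_greatest) auto
  then have "wt w m dvd 1" using w by simp
  moreover have "0 \<le> wt w m" using c(2) cint by simp
  ultimately have "wt w m = 1" by (simp add: zdvd1_eq)
  then show ?thesis using eq by (simp add: vec_eq_iff)
qed

lemma face_of_cone_summand:
  assumes F: "F face_of C" "convex_cone F" and xy: "x \<in> C" "y \<in> C" "x + y \<in> F"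
  shows "x \<in> F"
proof (cases "x = y")
  case True
  have "(1/2) *\<^sub>R (x + y) \<in> F" using F(2) xy(3) by (intro convex_cone_scaleR) simp_all
  moreover have "(1/2) *\<^sub>R (x + y) = x" using True by (simp add: scaleR_2[symmetric])
  ultimately show ?thesis by simp
next
  case False
  have "(1/2) *\<^sub>R (x + y) \<in> F" using F(2) xy(3) by (intro convex_cone_scaleR) simp_all
  then have "midpoint x y \<in> F" by (simp add: midpoint_def)
  moreover have "midpoint x y \<in> open_segment x y" using False by simp
  ultimately show ?thesis using F(1) xy(1,2) unfolding face_of_def by blast
qed

text \<open>If a convex combination of two elements of the cone lies on the ray of
  \<open>a\<close>, then their components in the cone of the other generators combine to a multiple
  of \<open>a\<close>; as \<open>a\<close> is not in that cone and the cone is pointed, these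
  components vanish.\<close>

lemma irredundant_generator_face:
  fixes a :: "'a::real_vector"
  assumes C: "C = convex_cone hull (insert a S)" and a: "a \<notin> convex_cone hull S"
    and pointed: "\<And>x. x \<in> C \<Longrightarrow> - x \<in> C \<Longrightarrow> x = 0"
  shows "convex_cone hull {a} face_of C"
  unfolding face_of_def
proof (intro conjI ballI impI)
  let ?D = "convex_cone hull S" and ?F = "convex_cone hull {a}"
  have DC: "?D \<subseteq> C" unfolding C by (rule hull_mono) blast
  have aC: "a \<in> C" unfolding C by (rule hull_inc) simp
  have dec: "\<exists>\<alpha> y. 0 \<le> \<alpha> \<and> y \<in> ?D \<and> x = \<alpha> *\<^sub>R a + y" if "x \<in> C" for x
  proof -
    have "C = (\<Union>x\<in>?F. \<Union>y\<in>?D. {x + y})" unfolding C using convex_cone_hull_Un[of "{a}" S] by simp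
    then show ?thesis using that unfolding ray_hull by blast
  qed
  show "?F \<subseteq> C" unfolding C by (rule hull_mono) simp
  show "convex ?F" by (rule convex_convex_cone_hull)
  fix x y z assume xy: "x \<in> C" "y \<in> C" and z: "z \<in> ?F" "z \<in> open_segment x y"
  obtain u where u: "0 < u" "u < 1" "z = (1 - u) *\<^sub>R x + u *\<^sub>R y" using z(2) unfolding in_segment by blast
  obtain c where c: "z = c *\<^sub>R a" using z(1) unfolding ray_hull by blast
  obtain \<alpha> x' where x: "0 \<le> \<alpha>" "x' \<in> ?D" "x = \<alpha> *\<^sub>R a + x'" using dec[OF xy(1)] by blast
  obtain \<beta> y' where y: "0 \<le> \<beta>" "y' \<in> ?D" "y = \<beta> *\<^sub>R a + y'" using dec[OF xy(2)] by blast
  define e where "e = c - ((1 - u) * \<alpha> + u * \<beta>)"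
  have ea: "e *\<^sub>R a = (1 - u) *\<^sub>R x' + u *\<^sub>R y'"
    using u(3) unfolding c x(3) y(3) e_def by (simp add: algebra_simps)
  have parts: "(1 - u) *\<^sub>R x' \<in> ?D" "u *\<^sub>R y' \<in> ?D" using x(2) y(2) u by (auto intro: convex_cone_hull_mul)
  then have eD: "e *\<^sub>R a \<in> ?D" unfolding ea by (rule convex_cone_hull_add)
  have "e \<le> 0"
  proof (rule ccontr)
    assume "\<not> e \<le> 0"
    have "inverse e *\<^sub>R (e *\<^sub>R a) \<in> ?D"
      by (rule convex_cone_hull_mul[OF eD]) (use \<open>\<not> e \<le> 0\<close> in simp)
    moreover have "inverse e *\<^sub>R (e *\<^sub>R a) = a" using \<open>\<not> e \<le> 0\<close> by simp
    ultimately show False using a by metis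
  qed
  then have "(- e) *\<^sub>R a \<in> C" using aC unfolding C by (intro convex_cone_hull_mul) simp_all
  then have "e *\<^sub>R a = 0" using pointed[of "e *\<^sub>R a"] eD DC by (simp add: subset_iff)
  then have sum0: "(1 - u) *\<^sub>R x' + u *\<^sub>R y' = 0" using ea by simp
  then have "- ((1 - u) *\<^sub>R x') = u *\<^sub>R y'" by (rule minus_unique)
  then have x0: "(1 - u) *\<^sub>R x' = 0" using pointed[of "(1 - u) *\<^sub>R x'"] parts DC by (simp add: subset_iff)
  then have "u *\<^sub>R y' = 0" using sum0 by (metis add_0)
  then have "x' = 0" "y' = 0" using x0 u by simp_all
  then show "x \<in> ?F" "y \<in> ?F" unfolding ray_hull using x y by auto
qed

definition rays :: "(real ^ 'n) set set \<Rightarrow> (real ^ 'n) set \<Rightarrow> (int ^ 'n) set" where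
  "rays \<Sigma> \<sigma> = {v \<in> primitive_generators \<Sigma>. real_vec v \<in> \<sigma>}"

lemma primitive_multiple:
  fixes v :: "int ^ 'n::finite"
  assumes "v \<noteq> 0"
  obtains g w where "0 < g" "v = g *s w" "Gcd (range (vec_nth w)) = 1"
proof -
  define g where "g = Gcd (range (vec_nth v))"
  obtain i where i: "v $ i \<noteq> 0" using assms by (auto simp: vec_eq_iff)
  have dvd: "g dvd v $ j" for j unfolding g_def by (intro Gcd_dvd rangeI)
  have "g \<noteq> 0" using dvd[of i] i by auto
  moreover have "0 \<le> g" unfolding g_def by simp
  ultimately have g: "0 < g" by simp
  define w where "w = (\<chi> j. v $ j div g)"
  have vw: "v = g *s w" unfolding w_def using dvd by (simp add: vec_eq_iff)
  have "g * Gcd (range (vec_nth w)) dvd g"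
  proof -
    have "g * Gcd (range (vec_nth w)) dvd v $ j" for j
      unfolding vw by (simp add: mult_dvd_mono)
    then have "g * Gcd (range (vec_nth w)) dvd Gcd (range (vec_nth v))" by (intro Gcd_greatest) auto
    then show ?thesis by (simp only: g_def[symmetric])
  qed
  then have "g * Gcd (range (vec_nth w)) dvd g * 1" by simp
  then have "Gcd (range (vec_nth w)) dvd 1" using g by (simp only: dvd_mult_cancel_left) simp
  moreover have "0 \<le> Gcd (range (vec_nth w))" by simp
  ultimately have "Gcd (range (vec_nth w)) = 1" by (simp add: zdvd1_eq)
  then show ?thesis using that g vw by blast
qed

lemma fanD:
  assumes "fan \<Sigma>" "\<sigma> \<in> \<Sigma>"
  shows "rational_cone \<sigma>" "x \<in> \<sigma> \<Longrightarrow> - x \<in> \<sigma> \<Longrightarrow> x = 0" "\<tau> face_of \<sigma> \<Longrightarrow> \<tau> \<noteq> {} \<Longrightarrow> \<tau> \<in> \<Sigma>"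
    "\<tau> \<in> \<Sigma> \<Longrightarrow> \<sigma> \<inter> \<tau> face_of \<sigma>" "\<tau> \<in> \<Sigma> \<Longrightarrow> \<sigma> \<inter> \<tau> face_of \<tau>"
  using assms unfolding fan_def by blast+

lemma fan_finite: "fan \<Sigma> \<Longrightarrow> finite \<Sigma>"
  unfolding fan_def by blast

lemma cone_of_fan:
  assumes "fan \<Sigma>" "\<sigma> \<in> \<Sigma>" shows "convex_cone \<sigma>"
  using fanD(1)[OF assms] unfolding rational_cone_def by (metis convex_cone_convex_cone_hull)

text \<open>Every cone of a fan is generated by the primitive generators of its rays: in a generating
  set of least cardinality no generator is redundant.\<close>

lemma rays_generate:
  assumes fan: "fan \<Sigma>" and \<sigma>: "\<sigma> \<in> \<Sigma>"
  shows "\<sigma> = convex_cone hull (real_vec ` rays \<Sigma> \<sigma>)"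
proof -
  let ?P = "\<lambda>n. \<exists>S. finite S \<and> card S = n \<and> \<sigma> = convex_cone hull (real_vec ` S)"
  obtain S0 where S0: "finite S0" "\<sigma> = convex_cone hull (real_vec ` S0)"
    using fanD(1)[OF assms] unfolding rational_cone_def by (elim exE conjE)
  have "?P (card S0)" by (intro exI[of _ S0] conjI S0 refl)
  then have "\<exists>n. ?P n" by (rule exI)
  then have "?P (LEAST n. ?P n)" by (rule LeastI_ex)
  then obtain S where S: "finite S" "card S = (LEAST n. ?P n)" "\<sigma> = convex_cone hull (real_vec ` S)"
    by (elim exE conjE)
  have gen: "real_vec v \<in> convex_cone hull (real_vec ` rays \<Sigma> \<sigma>)" if v: "v \<in> S" for v
  proof -
    have ins: "real_vec ` S = insert (real_vec v) (real_vec ` (S - {v}))"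
      using image_insert[of real_vec v "S - {v}"] unfolding insert_Diff[OF v] .
    have irr: "real_vec v \<notin> convex_cone hull (real_vec ` (S - {v}))"
    proof
      assume "real_vec v \<in> convex_cone hull (real_vec ` (S - {v}))"
      then have "convex_cone hull (real_vec ` S) = convex_cone hull (real_vec ` (S - {v}))"
        unfolding ins by (rule hull_redundant)
      then have "\<sigma> = convex_cone hull (real_vec ` (S - {v}))" by (simp only: S(3))
      then have "?P (card (S - {v}))" using S(1) by (intro exI[of _ "S - {v}"] conjI finite_Diff refl)
      then have "card S \<le> card (S - {v})" unfolding S(2) by (rule Least_le)
      then show False using card_Diff1_less[OF S(1) v] by simp
    qed
    have face: "convex_cone hull {real_vec v} face_of \<sigma>"
      by (rule irredundant_generator_face[OF S(3)[unfolded ins] irr]) (rule fanD(2)[OF assms])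
    then have inF: "convex_cone hull {real_vec v} \<in> \<Sigma>"
      by (rule fanD(3)[OF assms _ convex_cone_hull_nonempty])
    have "v \<noteq> 0" using irr convex_cone_hull_contains_0 by (metis real_vec_zero)
    then obtain g w where w: "0 < g" "v = g *s w" "Gcd (range (vec_nth w)) = 1" by (rule primitive_multiple)
    have vw: "real_vec v = of_int g *\<^sub>R real_vec w" unfolding w(2) by (rule real_vec_scale)
    have wv: "real_vec w = inverse (of_int g) *\<^sub>R real_vec v" unfolding vw using w(1) by simp
    have "convex_cone hull {real_vec w} = convex_cone hull {real_vec v}"
    proof (rule subset_antisym; rule hull_minimal)
      show "{real_vec w} \<subseteq> convex_cone hull {real_vec v}"
        unfolding wv using w(1) by (simp add: convex_cone_hull_mul hull_inc)
      show "{real_vec v} \<subseteq> convex_cone hull {real_vec w}"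
        unfolding vw using w(1) by (simp add: convex_cone_hull_mul hull_inc)
    qed (rule convex_cone_convex_cone_hull)+
    then have prim: "w \<in> primitive_generators \<Sigma>" using inF w(3) unfolding primitive_generators_def by simp
    have "real_vec v \<in> \<sigma>" unfolding S(3) by (rule hull_inc) (use v in blast)
    then have "real_vec w \<in> \<sigma>" unfolding wv
      using cone_of_fan[OF assms] w(1) by (intro convex_cone_scaleR) simp_all
    then have "w \<in> rays \<Sigma> \<sigma>" using prim unfolding rays_def by simp
    then have "real_vec w \<in> convex_cone hull (real_vec ` rays \<Sigma> \<sigma>)" by (intro hull_inc imageI)
    then show ?thesis unfolding vw by (rule convex_cone_hull_mul) (use w(1) in simp)
  qed
  show ?thesis
  proof (rule subset_antisym)
    show "\<sigma> \<subseteq> convex_cone hull (real_vec ` rays \<Sigma> \<sigma>)"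
      by (subst S(3), rule hull_minimal) (use gen convex_cone_convex_cone_hull in \<open>blast+\<close>)
    show "convex_cone hull (real_vec ` rays \<Sigma> \<sigma>) \<subseteq> \<sigma>"
      by (rule hull_minimal) (use cone_of_fan[OF assms] in \<open>auto simp: rays_def\<close>)
  qed
qed

lemma primitive_generators_unique:
  assumes "v \<in> primitive_generators \<Sigma>" "w \<in> primitive_generators \<Sigma>"
    "real_vec w \<in> convex_cone hull {real_vec v}"
  shows "w = (v :: int ^ 'n::{finite,linorder})"
  using assms primitive_unique unfolding primitive_generators_def by blast

lemma finite_primitive_generators:
  fixes \<Sigma> :: "(real ^ 'n::{finite,linorder}) set set"
  assumes "fan \<Sigma>" shows "finite (primitive_generators \<Sigma>)"
proof (rule inj_on_finite[of "\<lambda>v. convex_cone hull {real_vec v}" _ \<Sigma>])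
  show "inj_on (\<lambda>v. convex_cone hull {real_vec v}) (primitive_generators \<Sigma>)"
  proof (rule inj_onI)
    fix v w assume vw: "v \<in> primitive_generators \<Sigma>" "w \<in> primitive_generators \<Sigma>"
      "convex_cone hull {real_vec v} = convex_cone hull {real_vec w}"
    have "real_vec v \<in> convex_cone hull {real_vec v}" by (rule hull_inc) simp
    then show "v = w" unfolding vw(3) by (rule primitive_generators_unique[OF vw(2,1)])
  qed
qed (use fan_finite[OF assms] in \<open>auto simp: primitive_generators_def\<close>)

lemma finite_rays:
  fixes \<Sigma> :: "(real ^ 'n::{finite,linorder}) set set"
  shows "fan \<Sigma> \<Longrightarrow> finite (rays \<Sigma> \<sigma>)"
  unfolding rays_def by (rule finite_subset[OF _ finite_primitive_generators]) auto

lemma rays_of_ray: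
  assumes v: "v \<in> primitive_generators \<Sigma>"
  shows "rays \<Sigma> (convex_cone hull {real_vec v}) = {v :: int ^ 'n::{finite,linorder}}"
proof (rule subset_antisym; rule subsetI)
  fix w assume "w \<in> rays \<Sigma> (convex_cone hull {real_vec v})"
  then show "w \<in> {v}" using primitive_generators_unique[OF v, of w] unfolding rays_def by simp
next
  fix w assume "w \<in> {v}"
  moreover have "real_vec v \<in> convex_cone hull {real_vec v}" by (rule hull_inc) simp
  ultimately show "w \<in> rays \<Sigma> (convex_cone hull {real_vec v})" using v unfolding rays_def by simp
qed

lemma dual_monoid_rays:
  assumes "fan \<Sigma>" "\<sigma> \<in> \<Sigma>"
  shows "m \<in> dual_monoid \<sigma> \<longleftrightarrow> (\<forall>v\<in>rays \<Sigma> \<sigma>. 0 \<le> wt v m)"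
  by (subst rays_generate[OF assms]) (rule dual_monoid_hull)

lemma ray_face:
  assumes "fan \<Sigma>" "\<sigma> \<in> \<Sigma>" "v \<in> rays \<Sigma> \<sigma>"
  shows "convex_cone hull {real_vec v} face_of \<sigma>"
proof -
  have "convex_cone hull {real_vec v} \<in> \<Sigma>" "real_vec v \<in> \<sigma>"
    using assms(3) unfolding rays_def primitive_generators_def by blast+
  moreover from this have "convex_cone hull {real_vec v} \<subseteq> \<sigma>"
    using cone_of_fan[OF assms(1,2)] by (intro hull_minimal) simp_all
  then have "\<sigma> \<inter> convex_cone hull {real_vec v} = convex_cone hull {real_vec v}" by (rule Int_absorb1)
  ultimately show ?thesis using fanD(4)[OF assms(1,2), of "convex_cone hull {real_vec v}"] by simp
qed

text \<open>Apply the lemma of Farkas to \<open>- w\<close> and the cone generated by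
  \<open>\<sigma>\<close> and \<open>- v\<close>, which does not contain \<open>- w\<close> because
  the ray of \<open>v\<close> is a face.\<close>

lemma separate_two_rays:
  fixes \<Sigma> :: "(real ^ 'n::{finite,linorder}) set set"
  assumes fan: "fan \<Sigma>" and \<sigma>: "\<sigma> \<in> \<Sigma>" and v: "v \<in> rays \<Sigma> \<sigma>" and w: "w \<in> rays \<Sigma> \<sigma>" and ne: "w \<noteq> v"
  shows "\<exists>m\<in>dual_monoid \<sigma>. wt v m = 0 \<and> 0 < wt w m"
proof -
  let ?S = "insert (- v) (rays \<Sigma> \<sigma>)"
  have "real_vec (- w) \<notin> convex_cone hull (real_vec ` ?S)"
  proof
    assume "real_vec (- w) \<in> convex_cone hull (real_vec ` ?S)"
    moreover have "real_vec ` ?S = {- real_vec v} \<union> real_vec ` rays \<Sigma> \<sigma>" by (simp add: real_vec_uminus)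
    ultimately have "- real_vec w \<in> (\<Union>x\<in>convex_cone hull {- real_vec v}. \<Union>y\<in>\<sigma>. {x + y})"
      by (simp only: convex_cone_hull_Un rays_generate[OF fan \<sigma>, symmetric] real_vec_uminus)
    then obtain c y where c: "0 \<le> c" "y \<in> \<sigma>" "- real_vec w = c *\<^sub>R (- real_vec v) + y"
      unfolding ray_hull by blast
    have "real_vec w + y = c *\<^sub>R real_vec v" using c(3) by (simp add: algebra_simps)
    then have wy: "real_vec w + y \<in> convex_cone hull {real_vec v}" using c(1) unfolding ray_hull by blast
    have "real_vec w \<in> \<sigma>" using w unfolding rays_def by simp
    from face_of_cone_summand[OF ray_face[OF fan \<sigma> v] convex_cone_convex_cone_hull this c(2) wy]
    have "real_vec w \<in> convex_cone hull {real_vec v}" .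
    then show False using primitive_generators_unique[of v \<Sigma> w] v w ne unfolding rays_def by blast
  qed
  from farkas[OF finite.insertI[OF finite_rays[OF fan]] this]
  obtain m where m0: "\<forall>u\<in>?S. 0 \<le> wt u m" and m2: "wt (- w) m < 0" by (elim exE conjE)
  have m: "\<And>u. u \<in> ?S \<Longrightarrow> 0 \<le> wt u m" "wt (- w) m < 0" by (rule bspec[OF m0], assumption) (rule m2)
  have neg: "wt (- u) m = - wt u m" for u by (simp add: wt_def sum_negf)
  have "wt v m = 0" "0 < wt w m" using m(1)[of v] m(1)[of "- v"] m(2) v unfolding neg by simp_all
  moreover have "m \<in> dual_monoid \<sigma>" unfolding dual_monoid_rays[OF fan \<sigma>] using m(1) by blast
  ultimately show ?thesis by blast
qed

text \<open>The ray of \<open>v\<close> is exposed by the sum of the functionals that separate it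
  from each of the other rays.\<close>

lemma exposing_functional:
  fixes \<Sigma> :: "(real ^ 'n::{finite,linorder}) set set"
  assumes fan: "fan \<Sigma>" and \<sigma>: "\<sigma> \<in> \<Sigma>" and v: "v \<in> rays \<Sigma> \<sigma>"
  obtains m where "m \<in> dual_monoid \<sigma>" "wt v m = 0" "\<And>w. w \<in> rays \<Sigma> \<sigma> \<Longrightarrow> w \<noteq> v \<Longrightarrow> 0 < wt w m"
proof -
  have "\<forall>w\<in>rays \<Sigma> \<sigma> - {v}. \<exists>m. m \<in> dual_monoid \<sigma> \<and> wt v m = 0 \<and> 0 < wt w m"
    using separate_two_rays[OF fan \<sigma> v] by blast
  then obtain f where f: "\<And>w. w \<in> rays \<Sigma> \<sigma> - {v} \<Longrightarrow> f w \<in> dual_monoid \<sigma> \<and> wt v (f w) = 0 \<and> 0 < wt w (f w)"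
    by metis
  let ?R = "rays \<Sigma> \<sigma> - {v}"
  define m where "m = (\<Sum>w\<in>?R. f w)"
  have fin: "finite ?R" using finite_rays[OF fan] by blast
  have nn: "0 \<le> wt u (f w)" if "u \<in> rays \<Sigma> \<sigma>" "w \<in> ?R" for u w
    using f[OF that(2)] that(1) unfolding dual_monoid_rays[OF fan \<sigma>] by blast
  have "m \<in> dual_monoid \<sigma>"
    unfolding dual_monoid_rays[OF fan \<sigma>] m_def wt_sum using nn by (intro ballI sum_nonneg)
  moreover have "wt v m = 0" unfolding m_def wt_sum by (rule sum.neutral) (use f in blast)
  moreover have "0 < wt w m" if w: "w \<in> rays \<Sigma> \<sigma>" "w \<noteq> v" for w
  proof -
    have "w \<in> ?R" using w by blast
    then show ?thesis unfolding m_def wt_sum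
      using f[of w] nn[OF w(1)] by (intro sum_pos2[OF fin]) blast+
  qed
  ultimately show ?thesis using that by blast
qed

text \<open>A sum of functionals, one for each ray \<open>w\<close>, that is nonnegative on the
  cone and positive at \<open>w\<close>; such functionals exist since the cone does not contain
  \<open>- w\<close>.\<close>

lemma positive_functional:
  fixes \<Sigma> :: "(real ^ 'n::{finite,linorder}) set set"
  assumes fan: "fan \<Sigma>" and \<sigma>: "\<sigma> \<in> \<Sigma>" 
  obtains m where "m \<in> dual_monoid \<sigma>" "\<And>w. w \<in> rays \<Sigma> \<sigma> \<Longrightarrow> 0 < wt w m"
proof -
  have "\<exists>m. m \<in> dual_monoid \<sigma> \<and> 0 < wt w m" if w: "w \<in> rays \<Sigma> \<sigma>" for w
  proof -
    have w': "real_vec w \<in> \<sigma>" "Gcd (range (vec_nth w)) = 1"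
      using w unfolding rays_def primitive_generators_def by blast+
    have "w \<noteq> 0"
    proof
      assume "w = 0"
      obtain m where "wt w m = 1" by (rule primitive_functional[OF w'(2)])
      then show False unfolding \<open>w = 0\<close> by (simp add: wt_def)
    qed
    then have "- real_vec w \<notin> \<sigma>" using fanD(2)[OF fan \<sigma> w'(1)] real_vec_inject[of w 0] by force
    then have "real_vec (- w) \<notin> convex_cone hull (real_vec ` rays \<Sigma> \<sigma>)"
      unfolding rays_generate[OF fan \<sigma>, symmetric] real_vec_uminus .
    from farkas[OF finite_rays[OF fan] this]
    obtain m where m: "\<forall>u\<in>rays \<Sigma> \<sigma>. 0 \<le> wt u m" "wt (- w) m < 0" by (elim exE conjE)
    have "wt (- w) m = - wt w m" by (simp add: wt_def sum_negf)
    then show ?thesis using m unfolding dual_monoid_rays[OF fan \<sigma>] by (intro exI[of _ m]) simp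
  qed
  then obtain f where f: "\<And>w. w \<in> rays \<Sigma> \<sigma> \<Longrightarrow> f w \<in> dual_monoid \<sigma> \<and> 0 < wt w (f w)" by metis
  define m where "m = (\<Sum>w\<in>rays \<Sigma> \<sigma>. f w)"
  have nn: "0 \<le> wt u (f w)" if "u \<in> rays \<Sigma> \<sigma>" "w \<in> rays \<Sigma> \<sigma>" for u w
    using f[OF that(2)] that(1) unfolding dual_monoid_rays[OF fan \<sigma>] by blast
  have "m \<in> dual_monoid \<sigma>"
    unfolding dual_monoid_rays[OF fan \<sigma>] m_def wt_sum using nn by (intro ballI sum_nonneg)
  moreover have "0 < wt w m" if w: "w \<in> rays \<Sigma> \<sigma>" for w
    unfolding m_def wt_sum using f[of w] nn[OF w] w by (intro sum_pos2[OF finite_rays[OF fan]]) blast+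
  ultimately show ?thesis using that by blast
qed

text \<open>Biduality of rational cones, a reformulation of the lemma of Farkas.\<close>

lemma in_cone_of_dual_nonneg:
  assumes fan: "fan \<Sigma>" and \<sigma>: "\<sigma> \<in> \<Sigma>" and pos: "\<And>m. m \<in> dual_monoid \<sigma> \<Longrightarrow> 0 \<le> wt u m"
  shows "real_vec u \<in> (\<sigma> :: (real ^ 'n::{finite,linorder}) set)"
proof (rule ccontr)
  assume "real_vec u \<notin> \<sigma>"
  then have "real_vec u \<notin> convex_cone hull (real_vec ` rays \<Sigma> \<sigma>)"
    unfolding rays_generate[OF fan \<sigma>, symmetric] .
  from farkas[OF finite_rays[OF fan] this]
  obtain m where m: "\<forall>v\<in>rays \<Sigma> \<sigma>. 0 \<le> wt v m" "wt u m < 0" by (elim exE conjE)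
  have "m \<in> dual_monoid \<sigma>" unfolding dual_monoid_rays[OF fan \<sigma>] by (rule m(1))
  then show False using pos[of m] m(2) by simp
qed

text \<open>The support is closed and invariant under positive scaling, so that it contains all
  rational points and their limits.\<close>

lemma fan_covers:
  fixes \<Sigma> :: "(real ^ 'n::{finite,linorder}) set set"
  assumes fan: "fan \<Sigma>" and lat: "\<And>u. \<exists>\<sigma>\<in>\<Sigma>. real_vec u \<in> \<sigma>"
  shows "\<Union>\<Sigma> = UNIV"
proof -
  have cl: "closed \<sigma>" if "\<sigma> \<in> \<Sigma>" for \<sigma>
    by (subst rays_generate[OF fan that], rule closed_convex_cone_hull) (simp add: finite_rays[OF fan])
  have closed: "closed (\<Union>\<Sigma>)" by (rule closed_Union[OF fan_finite[OF fan]]) (use cl in blast)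
  have "x \<in> \<Union>\<Sigma>" for x
  proof -
    define u where "u N = (\<chi> i. \<lfloor>real (Suc N) * x $ i\<rfloor>)" for N :: nat
    define y where "y N = inverse (real (Suc N)) *\<^sub>R real_vec (u N)" for N
    have mem: "y N \<in> \<Union>\<Sigma>" for N
    proof -
      obtain \<sigma> where \<sigma>: "\<sigma> \<in> \<Sigma>" "real_vec (u N) \<in> \<sigma>" using lat by blast
      then have "y N \<in> \<sigma>" unfolding y_def using cone_of_fan[OF fan \<sigma>(1)] by (intro convex_cone_scaleR) simp_all
      then show ?thesis using \<sigma>(1) by blast
    qed
    have "y \<longlonglongrightarrow> x"
    proof (rule vec_tendstoI)
      fix i
      have lim: "(\<lambda>N. x $ i - inverse (real (Suc N))) \<longlonglongrightarrow> x $ i - 0"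
        by (intro tendsto_diff tendsto_const LIMSEQ_inverse_real_of_nat)
      show "(\<lambda>N. y N $ i) \<longlonglongrightarrow> x $ i"
      proof (rule tendsto_sandwich[OF _ _ lim[unfolded diff_zero] tendsto_const])
        have yN: "y N $ i = inverse (real (Suc N)) * real_of_int \<lfloor>real (Suc N) * x $ i\<rfloor>" for N
          unfolding y_def u_def
          by (simp only: vector_scaleR_component real_vec_nth vec_lambda_beta real_scaleR_def)
        have ge: "x $ i - inverse (real (Suc N)) \<le> y N $ i" for N
        proof -
          have "real (Suc N) * x $ i - 1 \<le> real_of_int \<lfloor>real (Suc N) * x $ i\<rfloor>" by linarith
          then have "inverse (real (Suc N)) * (real (Suc N) * x $ i - 1)
            \<le> inverse (real (Suc N)) * real_of_int \<lfloor>real (Suc N) * x $ i\<rfloor>" by (rule mult_left_mono) simp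
          moreover have "inverse (real (Suc N)) * (real (Suc N) * x $ i - 1) = x $ i - inverse (real (Suc N))"
            by (simp add: field_simps)
          ultimately show ?thesis unfolding yN by linarith
        qed
        have le: "y N $ i \<le> x $ i" for N
        proof -
          have "inverse (real (Suc N)) * real_of_int \<lfloor>real (Suc N) * x $ i\<rfloor>
            \<le> inverse (real (Suc N)) * (real (Suc N) * x $ i)" by (rule mult_left_mono) simp_all
          moreover have "inverse (real (Suc N)) * (real (Suc N) * x $ i) = x $ i" by (simp add: field_simps)
          ultimately show ?thesis unfolding yN by linarith
        qed
        show "\<forall>\<^sub>F N in sequentially. x $ i - inverse (real (Suc N)) \<le> y N $ i"
          "\<forall>\<^sub>F N in sequentially. y N $ i \<le> x $ i" using ge le by simp_all
      qed
    qed
    then show ?thesis using closed mem by (meson closed_sequentially)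
  qed
  then show ?thesis by blast
qed

lemma interior_finite_Union_nonempty:
  fixes T :: "'a::topological_space set set"
  assumes "finite T" "\<And>S. S \<in> T \<Longrightarrow> closed S" "x \<in> interior (\<Union>T)"
  shows "\<exists>S\<in>T. \<exists>y. y \<in> interior S"
  using assms
proof (induction T rule: finite_induct)
  case (insert S T)
  show ?case
  proof (cases "\<exists>y. y \<in> interior S")
    case False
    then have S: "interior S = {}" by simp
    have T: "closed (\<Union>T)" using insert.hyps(1) insert.prems(1) by (intro closed_Union) simp_all
    have "interior (\<Union>T \<union> S) = interior (\<Union>T)" by (rule interior_closed_Un_empty_interior[OF T S])
    moreover have "\<Union>(insert S T) = \<Union>T \<union> S" by (simp add: Un_commute)
    ultimately have "x \<in> interior (\<Union>T)" using insert.prems(2) by simp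
    moreover have "closed R" if "R \<in> T" for R using insert.prems(1) that by simp
    ultimately have "\<exists>S\<in>T. \<exists>y. y \<in> interior S" by (intro insert.IH)
    then show ?thesis by (elim bexE) (intro bexI[OF _ insertI2])
  qed simp
qed simp

text \<open>Near a point of the relative interior of \<open>\<tau>\<close>, the space is the union
  of the cones that contain this point, so that one of these has interior points. It contains
  \<open>\<tau>\<close> because its intersection with \<open>\<tau>\<close> is a face that meets the
  relative interior.\<close>

lemma in_full_dimensional_cone:
  fixes \<Sigma> :: "(real ^ 'n::{finite,linorder}) set set"
  assumes fan: "fan \<Sigma>" and cover: "\<Union>\<Sigma> = UNIV" and \<tau>: "\<tau> \<in> \<Sigma>"
  shows "\<exists>\<sigma>\<in>\<Sigma>. \<tau> \<subseteq> \<sigma> \<and> dim \<sigma> = CARD('n)"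
proof -
  have cl: "closed \<sigma>" if "\<sigma> \<in> \<Sigma>" for \<sigma>
    by (subst rays_generate[OF fan that], rule closed_convex_cone_hull) (simp add: finite_rays[OF fan])
  have "convex \<tau>" "\<tau> \<noteq> {}" using cone_of_fan[OF fan \<tau>] unfolding convex_cone_def by blast+
  then have "rel_interior \<tau> \<noteq> {}" by (simp add: rel_interior_eq_empty)
  then obtain w where w: "w \<in> rel_interior \<tau>" unfolding ex_in_conv[symmetric] by (rule exE)
  define T where "T = {\<sigma> \<in> \<Sigma>. w \<in> \<sigma>}"
  define U where "U = - \<Union>(\<Sigma> - T)"
  have oU: "open U" unfolding U_def using fan_finite[OF fan] cl by (intro open_Compl closed_Union) simp_all
  have wU: "w \<in> U" unfolding U_def T_def by simp
  have UT: "U \<subseteq> \<Union>T"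
  proof
    fix x assume "x \<in> U"
    moreover have "x \<in> \<Union>\<Sigma>" unfolding cover by simp
    ultimately show "x \<in> \<Union>T" unfolding U_def by blast
  qed
  have "w \<in> interior (\<Union>T)" by (rule subsetD[OF interior_maximal[OF UT oU] wU])
  then have "\<exists>S\<in>T. \<exists>y. y \<in> interior S"
    by (rule interior_finite_Union_nonempty[rotated 2]) (use fan_finite[OF fan] cl in \<open>simp_all add: T_def\<close>)
  then obtain \<sigma> y where \<sigma>: "\<sigma> \<in> T" "y \<in> interior \<sigma>" by (elim bexE exE)
  have \<sigma>\<Sigma>: "\<sigma> \<in> \<Sigma>" "w \<in> \<sigma>" using \<sigma>(1) unfolding T_def by simp_all
  have le: "dim \<sigma> \<le> CARD('n)" using dim_subset_UNIV[of \<sigma>] by simp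
  have "dim \<sigma> = CARD('n)"
  proof (rule ccontr)
    assume "dim \<sigma> \<noteq> CARD('n)"
    then have "dim \<sigma> < CARD('n)" using le by linarith
    then have "interior \<sigma> = {}" by (intro empty_interior_lowdim) simp
    then show False using \<sigma>(2) by simp
  qed
  moreover have "\<tau> \<subseteq> \<sigma>"
  proof -
    have "\<tau> \<subseteq> \<tau> \<inter> \<sigma>"
    proof (rule subset_of_face_of[OF fanD(4)[OF fan \<tau> \<sigma>\<Sigma>(1)] subset_refl])
      have "w \<in> \<tau> \<inter> \<sigma> \<inter> rel_interior \<tau>"
        by (intro IntI w \<sigma>\<Sigma>(2) subsetD[OF rel_interior_subset w])
      then show "\<tau> \<inter> \<sigma> \<inter> rel_interior \<tau> \<noteq> {}" unfolding ex_in_conv[symmetric] by (rule exI)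
    qed
    then show ?thesis by simp
  qed
  ultimately show ?thesis using \<sigma>\<Sigma>(1) by blast
qed

section \<open>Affine charts and prime divisors of a toric variety\<close>

abbreviation embed :: "('n::{finite,linorder}, 'k::field) group_algebra \<Rightarrow> ('n, 'k) toric_field" where
  "embed f \<equiv> Fract f 1"

lemma embed_eq_iff: "embed f = embed g \<longleftrightarrow> f = g"
  by (subst eq_fract) simp_all

lemma embed_add: "embed f + embed g = embed (f + g)" and embed_diff: "embed f - embed g = embed (f - g)"
  and embed_mult: "embed f * embed g = embed (f * g)"
  by simp_all

lemma embed_one: "embed 1 = 1" and embed_zero: "embed 0 = 0"
  by (simp_all add: One_fract_def Zero_fract_def)

lemma embed_zero_iff: "embed f = 0 \<longleftrightarrow> f = 0"
  by (rule Fract_eq_zero_iff) simp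

lemma embed_divide: "b \<noteq> 0 \<Longrightarrow> embed a / embed b = Fract a b"
  by (subst divide_fract) simp

lemma mem_character_span: "z \<in> character_span S \<longleftrightarrow> (\<exists>f. Poly_Mapping.keys f \<subseteq> S \<and> z = embed f)"
  unfolding character_span_def image_iff mem_Collect_eq Bex_def by (rule refl)

lemma embed_in_span: "embed f \<in> character_span S \<longleftrightarrow> Poly_Mapping.keys f \<subseteq> S"
  unfolding mem_character_span embed_eq_iff by blast

lemma ray_val_embed: "f \<noteq> 0 \<Longrightarrow> ray_val v (embed f) = low (wt v) f"
  using ray_val_Fract[of f 1 v] integer_valuation.one[OF integer_valuation_ray[of v]] by simp

lemma torus_val_embed: "prime_elem p \<Longrightarrow> f \<noteq> 0 \<Longrightarrow> torus_val p (embed f) = padic p f"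
  using torus_val_Fract[of p f 1] padic_unit[of p 1] by simp

lemma dual_monoid_zero: "0 \<in> dual_monoid \<sigma>"
  by (simp add: dual_monoid_def pairing_def)

lemma dual_monoid_add: "m \<in> dual_monoid \<sigma> \<Longrightarrow> n \<in> dual_monoid \<sigma> \<Longrightarrow> m + n \<in> dual_monoid \<sigma>"
  unfolding dual_monoid_def by (simp add: pairing_def lookup_add distrib_right sum.distrib)

abbreviation chart :: "(real ^ 'n::{finite,linorder}) set \<Rightarrow> ('n, 'k::field) toric_field set" where
  "chart \<sigma> \<equiv> character_span (dual_monoid \<sigma>)"

lemma ring_closed_chart:
  fixes \<sigma> :: "(real ^ 'n::{finite,linorder}) set"
  shows "ring_closed (chart \<sigma> :: ('n, 'k::field) toric_field set)"
  unfolding ring_closed_def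
proof (intro conjI ballI)
  show "1 \<in> chart \<sigma>" unfolding embed_one[symmetric] embed_in_span using dual_monoid_zero by simp
  fix x y :: "('n, 'k) toric_field" assume "x \<in> chart \<sigma>" "y \<in> chart \<sigma>"
  then obtain f g where f: "Poly_Mapping.keys f \<subseteq> dual_monoid \<sigma>" "x = embed f"
    and g: "Poly_Mapping.keys g \<subseteq> dual_monoid \<sigma>" "y = embed g"
    unfolding mem_character_span by (elim exE conjE)
  show "x - y \<in> chart \<sigma>" unfolding f(2) g(2) embed_diff embed_in_span
    using keys_diff[of f g] f(1) g(1) by (meson Un_least subset_trans)
  show "x * y \<in> chart \<sigma>" unfolding f(2) g(2) embed_mult embed_in_span
  proof
    fix m assume "m \<in> Poly_Mapping.keys (f * g)"
    then obtain a b where "a \<in> Poly_Mapping.keys f" "b \<in> Poly_Mapping.keys g" "m = a + b"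
      by (rule keys_mult_elim)
    then show "m \<in> dual_monoid \<sigma>"
      using dual_monoid_add[OF subsetD[OF f(1)] subsetD[OF g(1)], of a b] by simp
  qed
qed

lemma chr_in_chart: "m \<in> dual_monoid \<sigma> \<Longrightarrow> chr m \<in> chart \<sigma>"
  unfolding embed_in_span by simp

text \<open>Characters clear denominators: every Laurent polynomial with nonnegative order along the
  rays on which \<open>m\<close> vanishes becomes regular after multiplication by a power of \<open>m\<close>.\<close>

lemma clear_denominators:
  fixes \<Sigma> :: "(real ^ 'n::{finite,linorder}) set set" and f :: "('n, 'k::field) group_algebra"
  assumes fan: "fan \<Sigma>" and \<sigma>: "\<sigma> \<in> \<Sigma>"
    and m: "\<And>v. v \<in> rays \<Sigma> \<sigma> \<Longrightarrow> 0 < wt v m \<or> (wt v m = 0 \<and> 0 \<le> low (wt v) f)"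
  shows "\<exists>N. \<forall>k\<ge>N. Poly_Mapping.keys (character (frag_cmul (int k) m) * f) \<subseteq> dual_monoid \<sigma>"
proof -
  define B where "B = (\<Sum>v\<in>rays \<Sigma> \<sigma>. \<bar>low (wt v) f\<bar>)"
  have B: "\<bar>low (wt v) f\<bar> \<le> B" if "v \<in> rays \<Sigma> \<sigma>" for v
    unfolding B_def using that finite_rays[OF fan] by (intro member_le_sum) simp_all
  have "Poly_Mapping.keys (character (frag_cmul (int k) m) * f) \<subseteq> dual_monoid \<sigma>" if k: "nat B \<le> k" for k
  proof
    fix n assume "n \<in> Poly_Mapping.keys (character (frag_cmul (int k) m) * f)"
    then obtain a where a: "a \<in> Poly_Mapping.keys f" "n = frag_cmul (int k) m + a"
      unfolding keys_character_mult by (elim imageE)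
    show "n \<in> dual_monoid \<sigma>" unfolding dual_monoid_rays[OF fan \<sigma>]
    proof
      fix v assume v: "v \<in> rays \<Sigma> \<sigma>"
      have wn: "wt v n = int k * wt v m + wt v a" unfolding a(2) wt_add wt_cmul by (rule refl)
      have la: "low (wt v) f \<le> wt v a" by (rule low_le[OF a(1)])
      show "0 \<le> wt v n"
      proof (cases "0 < wt v m")
        case True
        then have "int k * 1 \<le> int k * wt v m" by (intro mult_left_mono) simp_all
        moreover have "B \<le> int k" using k by simp
        ultimately show ?thesis using wn la B[OF v] by linarith
      next
        case False
        then show ?thesis using m[OF v] wn la by simp
      qed
    qed
  qed
  then show ?thesis by blast
qed

definition torus_divisors :: "('n::{finite,linorder}, 'k::field) toric_field set set" where
  "torus_divisors = {val_ring (torus_val p) | p. prime_elem p}"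

abbreviation ray_ring :: "int ^ 'n::{finite,linorder} \<Rightarrow> ('n, 'k::field) toric_field set" where
  "ray_ring v \<equiv> val_ring (ray_val v)"

lemma discrete_valuation_ray_val:
  assumes "v \<in> primitive_generators \<Sigma>"
  shows "discrete_valuation (ray_val v :: ('n::{finite,linorder}, 'k::field) toric_field \<Rightarrow> int)"
proof -
  interpret field_valuation "ray_val v :: ('n, 'k) toric_field \<Rightarrow> int" by (rule field_valuation_ray_val)
  have "Gcd (range (vec_nth v)) = 1" using assms unfolding primitive_generators_def by simp
  then obtain m where "wt v m = 1" by (rule primitive_functional)
  then have "ray_val v (chr m :: ('n, 'k) toric_field) = 1" unfolding ray_val_chr .
  then show ?thesis using chr_nonzero by unfold_locales blast
qed

lemma chart_subset_ray_ring:
  fixes u :: "int ^ 'n::{finite,linorder}"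
  assumes "real_vec u \<in> \<sigma>"
  shows "(chart \<sigma> :: ('n, 'k::field) toric_field set) \<subseteq> ray_ring u"
proof
  fix z :: "('n, 'k) toric_field" assume "z \<in> chart \<sigma>"
  then obtain f where f: "Poly_Mapping.keys f \<subseteq> dual_monoid \<sigma>" "z = embed f"
    unfolding mem_character_span by (elim exE conjE)
  show "z \<in> ray_ring u"
  proof (cases "f = 0")
    case True
    then show ?thesis unfolding f(2) val_ring_def by (simp add: embed_zero)
  next
    case False
    have "0 \<le> low (wt u) f"
    proof (rule low_ge[OF False])
      fix m assume "m \<in> Poly_Mapping.keys f"
      then have "0 \<le> pairing m (real_vec u)" using f(1) assms unfolding dual_monoid_def by blast
      then show "0 \<le> wt u m" by (simp add: pairing_real_vec)
    qed
    then show ?thesis unfolding f(2) val_ring_def using ray_val_embed[OF False] by simp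
  qed
qed

lemma chart_subset_torus_ring:
  fixes p :: "('n::{finite,linorder}, 'k::field) group_algebra"
  assumes p: "prime_elem p" shows "chart \<sigma> \<subseteq> val_ring (torus_val p)"
proof
  fix z :: "('n, 'k) toric_field" assume "z \<in> chart \<sigma>"
  then obtain f where f: "z = embed f" unfolding mem_character_span by (elim exE conjE)
  show "z \<in> val_ring (torus_val p)"
  proof (cases "f = 0")
    case True
    then show ?thesis unfolding f val_ring_def by (simp add: embed_zero)
  next
    case False
    then show ?thesis unfolding f val_ring_def
      using torus_val_embed[OF p False] padic_nonneg[OF p False] by simp
  qed
qed

text \<open>The local ring of a chart at the centre of a ray valuation is the whole valuation ring:
  numerator and denominator are first shifted to order zero along the ray, then made regular along
  the other rays by a character that exposes the ray.\<close>

lemma localization_ray: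
  fixes \<Sigma> :: "(real ^ 'n::{finite,linorder}) set set"
  assumes fan: "fan \<Sigma>" and \<sigma>: "\<sigma> \<in> \<Sigma>" and v: "v \<in> rays \<Sigma> \<sigma>"
  shows "localization (chart \<sigma>) (field_valuation.centre (ray_val v) (chart \<sigma>)) =
    (ray_ring v :: ('n, 'k::field) toric_field set)"
proof -
  interpret field_valuation "ray_val v :: ('n, 'k) toric_field \<Rightarrow> int" by (rule field_valuation_ray_val)
  have v': "real_vec v \<in> \<sigma>" "v \<in> primitive_generators \<Sigma>" using v unfolding rays_def by simp_all
  show ?thesis
  proof (rule localization_centre[OF ring_closed_chart chart_subset_ray_ring[OF v'(1)]])
    fix z :: "('n, 'k) toric_field" assume z: "z \<noteq> 0" "0 \<le> ray_val v z"
    obtain a b where ab: "a \<noteq> 0" "b \<noteq> 0" "z = Fract a b" using z(1) by (rule nonzero_fract_cases)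
    obtain m1 where m1: "wt v m1 = 1"
      using v'(2) primitive_functional[of v] unfolding primitive_generators_def by blast
    define s where "s = frag_cmul (- low (wt v) b) m1"
    have ws: "wt v s = - low (wt v) b" unfolding s_def wt_cmul m1 by simp
    have lowmul: "low (wt v) (character n * f) = wt v n + low (wt v) f" if "f \<noteq> 0"
      for n and f :: "('n, 'k) group_algebra"
      using weight.low_mult[OF weight_wt character_nonzero that, of v n]
        weight.low_character[OF weight_wt, of v n, where ?'k = 'k] by simp
    have a0: "0 \<le> low (wt v) (character s * a)"
      using z(2) ab ray_val_Fract[OF ab(1,2), of v] lowmul[OF ab(1), of s] ws by simp
    have b0: "low (wt v) (character s * b) = 0" using lowmul[OF ab(2), of s] ws by simp
    obtain m where m: "m \<in> dual_monoid \<sigma>" "wt v m = 0" "\<And>w. w \<in> rays \<Sigma> \<sigma> \<Longrightarrow> w \<noteq> v \<Longrightarrow> 0 < wt w m"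
      by (rule exposing_functional[OF fan \<sigma> v]) blast
    have cond: "0 < wt w m \<or> (wt w m = 0 \<and> 0 \<le> low (wt w) f)"
      if "w \<in> rays \<Sigma> \<sigma>" "0 \<le> low (wt v) f" for w and f :: "('n, 'k) group_algebra"
      using m(2) m(3)[OF that(1)] that(2) by (cases "w = v") simp_all
    obtain N1 where N1: "\<And>k. N1 \<le> k \<Longrightarrow>
        Poly_Mapping.keys (character (frag_cmul (int k) m) * (character s * a)) \<subseteq> dual_monoid \<sigma>"
      using clear_denominators[OF fan \<sigma> cond[OF _ a0]] by blast
    obtain N2 where N2: "\<And>k. N2 \<le> k \<Longrightarrow>
        Poly_Mapping.keys (character (frag_cmul (int k) m) * (character s * b)) \<subseteq> dual_monoid \<sigma>"
      using clear_denominators[OF fan \<sigma> cond[OF _ b0[THEN eq_refl[OF sym]]]] by blast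
    define k where "k = max N1 N2"
    define a' where "a' = character (frag_cmul (int k) m) * (character s * a)"
    define b' where "b' = character (frag_cmul (int k) m) * (character s * b)"
    have b'0: "b' \<noteq> 0" unfolding b'_def using ab(2) by simp
    have "low (wt v) b' = 0" unfolding b'_def
      using lowmul[of "character s * b" "frag_cmul (int k) m"] ab(2) b0 m(2) by (simp add: wt_cmul)
    then have vb: "ray_val v (embed b') = 0" using ray_val_embed[OF b'0] by simp
    have "z = Fract a' b'" unfolding ab(3) using ab(2) b'0
      by (subst eq_fract) (simp_all add: a'_def b'_def mult_ac)
    then have "z = embed a' / embed b'" using embed_divide[OF b'0] by simp
    moreover have "embed a' \<in> chart \<sigma>" "embed b' \<in> chart \<sigma>"
      unfolding embed_in_span a'_def b'_def k_def by (intro N1 N2; simp)+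
    moreover have "embed b' \<noteq> 0" using b'0 by (simp add: embed_zero_iff)
    ultimately show "\<exists>a\<in>chart \<sigma>. \<exists>b\<in>chart \<sigma>. b \<noteq> 0 \<and> ray_val v b = 0 \<and> z = a / b"
      using vb by (intro bexI[of _ "embed a'"] bexI[of _ "embed b'"] conjI)
  qed
qed

text \<open>The prime is cancelled from the denominator, and then numerator and denominator are
  multiplied by a character that makes both regular; characters have order zero at the
  prime.\<close>

lemma localization_torus:
  fixes \<Sigma> :: "(real ^ 'n::{finite,linorder}) set set" and p :: "('n, 'k::field) group_algebra"
  assumes fan: "fan \<Sigma>" and \<sigma>: "\<sigma> \<in> \<Sigma>" and p: "prime_elem p"
  shows "localization (chart \<sigma>) (field_valuation.centre (torus_val p) (chart \<sigma>)) = val_ring (torus_val p)"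
proof -
  interpret discrete_valuation "torus_val p" by (rule discrete_valuation_torus_val[OF p])
  show ?thesis
  proof (rule localization_centre[OF ring_closed_chart chart_subset_torus_ring[OF p]])
    fix z :: "('n, 'k) toric_field" assume z: "z \<noteq> 0" "0 \<le> torus_val p z"
    obtain a b where ab: "a \<noteq> 0" "b \<noteq> 0" "z = Fract a b" using z(1) by (rule nonzero_fract_cases)
    obtain l b1 where b1: "b = p ^ l * b1" "\<not> p dvd b1" "padic p b = int l" by (rule padic_cases[OF p ab(2)])
    have "int l \<le> padic p a" using z(2) torus_val_Fract[OF p ab(1,2)] ab(3) b1(3) by simp
    then have "p ^ l dvd a" using padic_ge_iff[OF p ab(1)] by simp
    then obtain a1 where a1: "a = p ^ l * a1" by (rule dvdE)
    have b10: "b1 \<noteq> 0" using b1(1) ab(2) by auto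
    have z1: "z = Fract a1 b1" unfolding ab(3) using ab(2) b10 a1 b1(1)
      by (subst eq_fract) (simp_all add: mult_ac)
    obtain m where m: "m \<in> dual_monoid \<sigma>" "\<And>w. w \<in> rays \<Sigma> \<sigma> \<Longrightarrow> 0 < wt w m"
      by (rule positive_functional[OF fan \<sigma>]) blast
    obtain N1 where N1: "\<And>k. N1 \<le> k \<Longrightarrow> Poly_Mapping.keys (character (frag_cmul (int k) m) * a1) \<subseteq> dual_monoid \<sigma>"
      using clear_denominators[OF fan \<sigma> disjI1[OF m(2)], of a1] by blast
    obtain N2 where N2: "\<And>k. N2 \<le> k \<Longrightarrow> Poly_Mapping.keys (character (frag_cmul (int k) m) * b1) \<subseteq> dual_monoid \<sigma>"
      using clear_denominators[OF fan \<sigma> disjI1[OF m(2)], of b1] by blast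
    define k where "k = max N1 N2"
    define a' where "a' = character (frag_cmul (int k) m) * a1"
    define b' where "b' = character (frag_cmul (int k) m) * b1"
    have b'0: "b' \<noteq> 0" unfolding b'_def using b10 by simp
    have "padic p b' = 0" unfolding b'_def
      using integer_valuation.mult[OF integer_valuation_padic[OF p] character_nonzero b10]
        padic_character[OF p] padic_not_dvd[OF p b10 b1(2)] by simp
    then have vb: "torus_val p (embed b') = 0" using torus_val_embed[OF p b'0] by simp
    have "z = Fract a' b'" unfolding z1 using b10 b'0
      by (subst eq_fract) (simp_all add: a'_def b'_def mult_ac)
    then have "z = embed a' / embed b'" using embed_divide[OF b'0] by simp
    moreover have "embed a' \<in> chart \<sigma>" "embed b' \<in> chart \<sigma>"
      unfolding embed_in_span a'_def b'_def k_def by (intro N1 N2; simp)+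
    moreover have "embed b' \<noteq> 0" using b'0 by (simp add: embed_zero_iff)
    ultimately show "\<exists>a\<in>chart \<sigma>. \<exists>b\<in>chart \<sigma>. b \<noteq> 0 \<and> torus_val p b = 0 \<and> z = a / b"
      using vb by (intro bexI[of _ "embed a'"] bexI[of _ "embed b'"] conjI)
  qed
qed

text \<open>The ideal of the divisor in the chart of its ray is the centre of the ray
  valuation.\<close>

lemma ray_divisor_eq:
  fixes \<Sigma> :: "(real ^ 'n::{finite,linorder}) set set"
  assumes fan: "fan \<Sigma>" and v: "v \<in> primitive_generators \<Sigma>"
  shows "(ray_divisor v :: ('n, 'k::field) toric_field set) = ray_ring v"
proof -
  let ?\<rho> = "convex_cone hull {real_vec v}"
  interpret field_valuation "ray_val v :: ('n, 'k) toric_field \<Rightarrow> int" by (rule field_valuation_ray_val)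
  have \<rho>: "?\<rho> \<in> \<Sigma>" "v \<in> rays \<Sigma> ?\<rho>"
    using v rays_of_ray[OF v] unfolding primitive_generators_def by simp_all
  have dual: "m \<in> dual_monoid ?\<rho> \<longleftrightarrow> 0 \<le> wt v m" for m
    unfolding dual_monoid_rays[OF fan \<rho>(1)] rays_of_ray[OF v] by simp
  have "character_span {m. pairing m (real_vec v) > 0} = centre (chart ?\<rho>)"
  proof (rule subset_antisym; rule subsetI)
    fix z :: "('n, 'k) toric_field" assume "z \<in> character_span {m. pairing m (real_vec v) > 0}"
    then obtain f where f: "Poly_Mapping.keys f \<subseteq> {m. pairing m (real_vec v) > 0}" "z = embed f"
      unfolding mem_character_span by (elim exE conjE)
    have k: "0 < wt v m" if "m \<in> Poly_Mapping.keys f" for m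
      using subsetD[OF f(1) that] by (simp add: pairing_real_vec)
    have "Poly_Mapping.keys f \<subseteq> dual_monoid ?\<rho>" by (rule subsetI) (simp add: dual k less_imp_le)
    moreover have "f = 0 \<or> 0 < low (wt v) f" using k low_attained[of f "wt v"] by metis
    ultimately show "z \<in> centre (chart ?\<rho>)" unfolding f(2) centre_def mem_Collect_eq embed_in_span
      by (metis ray_val_embed embed_zero)
  next
    fix z :: "('n, 'k) toric_field" assume "z \<in> centre (chart ?\<rho>)"
    then have z: "z \<in> chart ?\<rho>" "z = 0 \<or> 0 < ray_val v z" unfolding centre_def by simp_all
    then obtain f where f: "Poly_Mapping.keys f \<subseteq> dual_monoid ?\<rho>" "z = embed f"
      unfolding mem_character_span by (elim exE conjE)
    have "0 < wt v m" if "m \<in> Poly_Mapping.keys f" for m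
    proof -
      have "f \<noteq> 0" using that by auto
      then have "0 < low (wt v) f" using z(2) unfolding f(2) by (simp add: embed_zero_iff ray_val_embed)
      then show ?thesis using low_le[OF that, of "wt v"] by simp
    qed
    then show "z \<in> character_span {m. pairing m (real_vec v) > 0}"
      unfolding f(2) embed_in_span by (intro subsetI) (simp add: pairing_real_vec)
  qed
  then show ?thesis unfolding ray_divisor_def using localization_ray[OF fan \<rho>, where ?'k = 'k] by simp
qed

lemma mem_points_toric:
  "x \<in> points (toric_variety \<Sigma>) \<longleftrightarrow> (\<exists>\<sigma>\<in>\<Sigma>. \<exists>p\<in>Spec (chart \<sigma>). x = localization (chart \<sigma>) p)"
  unfolding points_def toric_variety_def by (simp add: image_iff)

lemma ray_ring_prime_divisor:
  fixes \<Sigma> :: "(real ^ 'n::{finite,linorder}) set set"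
  assumes fan: "fan \<Sigma>" and \<sigma>: "\<sigma> \<in> \<Sigma>" and v: "v \<in> rays \<Sigma> \<sigma>"
  shows "(ray_ring v :: ('n, 'k::field) toric_field set) \<in> prime_divisors (toric_variety \<Sigma>)"
proof -
  have v': "real_vec v \<in> \<sigma>" "v \<in> primitive_generators \<Sigma>" using v unfolding rays_def by simp_all
  interpret discrete_valuation "ray_val v :: ('n, 'k) toric_field \<Rightarrow> int"
    by (rule discrete_valuation_ray_val[OF v'(2)])
  have "ray_ring v \<in> points (toric_variety \<Sigma> :: ('n, 'k) toric_field set set)"
    unfolding mem_points_toric
    by (rule bexI[OF _ \<sigma>], rule bexI[OF _ centre_in_Spec[OF ring_closed_chart chart_subset_ray_ring[OF v'(1)]]])
      (rule localization_ray[OF fan \<sigma> v, symmetric])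
  then show ?thesis unfolding prime_divisors_def using card_Spec_val_ring by simp
qed

lemma primitive_generator_ray:
  assumes "v \<in> primitive_generators \<Sigma>"
  shows "convex_cone hull {real_vec v} \<in> \<Sigma>" "v \<in> rays \<Sigma> (convex_cone hull {real_vec v})"
  using assms hull_inc[of "real_vec v" "{real_vec v}" convex_cone]
  unfolding primitive_generators_def rays_def by simp_all

lemma torus_prime_divisor:
  fixes \<Sigma> :: "(real ^ 'n::{finite,linorder}) set set" and p :: "('n, 'k::field) group_algebra"
  assumes fan: "fan \<Sigma>" and \<sigma>: "\<sigma> \<in> \<Sigma>" and p: "prime_elem p"
  shows "val_ring (torus_val p) \<in> prime_divisors (toric_variety \<Sigma>)"
proof -
  interpret discrete_valuation "torus_val p" by (rule discrete_valuation_torus_val[OF p])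
  have "val_ring (torus_val p) \<in> points (toric_variety \<Sigma>)"
    unfolding mem_points_toric
    by (rule bexI[OF _ \<sigma>], rule bexI[OF _ centre_in_Spec[OF ring_closed_chart chart_subset_torus_ring[OF p]]])
      (rule localization_torus[OF fan \<sigma> p, symmetric])
  then show ?thesis unfolding prime_divisors_def using card_Spec_val_ring by simp
qed

lemma sum_of_monomials:
  "f = (\<Sum>m\<in>Poly_Mapping.keys f. Poly_Mapping.single m (Poly_Mapping.lookup f m))"
proof (rule poly_mapping_eqI)
  fix k
  have "Poly_Mapping.lookup (\<Sum>m\<in>Poly_Mapping.keys f. Poly_Mapping.single m (Poly_Mapping.lookup f m)) k
    = (\<Sum>m\<in>Poly_Mapping.keys f. if m = k then Poly_Mapping.lookup f m else 0)"
    unfolding lookup_sum lookup_single when_def by (rule refl)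
  also have "\<dots> = Poly_Mapping.lookup f k" by (simp add: in_keys_iff)
  finally show "Poly_Mapping.lookup f k =
    Poly_Mapping.lookup (\<Sum>m\<in>Poly_Mapping.keys f. Poly_Mapping.single m (Poly_Mapping.lookup f m)) k" by (rule sym)
qed

lemma scalar_in_chart: "embed (Poly_Mapping.single 0 c) \<in> chart \<sigma>"
  unfolding embed_in_span using dual_monoid_zero by (cases "c = 0") simp_all

lemma embed_in_prime_of_characters:
  fixes f :: "('n::{finite,linorder}, 'k::field) group_algebra"
  assumes p: "p \<in> Spec (chart \<sigma>)" and f: "\<And>m. m \<in> Poly_Mapping.keys f \<Longrightarrow> chr m \<in> p"
  shows "embed f \<in> p"
proof -
  note Sp = SpecD[OF ring_closed_chart p]
  have mono: "embed (Poly_Mapping.single m c) \<in> p" if "chr m \<in> p" for m c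
  proof -
    have "embed (Poly_Mapping.single 0 c) * chr m \<in> p" by (rule Sp(5)[OF scalar_in_chart that])
    then show ?thesis unfolding embed_mult by (simp add: mult_single)
  qed
  have "embed (\<Sum>m\<in>K. Poly_Mapping.single m (Poly_Mapping.lookup f m)) \<in> p"
    if "finite K" "K \<subseteq> Poly_Mapping.keys f" for K
    using that
  proof (induction K rule: finite_induct)
    case empty
    then show ?case using Sp(2) by (simp add: embed_zero)
  next
    case (insert m K)
    have "embed (Poly_Mapping.single m (Poly_Mapping.lookup f m)) +
      embed (\<Sum>m\<in>K. Poly_Mapping.single m (Poly_Mapping.lookup f m)) \<in> p"
      by (rule Sp(4)[OF mono[OF f] insert.IH]) (use insert.prems in simp_all)
    then show ?case unfolding embed_add using insert.hyps by simp
  qed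
  from this[OF finite_keys subset_refl] show ?thesis unfolding sum_of_monomials[symmetric] .
qed

lemma chr_power:
  "(chr m :: ('n::{finite,linorder}, 'k::field) toric_field) ^ N = chr (frag_cmul (int N) m)"
proof (induction N)
  case 0
  then show ?case using embed_one by simp
next
  case (Suc N)
  have "(chr m :: ('n, 'k) toric_field) ^ Suc N = chr (m + frag_cmul (int N) m)"
    unfolding power_Suc Suc.IH embed_mult character_mult by (rule refl)
  also have "m + frag_cmul (int N) m = frag_cmul (int (Suc N)) m"
    by (rule poly_mapping_eqI) (simp add: lookup_add algebra_simps)
  finally show ?case .
qed

lemma chr_sum: "finite I \<Longrightarrow> (\<Prod>i\<in>I. chr (m i)) = chr (\<Sum>i\<in>I. m i)"
proof (induction I rule: finite_induct)
  case empty
  then show ?case using embed_one by simp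
next
  case (insert i I)
  then show ?case by (simp add: character_mult)
qed

text \<open>A prime containing a character contains the centre of a ray valuation. Otherwise, there
  would be characters outside of the prime that are positive on the single rays; their product is
  positive on all rays, so that a power of it is divisible by the given character.\<close>

lemma prime_with_character:
  fixes \<Sigma> :: "(real ^ 'n::{finite,linorder}) set set" and p :: "('n, 'k::field) toric_field set"
  assumes fan: "fan \<Sigma>" and \<sigma>: "\<sigma> \<in> \<Sigma>" and p: "p \<in> Spec (chart \<sigma>)"
    and m0: "m0 \<in> dual_monoid \<sigma>" "chr m0 \<in> p"
  shows "\<exists>v\<in>rays \<Sigma> \<sigma>. field_valuation.centre (ray_val v) (chart \<sigma>) \<subseteq> p"
proof (rule ccontr)
  assume neg: "\<not> (\<exists>v\<in>rays \<Sigma> \<sigma>. field_valuation.centre (ray_val v) (chart \<sigma>) \<subseteq> p)"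
  note Sp = SpecD[OF ring_closed_chart p]
  have "\<exists>m. m \<in> dual_monoid \<sigma> \<and> 0 < wt v m \<and> chr m \<notin> p" if v: "v \<in> rays \<Sigma> \<sigma>" for v
  proof -
    have "\<not> field_valuation.centre (ray_val v) (chart \<sigma>) \<subseteq> p" using neg v by simp
    then obtain z where z: "z \<in> field_valuation.centre (ray_val v) (chart \<sigma>)" "z \<notin> p" by (auto simp only: subset_iff)
    then have zc: "z \<in> chart \<sigma>" "z = 0 \<or> 0 < ray_val v z"
      unfolding field_valuation.centre_def[OF field_valuation_ray_val] by simp_all
    then obtain f where f: "Poly_Mapping.keys f \<subseteq> dual_monoid \<sigma>" "z = embed f"
      unfolding mem_character_span by (elim exE conjE)
    have "\<exists>m\<in>Poly_Mapping.keys f. chr m \<notin> p"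
      using embed_in_prime_of_characters[OF p, of f] z(2) unfolding f(2) by (rule_tac ccontr) simp
    then obtain m where m: "m \<in> Poly_Mapping.keys f" "chr m \<notin> p" by (rule bexE)
    have f0: "f \<noteq> 0" using m(1) by auto
    have "0 < low (wt v) f" using zc(2) unfolding f(2) by (simp add: embed_zero_iff f0 ray_val_embed)
    then have "0 < wt v m" using low_le[OF m(1), of "wt v"] by simp
    then show ?thesis using m f(1) by (intro exI[of _ m] conjI) (rule subsetD)
  qed
  then obtain g where g: "\<And>v. v \<in> rays \<Sigma> \<sigma> \<Longrightarrow> g v \<in> dual_monoid \<sigma> \<and> 0 < wt v (g v) \<and> chr (g v) \<notin> p" by metis
  define M where "M = (\<Sum>v\<in>rays \<Sigma> \<sigma>. g v)"
  note fin = finite_rays[OF fan, of \<sigma>]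
  have "(\<Prod>v\<in>rays \<Sigma> \<sigma>. chr (g v) :: ('n, 'k) toric_field) \<in> chart \<sigma> \<and> (\<Prod>v\<in>rays \<Sigma> \<sigma>. chr (g v)) \<notin> p"
    by (rule Spec_prod[OF ring_closed_chart p fin]) (use g chr_in_chart in blast)+
  then have M: "(chr M :: ('n, 'k) toric_field) \<in> chart \<sigma>" "chr M \<notin> p" unfolding chr_sum[OF fin] M_def by simp_all
  have Mpos: "1 \<le> wt v M" if v: "v \<in> rays \<Sigma> \<sigma>" for v
  proof -
    have "0 \<le> wt v (g u)" if "u \<in> rays \<Sigma> \<sigma>" for u
      using g[OF that] v unfolding dual_monoid_rays[OF fan \<sigma>] by simp
    then have "0 < (\<Sum>u\<in>rays \<Sigma> \<sigma>. wt v (g u))" using g[OF v] v by (intro sum_pos2[OF fin, of v]) simp_all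
    then show ?thesis unfolding M_def wt_sum by simp
  qed
  define N where "N = nat (\<Sum>v\<in>rays \<Sigma> \<sigma>. \<bar>wt v m0\<bar>)"
  have "frag_cmul (int N) M - m0 \<in> dual_monoid \<sigma>" unfolding dual_monoid_rays[OF fan \<sigma>]
  proof
    fix v assume v: "v \<in> rays \<Sigma> \<sigma>"
    have "\<bar>wt v m0\<bar> \<le> (\<Sum>v\<in>rays \<Sigma> \<sigma>. \<bar>wt v m0\<bar>)" using v fin by (intro member_le_sum) simp_all
    then have "\<bar>wt v m0\<bar> \<le> int N" unfolding N_def by simp
    moreover have "int N * 1 \<le> int N * wt v M" using Mpos[OF v] by (intro mult_left_mono) simp_all
    ultimately show "0 \<le> wt v (frag_cmul (int N) M - m0)"
      unfolding diff_conv_add_uminus wt_add wt_minus wt_cmul by linarith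
  qed
  then have "chr (frag_cmul (int N) M - m0) * chr m0 \<in> p" by (intro Sp(5) chr_in_chart m0(2))
  then have "chr M ^ N \<in> p" unfolding embed_mult character_mult chr_power by simp
  then show False using Spec_power[OF ring_closed_chart p M(1)] M(2) by simp
qed

lemma clear_in_dual:
  fixes \<Sigma> :: "(real ^ 'n::{finite,linorder}) set set"
  assumes fan: "fan \<Sigma>" and \<sigma>: "\<sigma> \<in> \<Sigma>"
  obtains m where "m \<in> dual_monoid \<sigma>"
    "\<And>f :: ('n, 'k::field) group_algebra. \<exists>N. \<forall>k\<ge>N. Poly_Mapping.keys (character (frag_cmul (int k) m) * f) \<subseteq> dual_monoid \<sigma>"
    "\<And>k. frag_cmul (int k) m \<in> dual_monoid \<sigma>"
proof -
  obtain m where m: "m \<in> dual_monoid \<sigma>" "\<And>w. w \<in> rays \<Sigma> \<sigma> \<Longrightarrow> 0 < wt w m"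
    by (rule positive_functional[OF fan \<sigma>]) blast
  have "frag_cmul (int k) m \<in> dual_monoid \<sigma>" for k
    unfolding dual_monoid_rays[OF fan \<sigma>] wt_cmul using m(2) by (simp add: less_imp_le)
  then show ?thesis using that m(1) clear_denominators[OF fan \<sigma> disjI1[OF m(2)]] by blast
qed

text \<open>A Laurent polynomial in the prime is factored in the group algebra. Characters of the
  chart are outside of the prime, so that each factor may be shifted into the chart, and one of the
  shifted prime factors lies in the prime.\<close>

lemma prime_without_character:
  fixes \<Sigma> :: "(real ^ 'n::{finite,linorder}) set set" and p :: "('n, 'k::field) toric_field set"
  assumes fan: "fan \<Sigma>" and \<sigma>: "\<sigma> \<in> \<Sigma>" and p: "p \<in> Spec (chart \<sigma>)" and pz: "p \<noteq> {0}"
    and no: "\<And>m. m \<in> dual_monoid \<sigma> \<Longrightarrow> chr m \<notin> p"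
  shows "\<exists>q. prime_elem q \<and> field_valuation.centre (torus_val q) (chart \<sigma>) \<subseteq> p"
proof -
  note Sp = SpecD[OF ring_closed_chart p]
  obtain m where m: "m \<in> dual_monoid \<sigma>"
    and clear: "\<And>f :: ('n, 'k) group_algebra. \<exists>N. \<forall>k\<ge>N. Poly_Mapping.keys (character (frag_cmul (int k) m) * f) \<subseteq> dual_monoid \<sigma>"
    and md: "\<And>k. frag_cmul (int k) m \<in> dual_monoid \<sigma>" by (rule clear_in_dual[OF fan \<sigma>, where ?'k = 'k]) blast
  have main: "\<exists>q. prime_elem q \<and> field_valuation.centre (torus_val q) (chart \<sigma>) \<subseteq> p"
    if "f \<noteq> 0" "embed (character n * f) \<in> p" for f n
    using that
  proof (induction arbitrary: n rule: group_algebra_factorial_induct)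
    case (unit u)
    obtain a c where ac: "c \<noteq> 0" "u = Poly_Mapping.single a c" using unit_is_monomial[OF unit(1)] by (elim exE conjE)
    have in_p: "embed (Poly_Mapping.single (n + a) c) \<in> p" using unit(2) unfolding ac(2) mult_single by simp
    then have "embed (Poly_Mapping.single (n + a) c) \<in> chart \<sigma>" using Sp(1) by (rule_tac subsetD)
    then have dual: "n + a \<in> dual_monoid \<sigma>" unfolding embed_in_span using ac(1) by simp
    have "embed (Poly_Mapping.single 0 (inverse c)) * embed (Poly_Mapping.single (n + a) c) \<in> p"
      by (rule Sp(5)[OF scalar_in_chart in_p])
    then have "chr (n + a) \<in> p" unfolding embed_mult mult_single using ac(1) by simp
    then show ?case using no[OF dual] by simp
  next
    case (prime q f)
    obtain k where k: "Poly_Mapping.keys (character (frag_cmul (int k) m) * q) \<subseteq> dual_monoid \<sigma>"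
      using clear[of q] by (meson order_refl)
    let ?k = "frag_cmul (int k) m"
    obtain l1 where l1: "\<And>l. l1 \<le> l \<Longrightarrow> Poly_Mapping.keys (character (frag_cmul (int l) m) * f) \<subseteq> dual_monoid \<sigma>"
      using clear[of f] by (elim exE) blast
    define c where "c = (character (?k - n) :: ('n, 'k) group_algebra)"
    obtain l2 where l2: "\<And>l. l2 \<le> l \<Longrightarrow>
        Poly_Mapping.keys (character (frag_cmul (int l) m) * c) \<subseteq> dual_monoid \<sigma>"
      using clear[of c] by (elim exE) blast
    define l where "l = frag_cmul (int (max l1 l2)) m"
    have lf: "embed (character l * f) \<in> chart \<sigma>" unfolding embed_in_span l_def by (rule l1) simp
    have lk: "embed (character l * c) \<in> chart \<sigma>" unfolding embed_in_span l_def by (rule l2) simp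
    have kq: "embed (character ?k * q) \<in> chart \<sigma>" unfolding embed_in_span by (rule k)
    have hc: "c * character n = character ?k" unfolding c_def character_mult by simp
    have "character l * c * (character n * (q * f)) = (c * character n) * q * (character l * f)"
      by (simp only: mult_ac)
    then have "embed (character l * c) * embed (character n * (q * f)) =
      embed (character ?k * q) * embed (character l * f)" by (simp only: embed_mult hc)
    then have "embed (character ?k * q) * embed (character l * f) \<in> p"
      using Sp(5)[OF lk prime(4)] by (simp only:)
    from Sp(7)[OF kq lf this]
    consider "embed (character ?k * q) \<in> p" | "embed (character l * f) \<in> p" by blast
    then show ?case
    proof cases
      case 1
      interpret discrete_valuation "torus_val q" by (rule discrete_valuation_torus_val[OF prime(1)])
      have "centre (chart \<sigma>) \<subseteq> p"
      proof
        fix z assume "z \<in> centre (chart \<sigma>)"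
        then have z: "z \<in> chart \<sigma>" "z = 0 \<or> 0 < torus_val q z" unfolding centre_def by simp_all
        then obtain g where g: "z = embed g" unfolding mem_character_span by (elim exE conjE)
        show "z \<in> p"
        proof (cases "g = 0")
          case True
          then show ?thesis unfolding g using Sp(2) by (simp add: embed_zero)
        next
          case False
          then have "0 < padic q g" using z(2) unfolding g by (simp add: embed_zero_iff torus_val_embed[OF prime(1)])
          then have "q dvd g" using padic_pos_iff[OF prime(1) False] by simp
          then obtain h where h: "g = q * h" by (rule dvdE)
          obtain j where j: "Poly_Mapping.keys (character (frag_cmul (int j) m) * h) \<subseteq> dual_monoid \<sigma>"
            using clear[of h] by (meson order_refl)
          let ?j = "frag_cmul (int j) m"
          have "embed (character ?j * h) * embed (character ?k * q) \<in> p"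
            by (rule Sp(5)[OF _ 1]) (simp only: embed_in_span j)
          then have "chr (?j + ?k) * z \<in> p"
            unfolding g h embed_mult character_mult[symmetric] by (simp only: mult_ac)
          moreover have jk: "?j + ?k \<in> dual_monoid \<sigma>" by (rule dual_monoid_add[OF md md])
          ultimately show ?thesis using Sp(7)[OF chr_in_chart[OF jk] z(1)] no[OF jk] by simp
        qed
      qed
      then show ?thesis using prime(1) by (intro exI[of _ q] conjI)
    next
      case 2
      then show ?thesis by (rule prime(3))
    qed
  qed
  obtain z where z: "z \<in> p" "z \<noteq> 0" using pz Sp(2) by (metis insertI1 subsetI subset_singletonD singletonD equals0D)
  then obtain f where f: "z = embed f" using Sp(1) unfolding mem_character_span subset_iff by metis
  have "f \<noteq> 0" using z(2) f embed_zero by auto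
  moreover have "embed (character 0 * f) \<in> p" using z(1) f by simp
  ultimately show ?thesis by (rule main)
qed

text \<open>The prime \<open>p\<close> of a chart that defines \<open>P\<close> contains the
  centre of a ray valuation if it contains a character, and of the valuation of a prime element
  otherwise. As \<open>p\<close> has height one, it equals this centre, and then its local ring is
  the valuation ring.\<close>

theorem prime_divisors_toric:
  fixes \<Sigma> :: "(real ^ 'n::{finite,linorder}) set set"
  assumes fan: "fan \<Sigma>" and P: "P \<in> prime_divisors (toric_variety \<Sigma> :: ('n, 'k::field) toric_field set set)"
  shows "(\<exists>v\<in>primitive_generators \<Sigma>. P = ray_ring v) \<or> (\<exists>q. prime_elem q \<and> P = val_ring (torus_val q))"
proof -
  have P': "P \<in> points (toric_variety \<Sigma>)" "card (Spec P) = 2" using P unfolding prime_divisors_def by simp_all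
  then obtain \<sigma> p where \<sigma>: "\<sigma> \<in> \<Sigma>" and p: "p \<in> Spec (chart \<sigma>)" and loc: "P = localization (chart \<sigma>) p"
    unfolding mem_points_toric by (elim bexE)
  note card = P'(2)[unfolded loc]
  note A = ring_closed_chart
  show ?thesis
  proof (cases "\<exists>m\<in>dual_monoid \<sigma>. chr m \<in> p")
    case True
    then obtain m0 where "m0 \<in> dual_monoid \<sigma>" "chr m0 \<in> p" by (rule bexE)
    from prime_with_character[OF fan \<sigma> p this]
    obtain v where v: "v \<in> rays \<Sigma> \<sigma>" "field_valuation.centre (ray_val v) (chart \<sigma>) \<subseteq> p" by (rule bexE)
    have v': "real_vec v \<in> \<sigma>" "v \<in> primitive_generators \<Sigma>" using v(1) unfolding rays_def by simp_all
    interpret discrete_valuation "ray_val v :: ('n, 'k) toric_field \<Rightarrow> int"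
      by (rule discrete_valuation_ray_val[OF v'(2)])
    obtain m where m: "m \<in> dual_monoid \<sigma>" "\<And>w. w \<in> rays \<Sigma> \<sigma> \<Longrightarrow> 0 < wt w m"
      by (rule positive_functional[OF fan \<sigma>]) blast
    have "chr m \<in> centre (chart \<sigma>)"
      unfolding centre_def using chr_in_chart[OF m(1)] m(2)[OF v(1)] by (simp add: ray_val_chr)
    then have "centre (chart \<sigma>) \<noteq> {0}" using chr_nonzero[of m] by (metis singletonD)
    from height_one_prime_minimal[OF A p card centre_in_Spec[OF A chart_subset_ray_ring[OF v'(1)]] v(2) this]
    have "P = ray_ring v" unfolding loc using localization_ray[OF fan \<sigma> v(1), where ?'k = 'k] by simp
    then show ?thesis using v'(2) by (intro disjI1) (rule bexI)
  next
    case False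
    then have no: "chr m \<notin> p" if "m \<in> dual_monoid \<sigma>" for m using that by simp
    have "\<exists>q. prime_elem q \<and> field_valuation.centre (torus_val q) (chart \<sigma>) \<subseteq> p"
      by (rule prime_without_character[OF fan \<sigma> p height_one_prime_nonzero[OF A p card]]) (rule no)
    then obtain q where q: "prime_elem q" "field_valuation.centre (torus_val q) (chart \<sigma>) \<subseteq> p" by (elim exE conjE)
    interpret discrete_valuation "torus_val q" by (rule discrete_valuation_torus_val[OF q(1)])
    obtain m where m: "m \<in> dual_monoid \<sigma>"
      and clear: "\<And>f :: ('n, 'k) group_algebra. \<exists>N. \<forall>k\<ge>N. Poly_Mapping.keys (character (frag_cmul (int k) m) * f) \<subseteq> dual_monoid \<sigma>"
      by (rule clear_in_dual[OF fan \<sigma>, where ?'k = 'k]) blast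
    obtain k where k: "Poly_Mapping.keys (character (frag_cmul (int k) m) * q) \<subseteq> dual_monoid \<sigma>"
      using clear[of q] by (meson order_refl)
    have q0: "character (frag_cmul (int k) m) * q \<noteq> 0" using prime_nonzero[OF q(1)] by simp
    have "padic q (character (frag_cmul (int k) m) * q) = 1"
      using integer_valuation.mult[OF integer_valuation_padic[OF q(1)] character_nonzero prime_nonzero[OF q(1)]]
        padic_character[OF q(1)] padic_self[OF q(1)] by simp
    then have "embed (character (frag_cmul (int k) m) * q) \<in> centre (chart \<sigma>)"
      unfolding centre_def mem_Collect_eq embed_in_span using k torus_val_embed[OF q(1) q0] by simp
    then have "centre (chart \<sigma>) \<noteq> {0}" using q0 embed_zero_iff by (metis singletonD)
    from height_one_prime_minimal[OF A p card centre_in_Spec[OF A chart_subset_torus_ring[OF q(1)]] q(2) this]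
    have "P = val_ring (torus_val q)" unfolding loc using localization_torus[OF fan \<sigma> q(1)] by simp
    then show ?thesis using q(1) by (intro disjI2 exI conjI)
  qed
qed

lemma ord_at_ray_ring:
  fixes f :: "('n::{finite,linorder}, 'k::field) toric_field"
  shows "v \<in> primitive_generators \<Sigma> \<Longrightarrow> f \<noteq> 0 \<Longrightarrow> ord_at (ray_ring v) f = ray_val v f"
  by (rule discrete_valuation.ord_at_val_ring[OF discrete_valuation_ray_val])

lemma ord_at_torus: "prime_elem q \<Longrightarrow> f \<noteq> 0 \<Longrightarrow> ord_at (val_ring (torus_val q)) f = torus_val q f"
  by (rule discrete_valuation.ord_at_val_ring[OF discrete_valuation_torus_val])

lemma prime_divisor_valuation:
  fixes \<Sigma> :: "(real ^ 'n::{finite,linorder}) set set"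
  assumes "fan \<Sigma>" "P \<in> prime_divisors (toric_variety \<Sigma> :: ('n, 'k::field) toric_field set set)"
  obtains \<nu> where "discrete_valuation \<nu>" "P = val_ring \<nu>" "\<And>f. f \<noteq> 0 \<Longrightarrow> ord_at P f = \<nu> f"
proof -
  consider v where "v \<in> primitive_generators \<Sigma>" "P = ray_ring v" | q where "prime_elem q" "P = val_ring (torus_val q)"
    using prime_divisors_toric[OF assms] by (elim disjE bexE exE conjE)
  then show ?thesis
  proof cases
    case 1
    show ?thesis by (rule that[OF discrete_valuation_ray_val[OF 1(1)] 1(2)]) (simp add: 1(2) ord_at_ray_ring[OF 1(1)])
  next
    case 2
    show ?thesis by (rule that[OF discrete_valuation_torus_val[OF 2(1)] 2(2)]) (simp add: 2(2) ord_at_torus[OF 2(1)])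
  qed
qed

section \<open>The class group\<close>

lemma ord_at_mult:
  fixes \<Sigma> :: "(real ^ 'n::{finite,linorder}) set set" and f :: "('n, 'k::field) toric_field"
  assumes "fan \<Sigma>" "P \<in> prime_divisors (toric_variety \<Sigma>)" "f \<noteq> 0" "g \<noteq> 0"
  shows "ord_at P (f * g) = ord_at P f + ord_at P g" "ord_at P (inverse f) = - ord_at P f" "ord_at P (1 :: ('n, 'k) toric_field) = 0"
proof -
  obtain \<nu> where \<nu>: "discrete_valuation \<nu>" "P = val_ring \<nu>" "\<And>f. f \<noteq> 0 \<Longrightarrow> ord_at P f = \<nu> f"
    by (rule prime_divisor_valuation[OF assms(1,2)]) blast
  interpret discrete_valuation \<nu> by (rule \<nu>(1))
  show "ord_at P (f * g) = ord_at P f + ord_at P g" using \<nu>(3) assms(3,4) mult by simp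
  show "ord_at P (inverse f) = - ord_at P f" using \<nu>(3)[of f] \<nu>(3)[of "inverse f"] assms(3) inverse by simp
  show "ord_at P (1 :: ('n, 'k) toric_field) = 0" using \<nu>(3)[of 1] by simp
qed

text \<open>Zeros and poles lie on the finitely many invariant divisors or on the zero set of a
  prime factor of the numerator or denominator.\<close>

lemma finite_divisor_support:
  fixes \<Sigma> :: "(real ^ 'n::{finite,linorder}) set set" and f :: "('n, 'k::field) toric_field"
  assumes fan: "fan \<Sigma>" and f: "f \<noteq> 0"
  shows "finite {P \<in> prime_divisors (toric_variety \<Sigma>). ord_at P f \<noteq> 0}"
proof -
  obtain a b where ab: "a \<noteq> 0" "b \<noteq> 0" "f = Fract a b" using f by (rule nonzero_fract_cases)
  let ?R = "\<lambda>p. val_ring (torus_val p)"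
  have "{P \<in> prime_divisors (toric_variety \<Sigma>). ord_at P f \<noteq> 0} \<subseteq>
    ray_ring ` primitive_generators \<Sigma> \<union> (?R ` {p. prime_elem p \<and> p dvd a} \<union> ?R ` {p. prime_elem p \<and> p dvd b})"
  proof
    fix P assume "P \<in> {P \<in> prime_divisors (toric_variety \<Sigma>). ord_at P f \<noteq> 0}"
    then have P: "P \<in> prime_divisors (toric_variety \<Sigma>)" "ord_at P f \<noteq> 0" by simp_all
    consider v where "v \<in> primitive_generators \<Sigma>" "P = ray_ring v" | q where "prime_elem q" "P = ?R q"
      using prime_divisors_toric[OF fan P(1)] by (elim disjE bexE exE conjE)
    then show "P \<in> ray_ring ` primitive_generators \<Sigma> \<union> (?R ` {p. prime_elem p \<and> p dvd a} \<union> ?R ` {p. prime_elem p \<and> p dvd b})"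
    proof cases
      case 1
      then show ?thesis by simp
    next
      case 2
      have "torus_val q f \<noteq> 0" using P(2) unfolding 2(2) ord_at_torus[OF 2(1) f] .
      then have "padic q a \<noteq> padic q b" using torus_val_Fract[OF 2(1) ab(1,2)] ab(3) by simp
      then have "q dvd a \<or> q dvd b"
        using padic_not_dvd[OF 2(1) ab(1)] padic_not_dvd[OF 2(1) ab(2)] by (cases "q dvd a"; cases "q dvd b") simp_all
      then have "q \<in> {p. prime_elem p \<and> p dvd a} \<or> q \<in> {p. prime_elem p \<and> p dvd b}" using 2(1) by simp
      then show ?thesis unfolding 2(2) by (elim disjE) (intro UnI2 UnI1 imageI; assumption)+
    qed
  qed
  moreover have "finite (ray_ring ` primitive_generators \<Sigma> \<union> (?R ` {p. prime_elem p \<and> p dvd a} \<union> ?R ` {p. prime_elem p \<and> p dvd b}))"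
    by (intro finite_UnI finite_imageI finite_primitive_generators fan finite_prime_val_rings ab)
  ultimately show ?thesis by (rule finite_subset)
qed

lemma Weil_comm_group: "comm_group (Weil_divisors \<XX>)"
  by (rule abelian_free_Abelian_group)

lemma principal_subgroup:
  fixes \<Sigma> :: "(real ^ 'n::{finite,linorder}) set set"
  assumes fan: "fan \<Sigma>"
  shows "subgroup (principal_divisors (toric_variety \<Sigma> :: ('n, 'k::field) toric_field set set)) (Weil_divisors (toric_variety \<Sigma>))"
proof (rule subgroup.intro)
  let ?X = "toric_variety \<Sigma> :: ('n, 'k) toric_field set set"
  show "principal_divisors ?X \<subseteq> carrier (Weil_divisors ?X)" unfolding principal_divisors_def by (rule Collect_restrict)
  show "\<one>\<^bsub>Weil_divisors ?X\<^esub> \<in> principal_divisors ?X"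
    unfolding principal_divisors_def using ord_at_mult(3)[OF fan _ one_neq_zero one_neq_zero, where ?'k = 'k]
    by (intro CollectI conjI exI[of _ 1]) simp_all
next
  let ?X = "toric_variety \<Sigma> :: ('n, 'k) toric_field set set"
  fix D E assume "D \<in> principal_divisors ?X" "E \<in> principal_divisors ?X"
  then obtain f g where D: "D \<in> carrier (Weil_divisors ?X)" "f \<noteq> 0" "\<And>P. P \<in> prime_divisors ?X \<Longrightarrow> Poly_Mapping.lookup D P = ord_at P f"
    and E: "E \<in> carrier (Weil_divisors ?X)" "g \<noteq> 0" "\<And>P. P \<in> prime_divisors ?X \<Longrightarrow> Poly_Mapping.lookup E P = ord_at P g"
    unfolding principal_divisors_def by blast
  have "D + E \<in> carrier (Weil_divisors ?X)"
    using subset_trans[OF keys_add Un_least, of D "prime_divisors ?X" E] D(1) E(1) by simp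
  moreover have "f * g \<noteq> 0" using D(2) E(2) by simp
  moreover have "Poly_Mapping.lookup (D + E) P = ord_at P (f * g)" if "P \<in> prime_divisors ?X" for P
    using D(3)[OF that] E(3)[OF that] ord_at_mult(1)[OF fan that D(2) E(2)] by (simp add: lookup_add)
  ultimately show "D \<otimes>\<^bsub>Weil_divisors ?X\<^esub> E \<in> principal_divisors ?X"
    unfolding principal_divisors_def mult_free_Abelian_group by blast
next
  let ?X = "toric_variety \<Sigma> :: ('n, 'k) toric_field set set"
  fix D assume "D \<in> principal_divisors ?X"
  then obtain f where D: "D \<in> carrier (Weil_divisors ?X)" "f \<noteq> 0" "\<And>P. P \<in> prime_divisors ?X \<Longrightarrow> Poly_Mapping.lookup D P = ord_at P f"
    unfolding principal_divisors_def by blast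
  have k: "Poly_Mapping.keys D \<subseteq> prime_divisors ?X" using D(1) by simp
  have "- D \<in> carrier (Weil_divisors ?X)" using k by simp
  moreover have "inverse f \<noteq> 0" using D(2) by simp
  moreover have "Poly_Mapping.lookup (- D) P = ord_at P (inverse f)" if "P \<in> prime_divisors ?X" for P
    using D(3)[OF that] ord_at_mult(2)[OF fan that D(2) D(2)] by simp
  ultimately show "inv\<^bsub>Weil_divisors ?X\<^esub> D \<in> principal_divisors ?X"
    unfolding principal_divisors_def inv_free_Abelian_group[OF k] by blast
qed

lemma principal_normal:
  fixes \<Sigma> :: "(real ^ 'n::{finite,linorder}) set set"
  assumes fan: "fan \<Sigma>"
  shows "normal (principal_divisors (toric_variety \<Sigma> :: ('n, 'k::field) toric_field set set)) (Weil_divisors (toric_variety \<Sigma>))"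
  by (rule comm_group.normal_iff_subgroup[THEN iffD2, OF Weil_comm_group principal_subgroup[OF fan]])

lemma group_Cl:
  fixes \<Sigma> :: "(real ^ 'n::{finite,linorder}) set set"
  assumes fan: "fan \<Sigma>" shows "group (Cl (toric_variety \<Sigma> :: ('n, 'k::field) toric_field set set))"
  unfolding Cl_def by (rule normal.factorgroup_is_group[OF principal_normal[OF fan]])

lemma divisor_class_in_Cl: "D \<in> carrier (Weil_divisors \<XX>) \<Longrightarrow> divisor_class \<XX> D \<in> carrier (Cl \<XX>)"
  unfolding divisor_class_def Cl_def FactGroup_def RCOSETS_def by auto

lemma divisor_class_add:
  fixes \<Sigma> :: "(real ^ 'n::{finite,linorder}) set set"
  assumes fan: "fan \<Sigma>" and "\<XX> = (toric_variety \<Sigma> :: ('n, 'k::field) toric_field set set)"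
    and D: "D \<in> carrier (Weil_divisors \<XX>)" "E \<in> carrier (Weil_divisors \<XX>)"
  shows "divisor_class \<XX> (D + E) = divisor_class \<XX> D \<otimes>\<^bsub>Cl \<XX>\<^esub> divisor_class \<XX> E"
  using normal.rcos_sum[OF principal_normal[OF fan, where ?'k = 'k]] D unfolding divisor_class_def Cl_def FactGroup_def assms(2) by simp

lemma divisor_class_eq_iff:
  fixes \<Sigma> :: "(real ^ 'n::{finite,linorder}) set set"
  assumes fan: "fan \<Sigma>" and X: "\<XX> = (toric_variety \<Sigma> :: ('n, 'k::field) toric_field set set)"
    and D: "D \<in> carrier (Weil_divisors \<XX>)" "E \<in> carrier (Weil_divisors \<XX>)"
  shows "divisor_class \<XX> D = divisor_class \<XX> E \<longleftrightarrow> D - E \<in> principal_divisors \<XX>"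
proof -
  let ?W = "Weil_divisors \<XX>"
  interpret W: comm_group ?W by (rule Weil_comm_group)
  have sub: "subgroup (principal_divisors \<XX>) ?W" unfolding X by (rule principal_subgroup[OF fan])
  have mem: "D \<in> principal_divisors \<XX> #>\<^bsub>?W\<^esub> E \<longleftrightarrow> D - E \<in> principal_divisors \<XX>"
  proof
    assume "D \<in> principal_divisors \<XX> #>\<^bsub>?W\<^esub> E"
    then obtain h where "h \<in> principal_divisors \<XX>" "D = h + E" unfolding r_coset_def by auto
    then show "D - E \<in> principal_divisors \<XX>" by simp
  next
    assume "D - E \<in> principal_divisors \<XX>"
    then show "D \<in> principal_divisors \<XX> #>\<^bsub>?W\<^esub> E" unfolding r_coset_def
      by (intro UN_I[of "D - E"]) simp_all
  qed
  show ?thesis unfolding divisor_class_def mem[symmetric]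
    using W.rcos_self[OF D(1) sub] W.repr_independence[OF _ D(2) sub, of D] by metis
qed

lemma ray_ring_inject:
  fixes \<Sigma> :: "(real ^ 'n::{finite,linorder}) set set"
  assumes fan: "fan \<Sigma>" and v: "v \<in> primitive_generators \<Sigma>" and w: "w \<in> primitive_generators \<Sigma>"
    and eq: "(ray_ring v :: ('n, 'k::field) toric_field set) = ray_ring w"
  shows "w = v"
proof -
  have chr: "(chr m :: ('n, 'k) toric_field) \<in> ray_ring u \<longleftrightarrow> 0 \<le> wt u m" for u m
    unfolding val_ring_def by (simp add: ray_val_chr)
  note \<rho> = primitive_generator_ray[OF v]
  have "real_vec w \<in> convex_cone hull {real_vec v}"
  proof (rule in_cone_of_dual_nonneg[OF fan \<rho>(1)])
    fix m assume "m \<in> dual_monoid (convex_cone hull {real_vec v})"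
    then have "0 \<le> wt v m" using \<rho>(2) unfolding dual_monoid_rays[OF fan \<rho>(1)] by (rule bspec)
    then show "0 \<le> wt w m" unfolding chr[symmetric] eq .
  qed
  then show ?thesis by (rule primitive_generators_unique[OF v w])
qed

lemma ray_ring_not_torus:
  assumes v: "v \<in> primitive_generators \<Sigma>" and q: "prime_elem (q :: ('n::{finite,linorder}, 'k::field) group_algebra)"
  shows "ray_ring v \<noteq> val_ring (torus_val q)"
proof
  assume eq: "ray_ring v = val_ring (torus_val q)"
  have "Gcd (range (vec_nth v)) = 1" using v unfolding primitive_generators_def by simp
  then obtain m where m: "wt v m = 1" by (rule primitive_functional)
  have "(chr (- m) :: ('n, 'k) toric_field) \<in> val_ring (torus_val q)"
    unfolding val_ring_def using torus_val_chr[OF q] by simp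
  then have "(chr (- m) :: ('n, 'k) toric_field) \<in> ray_ring v" unfolding eq .
  then have "0 \<le> wt v (- m)" unfolding val_ring_def by (simp add: ray_val_chr)
  then show False unfolding wt_minus m by simp
qed

lemma torus_ring_eq_iff:
  fixes p q :: "('n::{finite,linorder}, 'k::field) group_algebra"
  assumes p: "prime_elem p" and q: "prime_elem q"
  shows "val_ring (torus_val p) = val_ring (torus_val q) \<longleftrightarrow> p dvd q"
proof
  assume eq: "val_ring (torus_val p) = val_ring (torus_val q)"
  show "p dvd q"
  proof (rule ccontr)
    assume "\<not> p dvd q"
    have nz: "q \<noteq> 0" "(1 :: ('n, 'k) group_algebra) \<noteq> 0" using prime_nonzero[OF q] by simp_all
    have "torus_val p (Fract 1 q) = 0"
      unfolding torus_val_Fract[OF p nz(2,1)] using padic_not_dvd[OF p nz(1) \<open>\<not> p dvd q\<close>] padic_unit[OF p, of 1] by simp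
    then have "Fract 1 q \<in> val_ring (torus_val p)" unfolding val_ring_def by simp
    then have "Fract 1 q \<in> val_ring (torus_val q)" unfolding eq .
    moreover have "torus_val q (Fract 1 q) = - 1"
      unfolding torus_val_Fract[OF q nz(2,1)] using padic_self[OF q] padic_unit[OF q, of 1] by simp
    moreover have "Fract 1 q \<noteq> 0" using nz by (simp add: Fract_eq_zero_iff)
    ultimately show False unfolding val_ring_def by simp
  qed
qed (rule val_ring_torus_eq[OF p q])

section \<open>Torus invariant divisors\<close>

definition invariant_divisor :: "int ^ 'j ^ 'n::{finite,linorder} \<Rightarrow> int ^ 'j \<Rightarrow> ('n, 'k::field) toric_field set \<Rightarrow>\<^sub>0 int" where
  "invariant_divisor V a = (\<Sum>j\<in>UNIV. frag_cmul (a $ j) (frag_of (ray_divisor (column j V))))"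

definition row_combination :: "int ^ 'j ^ 'n::{finite,linorder} \<Rightarrow> ('n \<Rightarrow>\<^sub>0 int) \<Rightarrow> int ^ 'j" where
  "row_combination V m = (\<chi> j. wt (column j V) m)"

locale toric =
  fixes \<Sigma> :: "(real ^ 'n::{finite,linorder}) set set"
    and V :: "int ^ 'j::finite ^ 'n::{finite,linorder}"
    and \<XX> :: "('n, 'k::field) toric_field set set"
    and D :: "int ^ 'j \<Rightarrow> ('n, 'k) toric_field set \<Rightarrow>\<^sub>0 int"
  assumes fan: "fan \<Sigma>" and fm: "fan_matrix \<Sigma> V" and nonempty: "\<Sigma> \<noteq> {}"
    and X_def: "\<XX> = toric_variety \<Sigma>" and D_def: "D = invariant_divisor V"
begin

lemma col_prim: "column j V \<in> primitive_generators \<Sigma>"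
  using fm unfolding fan_matrix_def by (rule bij_betwE[THEN bspec]) simp

lemma col_inj: "column i V = column j V \<Longrightarrow> i = j"
  using bij_betw_imp_inj_on[OF fm[unfolded fan_matrix_def]] by (rule injD)

lemma prim_col:
  assumes "v \<in> primitive_generators \<Sigma>" obtains j where "v = column j V"
proof -
  have "v \<in> range (\<lambda>j. column j V)"
    using bij_betw_imp_surj_on[OF fm[unfolded fan_matrix_def]] assms by simp
  then show ?thesis using that by (elim rangeE)
qed

abbreviation ring_of :: "'j \<Rightarrow> ('n, 'k) toric_field set" where "ring_of j \<equiv> ray_ring (column j V)"

lemma prime_divisor_cases:
  assumes "P \<in> prime_divisors \<XX>"
  obtains j where "P = ring_of j" | q where "prime_elem q" "P = val_ring (torus_val q)"
proof -
  consider v where "v \<in> primitive_generators \<Sigma>" "P = ray_ring v" | q where "prime_elem q" "P = val_ring (torus_val q)"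
    using prime_divisors_toric[OF fan assms[unfolded X_def]] by (elim disjE bexE exE conjE)
  then show ?thesis
  proof cases
    case 1
    from prim_col[OF 1(1)] obtain j where "v = column j V" .
    then show ?thesis using that(1)[of j] 1(2) by simp
  next
    case 2
    then show ?thesis by (rule that(2))
  qed
qed

lemma ring_of_prime_divisor: "ring_of j \<in> prime_divisors \<XX>"
  unfolding X_def using primitive_generator_ray[OF col_prim] by (rule ray_ring_prime_divisor[OF fan])

lemma torus_ring_prime_divisor: "prime_elem q \<Longrightarrow> val_ring (torus_val q) \<in> prime_divisors \<XX>"
  unfolding X_def using nonempty torus_prime_divisor[OF fan] by fast

lemma ord_ring_of: "f \<noteq> 0 \<Longrightarrow> ord_at (ring_of j) f = ray_val (column j V) f"
  by (rule ord_at_ray_ring[OF col_prim])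

lemma lookup_D: "Poly_Mapping.lookup (D a) P = (\<Sum>j\<in>UNIV. if ring_of j = P then a $ j else 0)"
  unfolding D_def invariant_divisor_def lookup_sum lookup_frag_cmul lookup_frag_of ray_divisor_eq[OF fan col_prim]
  by (intro sum.cong refl) (simp add: when_def)

lemma lookup_D_ray: "Poly_Mapping.lookup (D a) (ring_of j) = a $ j"
proof -
  have "ring_of i = ring_of j \<longleftrightarrow> i = j" for i
    using ray_ring_inject[OF fan col_prim[of j] col_prim[of i], where ?'k = 'k] col_inj by metis
  then have "Poly_Mapping.lookup (D a) (ring_of j) = (\<Sum>i\<in>UNIV. if i = j then a $ i else 0)" unfolding lookup_D by simp
  then show ?thesis by simp
qed

lemma lookup_D_torus:
  fixes q :: "('n, 'k) group_algebra"
  assumes q: "prime_elem q" shows "Poly_Mapping.lookup (D a) (val_ring (torus_val q)) = 0"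
  unfolding lookup_D
proof (rule sum.neutral, rule ballI)
  fix j show "(if ring_of j = val_ring (torus_val q) then a $ j else 0) = 0"
    using ray_ring_not_torus[OF col_prim[of j] q] by simp
qed

lemma D_carrier: "D a \<in> carrier (Weil_divisors \<XX>)"
proof -
  have "P \<in> prime_divisors \<XX>" if "Poly_Mapping.lookup (D a) P \<noteq> 0" for P
  proof (rule ccontr)
    assume "P \<notin> prime_divisors \<XX>"
    then have "ring_of j \<noteq> P" for j using ring_of_prime_divisor[of j] by metis
    then show False using that unfolding lookup_D by simp
  qed
  then show ?thesis by (simp add: subset_iff in_keys_iff)
qed

lemma D_add: "D (a + b) = D a + D b"
proof (rule poly_mapping_eqI)
  fix P show "Poly_Mapping.lookup (D (a + b)) P = Poly_Mapping.lookup (D a + D b) P"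
    unfolding lookup_add lookup_D sum.distrib[symmetric] by (intro sum.cong refl) simp
qed

lemma D_diff: "D (a - b) = D a - D b"
  using D_add[of "a - b" b] by simp

text \<open>A function whose divisor is invariant has order zero at all primes of the torus, so
  that it is a monomial.\<close>

lemma D_principal_iff: "D a \<in> principal_divisors \<XX> \<longleftrightarrow> (\<exists>m. a = row_combination V m)"
proof
  assume "D a \<in> principal_divisors \<XX>"
  then obtain f where f: "f \<noteq> 0" "\<And>P. P \<in> prime_divisors \<XX> \<Longrightarrow> Poly_Mapping.lookup (D a) P = ord_at P f"
    unfolding principal_divisors_def by blast
  have tu: "torus_val q f = 0" if "prime_elem q" for q
    using f(2)[OF torus_ring_prime_divisor[OF that]] lookup_D_torus[OF that] ord_at_torus[OF that f(1)] by simp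
  have "\<exists>m c. c \<noteq> 0 \<and> f = embed (Poly_Mapping.single m c)"
    by (rule torus_unit_is_monomial[OF f(1)]) (rule tu)
  then obtain m c where mc: "c \<noteq> 0" "f = embed (Poly_Mapping.single m c)" by (elim exE conjE)
  have "a $ j = wt (column j V) m" for j
  proof -
    have "a $ j = ray_val (column j V) f"
      using f(2)[OF ring_of_prime_divisor[of j]] lookup_D_ray[of a j] ord_ring_of[OF f(1)] by simp
    also have "\<dots> = low (wt (column j V)) (Poly_Mapping.single m c)"
      unfolding mc(2) by (rule ray_val_embed) (use f(1) mc(2) embed_zero_iff in metis)
    also have "\<dots> = wt (column j V) m" by (rule low_eqI[of _ _ _ m]) (use mc(1) in simp_all)
    finally show ?thesis .
  qed
  then have "a = row_combination V m" unfolding row_combination_def by (simp add: vec_eq_iff)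
  then show "\<exists>m. a = row_combination V m" by (rule exI)
next
  assume "\<exists>m. a = row_combination V m"
  then obtain m where m: "a = row_combination V m" by (rule exE)
  have "Poly_Mapping.lookup (D a) P = ord_at P (chr m)" if "P \<in> prime_divisors \<XX>" for P
    using that
  proof (cases rule: prime_divisor_cases)
    case (1 j)
    then show ?thesis using lookup_D_ray[of a j] ord_ring_of[OF chr_nonzero, of j m] m
      by (simp add: ray_val_chr row_combination_def)
  next
    case (2 q)
    then show ?thesis using lookup_D_torus[OF 2(1), of a] ord_at_torus[OF 2(1) chr_nonzero] torus_val_chr[OF 2(1)] by simp
  qed
  then show "D a \<in> principal_divisors \<XX>" unfolding principal_divisors_def using D_carrier chr_nonzero by blast
qed

text \<open>On the torus every divisor is principal, defined by the product of the primes of the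
  group algebra with multiplicities. Subtracting the divisor of this product leaves ray
  divisors.\<close>

lemma equivalent_invariant_divisor:
  assumes E: "E \<in> carrier (Weil_divisors \<XX>)"
  shows "\<exists>a. D a - E \<in> principal_divisors \<XX>"
proof -
  let ?R = "\<lambda>q :: ('n, 'k) group_algebra. val_ring (torus_val q)"
  define K where "K = {P \<in> Poly_Mapping.keys E. \<exists>q. prime_elem q \<and> P = ?R q}"
  have fin: "finite K" unfolding K_def by simp
  have "\<forall>P\<in>K. \<exists>q. prime_elem q \<and> P = ?R q" unfolding K_def by simp
  then obtain q where q: "\<And>P. P \<in> K \<Longrightarrow> prime_elem (q P) \<and> P = ?R (q P)" by metis
  have q0: "embed (q P) \<noteq> 0" if "P \<in> K" for P using q[OF that] prime_nonzero embed_zero_iff by metis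
  define f where "f = (\<Prod>P\<in>K. embed (q P) powi Poly_Mapping.lookup E P)"
  have f0: "f \<noteq> 0" unfolding f_def using q0 fin by simp
  have val: "torus_val p f = Poly_Mapping.lookup E (?R p)" if p: "prime_elem p" for p
  proof -
    interpret discrete_valuation "torus_val p" by (rule discrete_valuation_torus_val[OF p])
    have "torus_val p f = (\<Sum>P\<in>K. torus_val p (embed (q P) powi Poly_Mapping.lookup E P))"
      unfolding f_def using q0 by (intro prod fin) simp
    also have "\<dots> = (\<Sum>P\<in>K. if P = ?R p then Poly_Mapping.lookup E P else 0)"
    proof (rule sum.cong[OF refl])
      fix P assume P: "P \<in> K"
      have qP: "prime_elem (q P)" "P = ?R (q P)" using q[OF P] by simp_all
      have nz: "q P \<noteq> 0" by (rule prime_nonzero[OF qP(1)])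
      have "torus_val p (embed (q P)) = (if P = ?R p then 1 else 0)"
      proof (cases "p dvd q P")
        case True
        then have "P = ?R p" using torus_ring_eq_iff[OF p qP(1)] qP(2) by metis
        then show ?thesis using torus_val_embed[OF p nz] padic_associated[OF p qP(1) True] by simp
      next
        case False
        then have "P \<noteq> ?R p" using torus_ring_eq_iff[OF p qP(1)] qP(2) by metis
        then show ?thesis using torus_val_embed[OF p nz] padic_not_dvd[OF p nz False] by simp
      qed
      then show "torus_val p (embed (q P) powi Poly_Mapping.lookup E P) = (if P = ?R p then Poly_Mapping.lookup E P else 0)"
        unfolding power_int[OF q0[OF P]] by simp
    qed
    also have "\<dots> = (if ?R p \<in> K then Poly_Mapping.lookup E (?R p) else 0)" by (rule sum.delta[OF fin])
    also have "\<dots> = Poly_Mapping.lookup E (?R p)"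
    proof (cases "?R p \<in> Poly_Mapping.keys E")
      case True
      then have "?R p \<in> K" unfolding K_def using p by blast
      then show ?thesis by simp
    next
      case False
      then show ?thesis by (simp add: in_keys_iff)
    qed
    finally show ?thesis .
  qed
  define a where "a = (\<chi> j. Poly_Mapping.lookup E (ring_of j) - ray_val (column j V) f)"
  have if0: "inverse f \<noteq> 0" using f0 by simp
  have "Poly_Mapping.lookup (D a - E) P = ord_at P (inverse f)" if P: "P \<in> prime_divisors \<XX>" for P
  proof -
    have inv: "ord_at P (inverse f) = - ord_at P f" by (rule ord_at_mult(2)[OF fan P[unfolded X_def] f0 f0])
    show ?thesis using P
    proof (cases rule: prime_divisor_cases)
      case (1 j)
      then show ?thesis unfolding inv using lookup_D_ray[of a j] ord_ring_of[OF f0, of j]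
        by (simp add: lookup_minus a_def)
    next
      case (2 p)
      then show ?thesis unfolding inv using lookup_D_torus[OF 2(1), of a] ord_at_torus[OF 2(1) f0] val[OF 2(1)]
        by (simp add: lookup_minus)
    qed
  qed
  moreover have "D a - E \<in> carrier (Weil_divisors \<XX>)"
    using D_carrier[of a] E keys_diff[of "D a" E] by (simp add: subset_iff) blast
  ultimately have "D a - E \<in> principal_divisors \<XX>" unfolding principal_divisors_def using if0 by blast
  then show ?thesis by (rule exI)
qed

lemma Cartier_add_principal:
  assumes E: "E \<in> Cartier_divisors \<XX>" and F: "F \<in> principal_divisors \<XX>"
  shows "E + F \<in> Cartier_divisors \<XX>"
proof -
  obtain g where g: "F \<in> carrier (Weil_divisors \<XX>)" "g \<noteq> 0" "\<And>P. P \<in> prime_divisors \<XX> \<Longrightarrow> Poly_Mapping.lookup F P = ord_at P g"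
    using F unfolding principal_divisors_def by blast
  have Ec: "E \<in> carrier (Weil_divisors \<XX>)" and
    Eloc: "\<And>x. x \<in> points \<XX> \<Longrightarrow> \<exists>U. zariski_open \<XX> U \<and> x \<in> U \<and>
      (\<exists>f. f \<noteq> 0 \<and> (\<forall>P\<in>prime_divisors \<XX> \<inter> U. Poly_Mapping.lookup E P = ord_at P f))"
    using E unfolding Cartier_divisors_def by blast+
  have "E + F \<in> carrier (Weil_divisors \<XX>)"
    using subset_trans[OF keys_add Un_least, of E "prime_divisors \<XX>" F] Ec g(1) by simp
  moreover have "\<exists>U. zariski_open \<XX> U \<and> x \<in> U \<and>
      (\<exists>f. f \<noteq> 0 \<and> (\<forall>P\<in>prime_divisors \<XX> \<inter> U. Poly_Mapping.lookup (E + F) P = ord_at P f))" if xp: "x \<in> points \<XX>" for x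
  proof -
    obtain U f where U: "zariski_open \<XX> U" "x \<in> U" "f \<noteq> 0"
      "\<forall>P\<in>prime_divisors \<XX> \<inter> U. Poly_Mapping.lookup E P = ord_at P f" using Eloc[OF xp] by (elim exE conjE)
    have "Poly_Mapping.lookup (E + F) P = ord_at P (f * g)" if P: "P \<in> prime_divisors \<XX> \<inter> U" for P
    proof -
      have P': "P \<in> prime_divisors \<XX>" using P by simp
      show ?thesis using bspec[OF U(4) P] g(3)[OF P'] ord_at_mult(1)[OF fan P'[unfolded X_def] U(3) g(2)]
        by (simp add: lookup_add)
    qed
    moreover have "f * g \<noteq> 0" using U(3) g(2) by simp
    ultimately show ?thesis using U(1,2) by (intro exI[of _ U] conjI exI[of _ "f * g"] ballI)
  qed
  ultimately show ?thesis unfolding Cartier_divisors_def by simp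
qed

end

section \<open>Cartier divisors\<close>

lemma wt_vec_sum: "wt (\<Sum>j\<in>J. v j) m = (\<Sum>j\<in>J. wt (v j) m)"
  for v :: "'j \<Rightarrow> int ^ 'n::{finite,linorder}"
proof (induction J rule: infinite_finite_induct)
  case (insert j J)
  have "wt (a + b) m = wt a m + wt b m" for a b :: "int ^ 'n::{finite,linorder}"
    by (simp add: wt_def distrib_left sum.distrib)
  then show ?case using insert by simp
qed (simp_all add: wt_def)

lemma real_vec_sum: "real_vec (\<Sum>j\<in>J. v j) = (\<Sum>j\<in>J. real_vec (v j))"
  by (induction J rule: infinite_finite_induct) (simp_all add: real_vec_add)

context toric
begin

text \<open>A rational function \<open>f\<close> defining an invariant divisor near the distinguished point of a
  chart has, along the rays of the chart, the orders of a character. Its zeros and poles on the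
  torus lie on the zero set of a regular function \<open>s\<close> that does not vanish at the point, so
  that \<open>s\<^sup>N f\<close> and \<open>s\<^sup>N / f\<close> are Laurent polynomials for some \<open>N\<close>; as \<open>s\<close> has order zero
  along the rays and along their sum \<open>u\<close>, a character of least \<open>u\<close>-weight in \<open>s\<^sup>N f\<close> has
  least weight for all rays.\<close>

lemma Cartier_local_character:
  assumes cart: "D a \<in> Cartier_divisors \<XX>"
    and \<sigma>: "\<sigma> = convex_cone hull ((\<lambda>j. real_vec (column j V)) ` J)" "\<sigma> \<in> \<Sigma>"
  shows "\<exists>m. \<forall>j\<in>J. a $ j = wt (column j V) m"
proof -
  let ?A = "chart \<sigma> :: ('n, 'k) toric_field set"
  note A = ring_closed_chart[of \<sigma>, where ?'k = 'k]
  define u where "u = (\<Sum>j\<in>J. column j V)"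
  have gen: "real_vec (column j V) \<in> \<sigma>" if "j \<in> J" for j unfolding \<sigma>(1) by (rule hull_inc) (use that in simp)
  have ray: "column j V \<in> rays \<Sigma> \<sigma>" if "j \<in> J" for j unfolding rays_def using gen[OF that] col_prim by simp
  have "real_vec u \<in> \<sigma>" unfolding u_def real_vec_sum
  proof -
    have "(\<Sum>j\<in>K. real_vec (column j V)) \<in> \<sigma>" if "finite K" "K \<subseteq> J" for K
      using that
    proof (induction K rule: finite_induct)
      case empty
      then show ?case using convex_cone_contains_0[OF cone_of_fan[OF fan \<sigma>(2)]] by simp
    next
      case (insert j K)
      then show ?case using convex_cone_add[OF cone_of_fan[OF fan \<sigma>(2)] gen[of j]] by simp
    qed
    then show "(\<Sum>j\<in>J. real_vec (column j V)) \<in> \<sigma>" by simp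
  qed
  note Au = chart_subset_ray_ring[OF this, where ?'k = 'k]
  interpret u: field_valuation "ray_val u :: ('n, 'k) toric_field \<Rightarrow> int" by (rule field_valuation_ray_val)
  have cu: "u.centre ?A \<in> Spec ?A" by (rule u.centre_in_Spec[OF A Au])
  have AX: "?A \<in> \<XX>" unfolding X_def toric_variety_def using \<sigma>(2) by simp
  have "localization ?A (u.centre ?A) \<in> points \<XX>"
    unfolding X_def mem_points_toric by (rule bexI[OF _ \<sigma>(2)], rule bexI[OF _ cu]) (rule refl)
  then obtain U f where U: "zariski_open \<XX> U" "localization ?A (u.centre ?A) \<in> U" and f0: "f \<noteq> 0"
    and f: "\<And>P. P \<in> prime_divisors \<XX> \<Longrightarrow> P \<in> U \<Longrightarrow> Poly_Mapping.lookup (D a) P = ord_at P f"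
    using cart unfolding Cartier_divisors_def by blast
  obtain S where S: "S \<subseteq> ?A" "\<And>p. p \<in> Spec ?A \<Longrightarrow> localization ?A p \<in> U \<longleftrightarrow> \<not> S \<subseteq> p"
    using U(1) AX unfolding zariski_open_def by metis
  have "\<not> S \<subseteq> u.centre ?A" using S(2)[OF cu] U(2) by simp
  then obtain z where z: "z \<in> S" "z \<notin> u.centre ?A" by (auto simp only: subset_iff)
  have zA: "z \<in> ?A" using S(1) z(1) by (rule subsetD)
  then obtain s where s: "Poly_Mapping.keys s \<subseteq> dual_monoid \<sigma>" "z = embed s"
    unfolding mem_character_span by (elim exE conjE)
  have "z \<noteq> 0" "\<not> 0 < ray_val u z" using z(2) zA unfolding u.centre_def by simp_all
  then have s0: "s \<noteq> 0" using s(2) embed_zero by auto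
  have lu: "low (wt u) s \<le> 0" using \<open>\<not> 0 < ray_val u z\<close> unfolding s(2) ray_val_embed[OF s0] by simp
  have dual: "0 \<le> wt (column j V) m" if "m \<in> dual_monoid \<sigma>" "j \<in> J" for m j
    using that(1) ray[OF that(2)] unfolding dual_monoid_rays[OF fan \<sigma>(2)] by simp
  have wtu: "wt u m = (\<Sum>j\<in>J. wt (column j V) m)" for m unfolding u_def by (rule wt_vec_sum)
  obtain n0 where n0: "n0 \<in> Poly_Mapping.keys s" "wt u n0 = low (wt u) s" using low_attained[OF s0] by blast
  have n0d: "n0 \<in> dual_monoid \<sigma>" using s(1) n0(1) by (rule subsetD)
  have "0 \<le> (\<Sum>j\<in>J. wt (column j V) n0)" using dual[OF n0d] by (intro sum_nonneg)
  then have n0sum: "(\<Sum>j\<in>J. wt (column j V) n0) = 0" using n0(2) lu wtu[of n0] by simp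
  have n0j: "wt (column j V) n0 = 0" if "j \<in> J" for j
    using sum_nonneg_0[OF _ _ n0sum that] dual[OF n0d] by simp
  have low_j: "low (wt (column j V)) s = 0" if j: "j \<in> J" for j
    by (rule low_eqI[where n = n0]) (use n0(1) n0j[OF j] dual[OF subsetD[OF s(1)] j] in simp_all)
  have low_u: "low (wt u) s = 0" using n0(2) n0sum wtu[of n0] by simp
  have ray_ord: "a $ j = ray_val (column j V) f" if j: "j \<in> J" for j
  proof -
    interpret v: field_valuation "ray_val (column j V) :: ('n, 'k) toric_field \<Rightarrow> int" by (rule field_valuation_ray_val)
    have c: "v.centre ?A \<in> Spec ?A" by (rule v.centre_in_Spec[OF A chart_subset_ray_ring[OF gen[OF j]]])
    have "z \<notin> v.centre ?A" unfolding v.centre_def using \<open>z \<noteq> 0\<close> low_j[OF j] ray_val_embed[OF s0, of "column j V"] s(2) by simp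
    then have "\<not> S \<subseteq> v.centre ?A" using z(1) by (simp only: subset_iff) (rule notI, simp)
    then have "localization ?A (v.centre ?A) \<in> U" using S(2)[OF c] by simp
    then have "ring_of j \<in> U" unfolding localization_ray[OF fan \<sigma>(2) ray[OF j]] .
    then show ?thesis using f[OF ring_of_prime_divisor] lookup_D_ray ord_ring_of[OF f0] by simp
  qed
  have torus_ord: "torus_val q f = 0" if q: "prime_elem q" "\<not> q dvd s" for q
  proof -
    interpret t: discrete_valuation "torus_val q" by (rule discrete_valuation_torus_val[OF q(1)])
    have c: "t.centre ?A \<in> Spec ?A" by (rule t.centre_in_Spec[OF A chart_subset_torus_ring[OF q(1)]])
    have "z \<notin> t.centre ?A" unfolding t.centre_def
      using \<open>z \<noteq> 0\<close> padic_not_dvd[OF q(1) s0 q(2)] torus_val_embed[OF q(1) s0] s(2) by simp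
    then have "\<not> S \<subseteq> t.centre ?A" using z(1) by (simp only: subset_iff) (rule notI, simp)
    then have "localization ?A (t.centre ?A) \<in> U" using S(2)[OF c] by simp
    then have "val_ring (torus_val q) \<in> U" unfolding localization_torus[OF fan \<sigma>(2) q(1)] .
    then show ?thesis
      using f[OF torus_ring_prime_divisor[OF q(1)]] lookup_D_torus[OF q(1), of a] ord_at_torus[OF q(1) f0] by simp
  qed
  obtain \<alpha> \<beta> where ab: "\<alpha> \<noteq> 0" "\<beta> \<noteq> 0" "f = Fract \<alpha> \<beta>" using f0 by (rule nonzero_fract_cases)
  obtain N1 where N1: "\<And>q. prime_elem q \<Longrightarrow> padic q \<alpha> \<le> int N1" using padic_bounded[OF ab(1)] by blast
  obtain N2 where N2: "\<And>q. prime_elem q \<Longrightarrow> padic q \<beta> \<le> int N2" using padic_bounded[OF ab(2)] by blast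
  define N where "N = max N1 N2"
  define w where "w = s ^ N"
  have w0: "w \<noteq> 0" unfolding w_def using s0 by simp
  have dvd: "y dvd w * x" if xy: "x \<noteq> 0" "y \<noteq> 0" "\<And>q. prime_elem q \<Longrightarrow> padic q y \<le> int N"
    "\<And>q. prime_elem q \<Longrightarrow> \<not> q dvd s \<Longrightarrow> padic q x = padic q y" for x y
  proof (rule dvd_of_padic_le[OF xy(2)])
    show "w * x \<noteq> 0" using w0 xy(1) by simp
    fix q :: "('n, 'k) group_algebra" assume q: "prime_elem q"
    interpret q: integer_valuation "padic q" by (rule integer_valuation_padic[OF q])
    have val: "padic q (w * x) = int N * padic q s + padic q x"
      using q.mult[OF w0 xy(1)] q.power[OF s0] unfolding w_def by simp
    show "padic q y \<le> padic q (w * x)"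
    proof (cases "q dvd s")
      case True
      then have "1 \<le> padic q s" using padic_pos_iff[OF q s0] by simp
      then have "int N * 1 \<le> int N * padic q s" by (intro mult_left_mono) simp_all
      then show ?thesis unfolding val using xy(3)[OF q] padic_nonneg[OF q xy(1)] by simp
    next
      case False
      then show ?thesis unfolding val using xy(4)[OF q False] padic_nonneg[OF q s0] by simp
    qed
  qed
  have eqv: "padic q \<alpha> = padic q \<beta>" if "prime_elem q" "\<not> q dvd s" for q
    using torus_ord[OF that] torus_val_Fract[OF that(1) ab(1,2)] ab(3) by simp
  have le1: "padic q \<alpha> \<le> int N" "padic q \<beta> \<le> int N" if "prime_elem q" for q
    using N1[OF that] N2[OF that] unfolding N_def by simp_all
  have "\<beta> dvd w * \<alpha>" by (rule dvd[OF ab(1,2) le1(2) eqv])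
  then obtain g where g: "w * \<alpha> = \<beta> * g" by (rule dvdE)
  have "\<alpha> dvd w * \<beta>" by (rule dvd[OF ab(2,1) le1(1) eqv[symmetric]])
  then obtain h where h: "w * \<beta> = \<alpha> * h" by (rule dvdE)
  have g0: "g \<noteq> 0" using g w0 ab(1) by auto
  have h0: "h \<noteq> 0" using h w0 ab(2) by auto
  have gh: "low (wt v) g + low (wt v) h = 0 \<and> low (wt v) \<alpha> - low (wt v) \<beta> = low (wt v) g"
    if v: "low (wt v) s = 0" for v
  proof -
    interpret l: integer_valuation "low (wt v) :: ('n, 'k) group_algebra \<Rightarrow> int" by (rule integer_valuation_ray)
    have "low (wt v) w = 0" unfolding w_def using l.power[OF s0] v by simp
    then show ?thesis
      using arg_cong[OF g, of "low (wt v)"] arg_cong[OF h, of "low (wt v)"]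
        l.mult[OF w0 ab(1)] l.mult[OF w0 ab(2)] l.mult[OF ab(2) g0] l.mult[OF ab(1) h0] by linarith
  qed
  obtain m where m: "m \<in> Poly_Mapping.keys g" "wt u m = low (wt u) g" using low_attained[OF g0] by blast
  obtain n where n: "n \<in> Poly_Mapping.keys h" "wt u n = low (wt u) h" using low_attained[OF h0] by blast
  have nonneg: "0 \<le> wt (column j V) (m + n)" if j: "j \<in> J" for j
    using low_le[OF m(1), of "wt (column j V)"] low_le[OF n(1), of "wt (column j V)"] gh[OF low_j[OF j]]
    unfolding wt_add by linarith
  have "wt u (m + n) = 0" unfolding wt_add using m(2) n(2) gh[OF low_u] by simp
  then have sum0: "(\<Sum>j\<in>J. wt (column j V) (m + n)) = 0" by (simp only: wtu)
  have "a $ j = wt (column j V) m" if j: "j \<in> J" for j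
  proof -
    have "wt (column j V) m + wt (column j V) n = 0"
      using sum_nonneg_0[OF _ _ sum0 j] nonneg unfolding wt_add by simp
    then have "low (wt (column j V)) g = wt (column j V) m"
      using low_le[OF m(1), of "wt (column j V)"] low_le[OF n(1), of "wt (column j V)"] gh[OF low_j[OF j]] by linarith
    then show ?thesis
      using ray_ord[OF j] ray_val_Fract[OF ab(1,2), of "column j V"] ab(3) gh[OF low_j[OF j]] by simp
  qed
  then show ?thesis by blast
qed

text \<open>Conversely, characters on the cones define the divisor locally: an open neighbourhood of the
  points of the chart of \<open>\<tau>\<close> is the complement of the ray divisors of all rays outside of \<open>\<tau>\<close>.\<close>

lemma Cartier_of_local_characters:
  assumes loc: "\<And>\<tau>. \<tau> \<in> \<Sigma> \<Longrightarrow> \<exists>m. \<forall>j. real_vec (column j V) \<in> \<tau> \<longrightarrow> a $ j = wt (column j V) m"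
  shows "D a \<in> Cartier_divisors \<XX>"
proof -
  have "\<exists>U. zariski_open \<XX> U \<and> x \<in> U \<and>
      (\<exists>f. f \<noteq> 0 \<and> (\<forall>P\<in>prime_divisors \<XX> \<inter> U. Poly_Mapping.lookup (D a) P = ord_at P f))"
    if x: "x \<in> points \<XX>" for x
  proof -
    obtain \<tau> p where \<tau>: "\<tau> \<in> \<Sigma>" and p: "p \<in> Spec (chart \<tau>)" "x = localization (chart \<tau>) p"
      using x unfolding X_def mem_points_toric by (elim bexE)
    obtain m where m: "\<And>j. real_vec (column j V) \<in> \<tau> \<Longrightarrow> a $ j = wt (column j V) m"
      using loc[OF \<tau>] by blast
    define out where "out v \<longleftrightarrow> v \<in> primitive_generators \<Sigma> \<and> real_vec v \<notin> \<tau>" for v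
    \<comment> \<open>A point lies on the divisor of a ray iff its local ring is contained in the ring of the ray.\<close>
    define U where "U = {y \<in> points \<XX>. \<forall>v. out v \<longrightarrow> \<not> y \<subseteq> ray_ring v}"
    have in_cone: "real_vec v \<in> \<rho>" if "\<rho> \<in> \<Sigma>" "p' \<in> Spec (chart \<rho>)"
      "localization (chart \<rho>) p' \<subseteq> (ray_ring v :: ('n, 'k) toric_field set)" for \<rho> p' v
    proof (rule in_cone_of_dual_nonneg[OF fan that(1)])
      fix m assume "m \<in> dual_monoid \<rho>"
      then have "(chr m :: ('n, 'k) toric_field) \<in> ray_ring v"
        using chr_in_chart subset_localization[OF ring_closed_chart that(2)] that(3) by blast
      then show "0 \<le> wt v m" unfolding val_ring_def by (simp add: ray_val_chr)
    qed
    have open_at: "\<exists>S\<subseteq>A. \<forall>p\<in>Spec A. localization A p \<in> U \<longleftrightarrow> \<not> S \<subseteq> p" if AX: "A \<in> \<XX>" for A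
    proof -
      obtain \<rho> where \<rho>: "\<rho> \<in> \<Sigma>" and A: "A = chart \<rho>" using AX unfolding X_def toric_variety_def by (elim imageE)
      note rc = ring_closed_chart[of \<rho>, where ?'k = 'k]
      let ?c = "\<lambda>v. field_valuation.centre (ray_val v) A"
      have cdef: "y \<in> ?c v \<longleftrightarrow> y \<in> A \<and> (y = 0 \<or> 0 < ray_val v y)" for y v
        unfolding field_valuation.centre_def[OF field_valuation_ray_val] by simp
      define R where "R = {v \<in> rays \<Sigma> \<rho>. out v}"
      have finR: "finite R" unfolding R_def using finite_rays[OF fan] by simp
      have sub: "A \<subseteq> ray_ring v" if "v \<in> R" for v
        unfolding A using that by (intro chart_subset_ray_ring) (simp add: R_def rays_def)
      have cS: "?c v \<in> Spec A" if "v \<in> R" for v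
        unfolding A by (rule field_valuation.centre_in_Spec[OF field_valuation_ray_val rc sub[OF that, unfolded A]])
      define S where "S = {y \<in> A. \<forall>v\<in>R. y \<in> ?c v}"
      have "localization A p' \<in> U \<longleftrightarrow> \<not> S \<subseteq> p'" if p': "p' \<in> Spec A" for p'
      proof
        note p'A = p'[unfolded A]
        assume inU: "localization A p' \<in> U"
        have "\<exists>y. y \<in> ?c v \<and> y \<notin> p'" if v: "v \<in> R" for v
        proof (rule ccontr)
          assume "\<nexists>y. y \<in> ?c v \<and> y \<notin> p'"
          then have cp: "y \<in> p'" if "y \<in> ?c v" for y using that by blast
          have "localization A p' \<subseteq> ray_ring v"
          proof
            fix y assume "y \<in> localization A p'"
            then obtain b c where bc: "b \<in> A" "c \<in> A" "c \<notin> p'" "y = b / c" unfolding localization_mem_iff by blast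
            have "c \<notin> ?c v" using cp bc(3) by metis
            then have c: "c \<noteq> 0" "ray_val v c \<le> 0" unfolding cdef using bc(2) by simp_all
            have "b \<in> ray_ring v" using sub[OF v] bc(1) by (rule subsetD)
            then have b: "b = 0 \<or> 0 \<le> ray_val v b" unfolding val_ring_def by simp
            show "y \<in> ray_ring v"
              using b c field_valuation.divide[OF field_valuation_ray_val _ c(1), of b v]
              unfolding bc(4) val_ring_def by (cases "b = 0") simp_all
          qed
          moreover have "out v" using v unfolding R_def by simp
          ultimately show False using inU unfolding U_def by blast
        qed
        then obtain y where y: "\<And>v. v \<in> R \<Longrightarrow> y v \<in> ?c v \<and> y v \<notin> p'" by metis
        have yA: "y v \<in> A" if "v \<in> R" for v using y[OF that] unfolding cdef by simp
        have pr: "(\<Prod>v\<in>R. y v) \<in> A \<and> (\<Prod>v\<in>R. y v) \<notin> p'"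
          unfolding A by (rule Spec_prod[OF rc p'A finR]) (use y yA A in simp_all)
        have "(\<Prod>v\<in>R. y v) \<in> ?c v" if v: "v \<in> R" for v
        proof -
          have "(\<Prod>v\<in>R - {v}. y v) \<in> A"
            unfolding A by (rule conjunct1[OF Spec_prod[OF rc p'A]]) (use y yA A finR in simp_all)
          then have "(\<Prod>v\<in>R - {v}. y v) * y v \<in> ?c v"
            using SpecD(5)[OF rc[folded A] cS[OF v]] y[OF v] by blast
          then show ?thesis unfolding prod.remove[OF finR v] by (simp only: mult.commute)
        qed
        then have "(\<Prod>v\<in>R. y v) \<in> S" unfolding S_def using pr by simp
        then show "\<not> S \<subseteq> p'" using pr by (simp only: subset_iff) (rule notI, simp)
      next
        assume "\<not> S \<subseteq> p'"
        then obtain y where y: "y \<in> S" "y \<notin> p'" by (auto simp only: subset_iff)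
        have pt: "localization A p' \<in> points \<XX>"
          unfolding X_def mem_points_toric A by (rule bexI[OF _ \<rho>], rule bexI[OF _ p'[unfolded A]]) (rule refl)
        have "\<not> localization A p' \<subseteq> ray_ring v" if v: "out v" for v
        proof
          assume l: "localization A p' \<subseteq> ray_ring v"
          have "real_vec v \<in> \<rho>" by (rule in_cone[OF \<rho> p'[unfolded A] l[unfolded A]])
          then have "v \<in> R" unfolding R_def rays_def using v by (simp add: out_def)
          then have yc: "y \<in> A" "y = 0 \<or> 0 < ray_val v y" using y(1) unfolding S_def cdef by simp_all
          have y0: "y \<noteq> 0" using y(2) SpecD(2)[OF rc p'[unfolded A]] by metis
          have "inverse y \<in> localization A p'"
            unfolding A by (rule localization_denominator[OF rc p'[unfolded A]]) (use yc(1) y(2) A in simp)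
          then have "inverse y \<in> ray_ring v" using l by (rule_tac subsetD)
          then show False using yc(2) y0 field_valuation.inverse[OF field_valuation_ray_val y0, of v]
            unfolding val_ring_def by simp
        qed
        then show "localization A p' \<in> U" unfolding U_def using pt by simp
      qed
      moreover have "S \<subseteq> A" unfolding S_def by (rule Collect_restrict)
      ultimately show ?thesis by blast
    qed
    have "zariski_open \<XX> U" unfolding zariski_open_def
    proof (intro conjI ballI)
      show "U \<subseteq> points \<XX>" unfolding U_def by (rule Collect_restrict)
    qed (rule open_at)
    moreover have "x \<in> U"
    proof -
      have "\<not> x \<subseteq> ray_ring v" if v: "out v" for v
        using in_cone[OF \<tau> p(1), of v] v unfolding out_def p(2) by metis
      then show ?thesis unfolding U_def using x by simp
    qed
    moreover have "Poly_Mapping.lookup (D a) P = ord_at P (chr m)" if P: "P \<in> prime_divisors \<XX>" "P \<in> U" for P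
      using P(1)
    proof (cases rule: prime_divisor_cases)
      case (1 j)
      have "\<not> out (column j V)" using P(2) unfolding U_def 1 by blast
      then have "real_vec (column j V) \<in> \<tau>" unfolding out_def using col_prim by simp
      from m[OF this] show ?thesis unfolding 1 lookup_D_ray ord_ring_of[OF chr_nonzero] by (simp add: ray_val_chr)
    next
      case (2 q)
      then show ?thesis using lookup_D_torus[OF 2(1), of a] ord_at_torus[OF 2(1) chr_nonzero] torus_val_chr[OF 2(1)] by simp
    qed
    ultimately show ?thesis using chr_nonzero[of m] by (intro exI[of _ U] conjI exI[of _ "chr m"] ballI) simp_all
  qed
  then show ?thesis unfolding Cartier_divisors_def using D_carrier[of a] by simp
qed

end

section \<open>Maximal cones of a complete fan\<close>

text \<open>The monomial valuation ring of weight \<open>u\<close> contains a local ring of some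
  chart, and so the chart. Thus all characters in the dual of the corresponding cone are nonnegative
  at \<open>u\<close>, and \<open>u\<close> is in the cone by biduality.\<close>

lemma complete_fan_covers:
  fixes \<Sigma> :: "(real ^ 'n::{finite,linorder}) set set"
  assumes fan: "fan \<Sigma>" and compl: "complete_variety ground_field (toric_variety \<Sigma> :: ('n, 'k::field) toric_field set set)"
  shows "\<Union>\<Sigma> = UNIV"
proof (rule fan_covers[OF fan])
  fix u :: "int ^ 'n::{finite,linorder}"
  have "(ground_field :: ('n, 'k) toric_field set) \<subseteq> chart UNIV"
    unfolding ground_field_def
  proof
    fix z :: "('n, 'k) toric_field" assume "z \<in> character_span {0}"
    then show "z \<in> chart UNIV" unfolding mem_character_span using dual_monoid_zero[of UNIV] by blast
  qed
  then have "(ground_field :: ('n, 'k) toric_field set) \<subseteq> ray_ring u"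
    by (rule subset_trans[OF _ chart_subset_ray_ring]) simp
  then obtain x where x: "x \<in> points (toric_variety \<Sigma> :: ('n, 'k) toric_field set set)" "x \<subseteq> ray_ring u"
    using compl field_valuation.valuation_ring_val_ring[OF field_valuation_ray_val[of u, where ?'k = 'k]]
    unfolding complete_variety_def by blast
  obtain \<sigma> p where \<sigma>: "\<sigma> \<in> \<Sigma>" and p: "p \<in> Spec (chart \<sigma> :: ('n, 'k) toric_field set)" "x = localization (chart \<sigma>) p"
    using x(1) unfolding mem_points_toric by (elim bexE)
  have "real_vec u \<in> \<sigma>"
  proof (rule in_cone_of_dual_nonneg[OF fan \<sigma>])
    fix m assume "m \<in> dual_monoid \<sigma>"
    then have "(chr m :: ('n, 'k) toric_field) \<in> ray_ring u"
      using chr_in_chart subset_localization[OF ring_closed_chart p(1)] x(2) unfolding p(2) by blast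
    then show "0 \<le> wt u m" unfolding val_ring_def by (simp add: ray_val_chr)
  qed
  then show "\<exists>\<sigma>\<in>\<Sigma>. real_vec u \<in> \<sigma>" using \<sigma> by (rule bexI)
qed

context toric
begin

lemma I_SigmaD:
  assumes "I \<in> I_Sigma \<Sigma> V"
  shows "convex_cone hull ((\<lambda>j. real_vec (column j V)) ` (- I)) \<in> \<Sigma>"
    "dim (convex_cone hull ((\<lambda>j. real_vec (column j V)) ` (- I))) = CARD('n)"
  using assms unfolding I_Sigma_def Let_def by simp_all

text \<open>A primitive generator in the cone that is not among the given generators would be a
  ray of the cone, and there would be a functional that is zero on it and positive on all given
  generators. A large multiple of this functional minus one that takes the value one on the ray
  would be nonnegative on the generators, but negative on the ray.\<close>

lemma ray_in_cone_iff:
  assumes I: "I \<in> I_Sigma \<Sigma> V"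
  shows "real_vec (column j V) \<in> convex_cone hull ((\<lambda>j. real_vec (column j V)) ` (- I)) \<longleftrightarrow> j \<notin> I"
proof
  let ?\<sigma> = "convex_cone hull ((\<lambda>j. real_vec (column j V)) ` (- I))"
  note \<sigma> = I_SigmaD(1)[OF I]
  assume in_\<sigma>: "real_vec (column j V) \<in> ?\<sigma>"
  show "j \<notin> I"
  proof
    assume jI: "j \<in> I"
    have ray: "column i V \<in> rays \<Sigma> ?\<sigma>" if "i \<notin> I" for i
      unfolding rays_def using col_prim hull_inc[of "real_vec (column i V)" "(\<lambda>j. real_vec (column j V)) ` (- I)"] that by simp
    have rj: "column j V \<in> rays \<Sigma> ?\<sigma>" unfolding rays_def using col_prim in_\<sigma> by simp
    obtain m where m: "wt (column j V) m = 0" "\<And>w. w \<in> rays \<Sigma> ?\<sigma> \<Longrightarrow> w \<noteq> column j V \<Longrightarrow> 0 < wt w m"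
      by (rule exposing_functional[OF fan \<sigma> rj]) blast
    have "Gcd (range (vec_nth (column j V))) = 1" using col_prim unfolding primitive_generators_def by simp
    then obtain m1 where m1: "wt (column j V) m1 = 1" by (rule primitive_functional)
    define N where "N = (\<Sum>i\<in>UNIV. \<bar>wt (column i V) m1\<bar>)"
    have N0: "0 \<le> N" unfolding N_def by (rule sum_nonneg) simp
    define m' where "m' = frag_cmul N m + (- m1)"
    have nonneg: "0 \<le> pairing m' x" if xS: "x \<in> (\<lambda>j. real_vec (column j V)) ` (- I)" for x
    proof -
      obtain i where i: "i \<notin> I" "x = real_vec (column i V)" using xS by auto
      have "i \<noteq> j" using i(1) jI by auto
      then have "1 \<le> wt (column i V) m" using m(2)[OF ray[OF i(1)]] col_inj[of i j] by force
      then have "N * 1 \<le> N * wt (column i V) m" using N0 by (intro mult_left_mono)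
      moreover have "\<bar>wt (column i V) m1\<bar> \<le> N" unfolding N_def by (rule member_le_sum) simp_all
      ultimately have "0 \<le> wt (column i V) m'" unfolding m'_def wt_add wt_minus wt_cmul by linarith
      then show ?thesis unfolding i(2) pairing_real_vec by simp
    qed
    have "0 \<le> pairing m' (real_vec (column j V))"
      by (rule pairing_nonneg_hull[OF _ in_\<sigma>]) (rule nonneg)
    then have "0 \<le> wt (column j V) m'" unfolding pairing_real_vec by simp
    then show False unfolding m'_def wt_add wt_minus wt_cmul m(1) m1 by simp
  qed
next
  assume "j \<notin> I"
  then show "real_vec (column j V) \<in> convex_cone hull ((\<lambda>j. real_vec (column j V)) ` (- I))"
    by (intro hull_inc) simp
qed

text \<open>The cone of full dimension is generated by its rays, and these are columns of the fan
  matrix.\<close>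

lemma cone_in_I_Sigma:
  assumes cover: "\<Union>\<Sigma> = UNIV" and \<tau>: "\<tau> \<in> \<Sigma>"
  shows "\<exists>I\<in>I_Sigma \<Sigma> V. \<tau> \<subseteq> convex_cone hull ((\<lambda>j. real_vec (column j V)) ` (- I))"
proof -
  obtain \<sigma> where \<sigma>: "\<sigma> \<in> \<Sigma>" "\<tau> \<subseteq> \<sigma>" "dim \<sigma> = CARD('n)"
    using in_full_dimensional_cone[OF fan cover \<tau>] by blast
  define I where "I = {j. real_vec (column j V) \<notin> \<sigma>}"
  have "real_vec ` rays \<Sigma> \<sigma> = (\<lambda>j. real_vec (column j V)) ` (- I)"
  proof (rule subset_antisym; rule subsetI)
    fix x assume "x \<in> real_vec ` rays \<Sigma> \<sigma>"
    then obtain v where v: "v \<in> rays \<Sigma> \<sigma>" "x = real_vec v" by (elim imageE)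
    obtain j where j: "v = column j V" using v(1) unfolding rays_def by (elim CollectE conjE) (rule prim_col)
    then show "x \<in> (\<lambda>j. real_vec (column j V)) ` (- I)" using v unfolding rays_def I_def by simp
  next
    fix x assume "x \<in> (\<lambda>j. real_vec (column j V)) ` (- I)"
    then obtain j where "j \<notin> I" "x = real_vec (column j V)" by auto
    then show "x \<in> real_vec ` rays \<Sigma> \<sigma>" using col_prim unfolding rays_def I_def by simp
  qed
  then have eq: "\<sigma> = convex_cone hull ((\<lambda>j. real_vec (column j V)) ` (- I))" using rays_generate[OF fan \<sigma>(1)] by simp
  then have "I \<in> I_Sigma \<Sigma> V" using \<sigma>(1,3) unfolding I_Sigma_def Let_def by simp
  then show ?thesis using \<sigma>(2) eq by (intro bexI[of _ I]) simp_all
qed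

text \<open>Otherwise the cone would lie in a hyperplane.\<close>

lemma zero_of_vanishing_on_maximal_cone:
  assumes I: "I \<in> I_Sigma \<Sigma> V" and z: "\<And>j. j \<notin> I \<Longrightarrow> wt (column j V) m = 0"
  shows "m = 0"
proof -
  let ?S = "(\<lambda>j. real_vec (column j V)) ` (- I)"
  let ?c = "(\<chi> i. real_of_int (Poly_Mapping.lookup m i)) :: real ^ 'n::{finite,linorder}"
  have sub: "subspace {x. ?c \<bullet> x = 0}" by (rule subspace_hyperplane)
  have "?S \<subseteq> {x. ?c \<bullet> x = 0}" using z by (auto simp: pairing_inner[symmetric] pairing_real_vec)
  then have "convex_cone hull ?S \<subseteq> {x. ?c \<bullet> x = 0}" by (rule hull_minimal) (rule subspace_imp_convex_cone[OF sub])
  then have "span (convex_cone hull ?S) \<subseteq> {x. ?c \<bullet> x = 0}" by (rule span_minimal) (rule sub)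
  moreover have "span (convex_cone hull ?S) = UNIV"
    unfolding dim_eq_full[symmetric] using I_SigmaD(2)[OF I] by simp
  ultimately have "?c \<bullet> ?c = 0" by blast
  then have "?c = 0" by simp
  then show ?thesis by (intro poly_mapping_eqI) (simp add: vec_eq_iff)
qed

end

section \<open>The lattices of rows and columns\<close>

text \<open>The lattices are spanned by sets of vectors, in which equal rows or columns are
  identified; summation over the index set gives the same lattice.\<close>

lemma int_span_image:
  assumes I: "finite I"
  shows "int_span (f ` I) = {\<Sum>i\<in>I. c i *s f i | c. True}"
proof (rule subset_antisym; rule subsetI)
  fix x assume "x \<in> int_span (f ` I)"
  then obtain d where x: "x = (\<Sum>v\<in>f ` I. d v *s v)" unfolding int_span_def by auto
  obtain J where J: "J \<subseteq> I" "inj_on f J" "f ` J = f ` I"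
    using subset_image_inj[of "f ` I" f I] by auto
  have "x = (\<Sum>i\<in>J. d (f i) *s f i)"
    unfolding x J(3)[symmetric] by (simp add: sum.reindex[OF J(2)])
  also have "\<dots> = (\<Sum>i\<in>I. (if i \<in> J then d (f i) else 0) *s f i)"
    by (rule sum.mono_neutral_cong_left[OF I J(1)]) auto
  finally have "\<exists>c. x = (\<Sum>i\<in>I. c i *s f i)" by (rule exI[of _ "\<lambda>i. if i \<in> J then d (f i) else 0"])
  then show "x \<in> {\<Sum>i\<in>I. c i *s f i | c. True}" by simp
next
  fix x assume "x \<in> {\<Sum>i\<in>I. c i *s f i | c. True}"
  then obtain c where x: "x = (\<Sum>i\<in>I. c i *s f i)" by auto
  have "x = (\<Sum>v\<in>f ` I. \<Sum>i\<in>{i \<in> I. f i = v}. c i *s f i)"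
    unfolding x by (rule sum.image_gen[OF I])
  also have "\<dots> = (\<Sum>v\<in>f ` I. (\<Sum>i\<in>{i \<in> I. f i = v}. c i) *s v)"
    by (rule sum.cong[OF refl]) (simp add: vec_eq_iff sum_distrib_right)
  finally have "\<exists>d. x = (\<Sum>v\<in>f ` I. d v *s v)"
    by (intro exI[of _ "\<lambda>v. \<Sum>i\<in>{i \<in> I. f i = v}. c i"])
  then show "x \<in> int_span (f ` I)" unfolding int_span_def by simp
qed

lemma row_lattice_eq:
  fixes V :: "int ^ 'j ^ 'n::{finite,linorder}"
  shows "row_lattice V = range (row_combination V)"
proof -
  have rows: "rows V = (\<lambda>i. row i V) ` UNIV" unfolding rows_def by auto
  have comb: "row_combination V m = (\<Sum>i\<in>UNIV. Poly_Mapping.lookup m i *s row i V)" for m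
    unfolding row_combination_def by (simp add: vec_eq_iff wt_def column_def row_def)
  show ?thesis unfolding row_lattice_def rows int_span_image[OF finite]
  proof (rule subset_antisym; rule subsetI)
    fix x assume "x \<in> {\<Sum>i\<in>UNIV. c i *s row i V | c. True}"
    then obtain c where x: "x = (\<Sum>i\<in>UNIV. c i *s row i V)" by auto
    have "Poly_Mapping.lookup (Abs_poly_mapping c) = c" by (simp add: Abs_poly_mapping_inverse)
    then have "x = row_combination V (Abs_poly_mapping c)" unfolding comb x by simp
    then show "x \<in> range (row_combination V)" by (rule range_eqI)
  next
    fix x assume "x \<in> range (row_combination V)"
    then obtain m where "x = row_combination V m" by (rule rangeE)
    then show "x \<in> {\<Sum>i\<in>UNIV. c i *s row i V | c. True}" unfolding comb by auto
  qed
qed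

lemma mem_column_lattice: "x \<in> column_lattice Q I \<longleftrightarrow> (\<exists>a\<in>E_of I. Q *v a = x)"
proof -
  have prod: "Q *v a = (\<Sum>j\<in>I. (a $ j) *s column j Q)" if "a \<in> E_of I" for a
    unfolding matrix_mult_sum using that
    by (intro sum.mono_neutral_right) (auto simp: E_of_def)
  have "x \<in> column_lattice Q I \<longleftrightarrow> (\<exists>c. x = (\<Sum>j\<in>I. c j *s column j Q))"
    unfolding column_lattice_def int_span_image[OF finite] by simp
  also have "\<dots> \<longleftrightarrow> (\<exists>a\<in>E_of I. Q *v a = x)"
  proof
    assume "\<exists>c. x = (\<Sum>j\<in>I. c j *s column j Q)"
    then obtain c where x: "x = (\<Sum>j\<in>I. c j *s column j Q)" by (rule exE)
    have E: "(\<chi> j. if j \<in> I then c j else 0) \<in> E_of I" unfolding E_of_def by simp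
    have "Q *v (\<chi> j. if j \<in> I then c j else 0) = x" unfolding prod[OF E] x by simp
    then show "\<exists>a\<in>E_of I. Q *v a = x" using E by (rule bexI)
  next
    assume "\<exists>a\<in>E_of I. Q *v a = x"
    then obtain a where a: "a \<in> E_of I" "Q *v a = x" by (rule bexE)
    show "\<exists>c. x = (\<Sum>j\<in>I. c j *s column j Q)"
      using a(2)[symmetric] unfolding prod[OF a(1)] by (rule exI[of _ "\<lambda>j. a $ j"])
  qed
  finally show ?thesis .
qed

section \<open>The Picard group\<close>

locale graded_toric = toric \<Sigma> V \<XX> D
  for \<Sigma> :: "(real ^ 'n::{finite,linorder}) set set"
    and V :: "int ^ 'j::finite ^ 'n::{finite,linorder}"
    and \<XX> :: "('n, 'k::field) toric_field set set"
    and D :: "int ^ 'j \<Rightarrow> ('n, 'k) toric_field set \<Rightarrow>\<^sub>0 int" +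
  fixes \<phi> :: "(('n, 'k) toric_field set \<Rightarrow>\<^sub>0 int) set \<Rightarrow>
      (int ^ 'r) \<times> (('n, 'k) toric_field set \<Rightarrow>\<^sub>0 int) set"
    and Q :: "int ^ 'j ^ 'r"
  assumes phi: "\<phi> \<in> iso (Cl \<XX>) (integer_vectors \<times>\<times> (Cl \<XX>)\<lparr>carrier := Tors (Cl \<XX>)\<rparr>)"
    and weights: "weight_matrix \<XX> V \<phi> Q"
begin

lemma weight: "Q *v a = fst (\<phi> (divisor_class \<XX> (D a)))"
  using weights unfolding weight_matrix_def class_of_invariant_def D_def invariant_divisor_def by simp

lemma snd_phi_Tors: "snd (\<phi> (divisor_class \<XX> (D a))) \<in> Tors (Cl \<XX>)"
proof -
  have "bij_betw \<phi> (carrier (Cl \<XX>)) (carrier (integer_vectors \<times>\<times> (Cl \<XX>)\<lparr>carrier := Tors (Cl \<XX>)\<rparr>))"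
    using phi unfolding iso_def by simp
  from bij_betwE[OF this] divisor_class_in_Cl[OF D_carrier]
  have "\<phi> (divisor_class \<XX> (D a)) \<in> carrier (integer_vectors \<times>\<times> (Cl \<XX>)\<lparr>carrier := Tors (Cl \<XX>)\<rparr>)"
    by (rule bspec)
  then show ?thesis unfolding DirProd_def by auto
qed

lemma snd_phi_add: "snd (\<phi> (divisor_class \<XX> (D (a + b)))) =
    snd (\<phi> (divisor_class \<XX> (D a))) \<otimes>\<^bsub>Cl \<XX>\<^esub> snd (\<phi> (divisor_class \<XX> (D b)))"
proof -
  have hom: "\<phi> \<in> hom (Cl \<XX>) (integer_vectors \<times>\<times> (Cl \<XX>)\<lparr>carrier := Tors (Cl \<XX>)\<rparr>)"
    using phi unfolding iso_def by simp
  show ?thesis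
    unfolding D_add divisor_class_add[OF fan X_def D_carrier D_carrier]
      hom_mult[OF hom divisor_class_in_Cl[OF D_carrier] divisor_class_in_Cl[OF D_carrier]]
    by (simp add: DirProd_def case_prod_unfold)
qed

text \<open>The torsion component is additive, but not part of the weight matrix; it is followed
  along multiples of a divisor whose free component is zero.\<close>

lemma phi_multiple:
  assumes b: "Q *v b = 0"
  shows "\<phi> (divisor_class \<XX> (D (of_nat n *s b))) = (0, snd (\<phi> (divisor_class \<XX> (D b))) [^]\<^bsub>Cl \<XX>\<^esub> n)"
proof -
  let ?T = "\<lambda>a. snd (\<phi> (divisor_class \<XX> (D a)))"
  interpret Cl: group "Cl \<XX>" unfolding X_def by (rule group_Cl[OF fan])
  have T: "?T a \<in> carrier (Cl \<XX>)" for a using snd_phi_Tors[of a] unfolding Tors_def by simp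
  have step: "(of_nat (Suc n) :: int) *s b = of_nat n *s b + b" for n
    by (simp add: vec_eq_iff algebra_simps)
  have zero: "(of_nat 0 :: int) *s b = 0" by (simp add: vec_eq_iff)
  have T0: "?T 0 = \<one>\<^bsub>Cl \<XX>\<^esub>"
    using snd_phi_add[of 0 0] Cl.l_cancel_one[OF T[of 0] T[of 0]] by simp
  have "Q *v (of_nat n *s b) = 0 \<and> ?T (of_nat n *s b) = ?T b [^]\<^bsub>Cl \<XX>\<^esub> n"
  proof (induction n)
    case 0 show ?case unfolding zero T0 by simp
  next
    case (Suc n)
    show ?case unfolding step snd_phi_add matrix_vector_right_distrib using Suc b by simp
  qed
  then show ?thesis unfolding weight by (simp add: prod_eq_iff)
qed

text \<open>If \<open>Q b = 0\<close>, then the class of \<open>b\<close> is torsion, so that a multiple of \<open>b\<close> is the divisor of a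
  character. If \<open>b\<close> is moreover supported on the rays outside a cone of full dimension, then this character
  vanishes on the rays of the cone, and hence is trivial.\<close>

lemma kernel_meets_E_trivially:
  assumes I: "I \<in> I_Sigma \<Sigma> V" and b: "b \<in> E_of I" "Q *v b = 0"
  shows "b = 0"
proof -
  obtain N where N: "0 < (N::nat)" "snd (\<phi> (divisor_class \<XX> (D b))) [^]\<^bsub>Cl \<XX>\<^esub> N = \<one>\<^bsub>Cl \<XX>\<^esub>"
    using snd_phi_Tors[of b] unfolding Tors_def by blast
  have zero: "(of_nat 0 :: int) *s b = 0" by (simp add: vec_eq_iff)
  have "\<phi> (divisor_class \<XX> (D (of_nat N *s b))) = \<phi> (divisor_class \<XX> (D 0))"
    using phi_multiple[OF b(2), of N] phi_multiple[OF b(2), of 0] N(2) unfolding zero by simp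
  moreover have "inj_on \<phi> (carrier (Cl \<XX>))" using phi unfolding iso_def bij_betw_def by simp
  ultimately have "divisor_class \<XX> (D (of_nat N *s b)) = divisor_class \<XX> (D 0)"
    using divisor_class_in_Cl[OF D_carrier] divisor_class_in_Cl[OF D_carrier] by (simp add: inj_on_eq_iff)
  then have "D (of_nat N *s b) - D 0 \<in> principal_divisors \<XX>"
    unfolding divisor_class_eq_iff[OF fan X_def D_carrier D_carrier] .
  then have "\<exists>m. of_nat N *s b - 0 = row_combination V m" unfolding D_diff[symmetric] D_principal_iff .
  then obtain m where m: "of_nat N *s b = row_combination V m" by auto
  have Nb: "int N * b $ j = wt (column j V) m" for j
    using m unfolding row_combination_def by (simp add: vec_eq_iff)
  have "m = 0"
  proof (rule zero_of_vanishing_on_maximal_cone[OF I])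
    fix j assume "j \<notin> I"
    then show "wt (column j V) m = 0" using b(1) Nb[of j] unfolding E_of_def by simp
  qed
  then have "b $ j = 0" for j using Nb[of j] N(1) by (simp add: wt_zero)
  then show ?thesis by (simp add: vec_eq_iff)
qed

lemma a_of_eqI:
  assumes I: "I \<in> I_Sigma \<Sigma> V" and a: "a \<in> E_of I" "Q *v a = x"
  shows "a_of Q x I = a"
  unfolding a_of_def
proof (rule the_equality)
  show "a \<in> E_of I \<and> Q *v a = x" using a by simp
next
  fix a' assume a': "a' \<in> E_of I \<and> Q *v a' = x"
  have "a' - a \<in> E_of I" using a' a(1) unfolding E_of_def by simp
  moreover have "Q *v (a' - a) = 0"
    using matrix_vector_right_distrib[of Q "a' - a" a] a' a(2) by simp
  ultimately have "a' - a = 0" by (rule kernel_meets_E_trivially[OF I])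
  then show "a' = a" by simp
qed

lemma weight_row_combination: "Q *v (a - row_combination V m) = Q *v a"
proof -
  have "D (a - (a - row_combination V m)) \<in> principal_divisors \<XX>"
    unfolding D_principal_iff by (rule exI[of _ m]) simp
  then have "divisor_class \<XX> (D a) = divisor_class \<XX> (D (a - row_combination V m))"
    unfolding divisor_class_eq_iff[OF fan X_def D_carrier D_carrier] D_diff[symmetric] .
  then show ?thesis unfolding weight by simp
qed

text \<open>Subtracting from an invariant Cartier divisor of class \<open>x\<close> the character \<open>m\<^sub>I\<close> that
  defines it on the cone of \<open>I\<close> gives a divisor of class \<open>x\<close> supported in \<open>I\<close>, that is \<open>a\<^sub>I\<close>. Thus
  the differences of the \<open>a\<^sub>I\<close> are the divisors of the transition characters.\<close>

lemma Pic_imp_lattice_conditions: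
  assumes x: "(x, \<one>\<^bsub>Cl \<XX>\<^esub>) \<in> \<phi> ` Pic \<XX>"
  shows "x \<in> (\<Inter>I\<in>I_Sigma \<Sigma> V. column_lattice Q I)"
    and "\<forall>I\<in>I_Sigma \<Sigma> V. \<forall>J\<in>I_Sigma \<Sigma> V. a_of Q x I - a_of Q x J \<in> row_lattice V"
proof -
  obtain E where E: "E \<in> Cartier_divisors \<XX>" "(x, \<one>\<^bsub>Cl \<XX>\<^esub>) = \<phi> (divisor_class \<XX> E)"
    using x unfolding Pic_def by auto
  have Ec: "E \<in> carrier (Weil_divisors \<XX>)" using E(1) unfolding Cartier_divisors_def by blast
  obtain a where a: "D a - E \<in> principal_divisors \<XX>" using equivalent_invariant_divisor[OF Ec] by (rule exE)
  have cart: "D a \<in> Cartier_divisors \<XX>" using Cartier_add_principal[OF E(1) a] by simp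
  have "divisor_class \<XX> (D a) = divisor_class \<XX> E"
    unfolding divisor_class_eq_iff[OF fan X_def D_carrier Ec] by (rule a)
  then have Qa: "Q *v a = x" unfolding weight using E(2)[symmetric] by simp
  have "\<exists>m. a - row_combination V m \<in> E_of I" if I: "I \<in> I_Sigma \<Sigma> V" for I
  proof -
    obtain m where "\<forall>j\<in>- I. a $ j = wt (column j V) m"
      using Cartier_local_character[OF cart refl I_SigmaD(1)[OF I]] by (rule exE)
    then show ?thesis unfolding E_of_def row_combination_def by (intro exI[of _ m]) simp
  qed
  then obtain m where m: "\<And>I. I \<in> I_Sigma \<Sigma> V \<Longrightarrow> a - row_combination V (m I) \<in> E_of I" by metis
  have Qm: "Q *v (a - row_combination V (m I)) = x" for I unfolding weight_row_combination by (rule Qa)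
  show "x \<in> (\<Inter>I\<in>I_Sigma \<Sigma> V. column_lattice Q I)"
    using m Qm unfolding INT_iff mem_column_lattice by blast
  show "\<forall>I\<in>I_Sigma \<Sigma> V. \<forall>J\<in>I_Sigma \<Sigma> V. a_of Q x I - a_of Q x J \<in> row_lattice V"
  proof (intro ballI)
    fix I J assume I: "I \<in> I_Sigma \<Sigma> V" and J: "J \<in> I_Sigma \<Sigma> V"
    have "a_of Q x I - a_of Q x J = row_combination V (m J + - m I)"
      unfolding a_of_eqI[OF I m[OF I] Qm] a_of_eqI[OF J m[OF J] Qm] row_combination_def
        wt_add wt_minus
      by (simp add: vec_eq_iff)
    then show "a_of Q x I - a_of Q x J \<in> row_lattice V" unfolding row_lattice_eq by (rule range_eqI)
  qed
qed

text \<open>Conversely, let \<open>a = a\<^sub>I\<close> for a fixed \<open>I\<close>. On the rays of the cone of \<open>J\<close> the vector \<open>a\<^sub>J\<close>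
  vanishes, so that \<open>a\<close> agrees there with the character \<open>a - a\<^sub>J\<close>, and \<open>a\<close> is Cartier.\<close>

lemma lattice_conditions_imp_Pic:
  assumes cover: "\<Union>\<Sigma> = UNIV" and free: "\<phi> ` Pic \<XX> \<subseteq> UNIV \<times> {\<one>\<^bsub>Cl \<XX>\<^esub>}"
    and col: "x \<in> (\<Inter>I\<in>I_Sigma \<Sigma> V. column_lattice Q I)"
    and row: "\<forall>I\<in>I_Sigma \<Sigma> V. \<forall>J\<in>I_Sigma \<Sigma> V. a_of Q x I - a_of Q x J \<in> row_lattice V"
  shows "(x, \<one>\<^bsub>Cl \<XX>\<^esub>) \<in> \<phi> ` Pic \<XX>"
proof -
  have a_of: "a_of Q x I \<in> E_of I \<and> Q *v a_of Q x I = x" if I: "I \<in> I_Sigma \<Sigma> V" for I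
  proof -
    have "x \<in> column_lattice Q I" using col I by (rule INT_D)
    then obtain a where a: "a \<in> E_of I" "Q *v a = x" unfolding mem_column_lattice by (rule bexE)
    show ?thesis unfolding a_of_eqI[OF I a] using a by simp
  qed
  obtain \<tau>0 where "\<tau>0 \<in> \<Sigma>" using nonempty by blast
  then obtain I0 where I0: "I0 \<in> I_Sigma \<Sigma> V" using cone_in_I_Sigma[OF cover] by blast
  define a where "a = a_of Q x I0"
  have cart: "D a \<in> Cartier_divisors \<XX>"
  proof (rule Cartier_of_local_characters)
    fix \<tau> assume \<tau>: "\<tau> \<in> \<Sigma>"
    obtain I where I: "I \<in> I_Sigma \<Sigma> V" "\<tau> \<subseteq> convex_cone hull ((\<lambda>j. real_vec (column j V)) ` (- I))"
      using cone_in_I_Sigma[OF cover \<tau>] by (rule bexE)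
    have "a - a_of Q x I \<in> range (row_combination V)"
      using row I0 I(1) unfolding a_def row_lattice_eq by blast
    then obtain m where m: "a - a_of Q x I = row_combination V m" by (rule rangeE)
    have "a $ j = wt (column j V) m" if j: "real_vec (column j V) \<in> \<tau>" for j
    proof -
      have "j \<notin> I" using subsetD[OF I(2) j] unfolding ray_in_cone_iff[OF I(1)] .
      then have "a_of Q x I $ j = 0" using a_of[OF I(1)] unfolding E_of_def by simp
      moreover have "a $ j - a_of Q x I $ j = wt (column j V) m"
        using arg_cong[OF m, of "\<lambda>v. v $ j"] unfolding row_combination_def by simp
      ultimately show ?thesis by simp
    qed
    then show "\<exists>m. \<forall>j. real_vec (column j V) \<in> \<tau> \<longrightarrow> a $ j = wt (column j V) m" by blast
  qed
  then have P: "\<phi> (divisor_class \<XX> (D a)) \<in> \<phi> ` Pic \<XX>" unfolding Pic_def by simp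
  have "snd (\<phi> (divisor_class \<XX> (D a))) = \<one>\<^bsub>Cl \<XX>\<^esub>" using subsetD[OF free P] by (auto simp: mem_Times_iff)
  moreover have "fst (\<phi> (divisor_class \<XX> (D a))) = x"
    using a_of[OF I0] unfolding a_def weight by simp
  ultimately have "\<phi> (divisor_class \<XX> (D a)) = (x, \<one>\<^bsub>Cl \<XX>\<^esub>)" by (simp add: prod_eq_iff)
  then show ?thesis using P by simp
qed

end

theorem theorem3p2:
  fixes \<Sigma> :: "(real^'n::{finite,linorder}) set set"
    and \<XX> :: "('n, 'k::{alg_closed_field,field_char_0}) toric_field set set"
    and \<phi> :: "(('n, 'k) toric_field set \<Rightarrow>\<^sub>0 int) set \<Rightarrow>
                 (int^'r) \<times> (('n, 'k) toric_field set \<Rightarrow>\<^sub>0 int) set"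
    and V :: "int^'j^'n::{finite,linorder}"
    and Q :: "int^'j^'r"
    and x :: "int^'r"
  assumes "fan \<Sigma>"
    and "\<XX> = toric_variety \<Sigma>"
    and "complete_variety ground_field \<XX>"
    and "Q_factorial \<XX>"
    and "pure \<XX>"
    and "\<phi> \<in> iso (Cl \<XX>) (integer_vectors \<times>\<times> (Cl \<XX>)\<lparr>carrier := Tors (Cl \<XX>)\<rparr>)"
    and "\<phi> ` Pic \<XX> \<subseteq> UNIV \<times> {\<one>\<^bsub>Cl \<XX>\<^esub>}"
    and "fan_matrix \<Sigma> V"
    and "weight_matrix \<XX> V \<phi> Q"
  shows "(x, \<one>\<^bsub>Cl \<XX>\<^esub>) \<in> \<phi> ` Pic \<XX> \<longleftrightarrow>
    x \<in> (\<Inter>I\<in>I_Sigma \<Sigma> V. column_lattice Q I) \<and>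
    (\<forall>I\<in>I_Sigma \<Sigma> V. \<forall>J\<in>I_Sigma \<Sigma> V. a_of Q x I - a_of Q x J \<in> row_lattice V)"
proof -
  have cover: "\<Union>\<Sigma> = UNIV"
    by (rule complete_fan_covers[OF assms(1)]) (use assms(3) in \<open>simp only: assms(2)\<close>)
  then have "\<Sigma> \<noteq> {}" by auto
  then interpret graded_toric \<Sigma> V \<XX> "invariant_divisor V" \<phi> Q
    using assms(1,2,6,8,9) by unfold_locales simp_all
  show ?thesis
    using Pic_imp_lattice_conditions[of x] lattice_conditions_imp_Pic[OF cover assms(7), of x] by blast
qed

end
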